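(* Let $\alpha,\beta\in\mathbb{R}$ with $\sin(\beta-\alpha)\neq0$, let $\mu\in\mathbb{R}$ and $v\in L^2(0,\pi,\mathbb{C}^2)$, let $D=D(\mu,v)$ be the Dirac operator with non-local potential defined in the context, and assume $0\notin\sigma(D)$. Let $v_k=\langle v,u(\lambda_k(0),\cdot)\rangle$ ($k\in\mathbb{Z}$) be the Fourier coefficients of $v$ in the basis of eigenfunctions of $D_0$. Then the numbers $\mu|v_k|^2$ ($k\in\mathbb{Z}$) are uniquely determined by the spectrum $\sigma(D)=\{\lambda_k(\mu):k\in\mathbb{Z}\}$ (counted with multiplicity; $\alpha,\beta$ being given), and for every $p\in\mathbb{Z}$ $$\mu|v_p|^2=\frac{A}{\sin(\beta-\alpha)}\cdot\frac{\lambda_p(0)}{\lambda_p(\mu)}\,(\lambda_p(\mu)-\lambda_p(0))\;\mathrm{v.p.}\prod_{k\neq p}\frac{\lambda_k(0)}{\lambda_k(\mu)}\left(1+\frac{\lambda_k(\mu)-\lambda_k(0)}{\lambda_k(0)-\lambda_p(0)}\right),$$ where $$A=\sin(\beta-\alpha)\lim_{y\to\infty}\mathrm{v.p.}\prod_k\frac{1-\frac{iy}{\lambda_k(0)}}{1-\frac{iy}{\lambda_k(\mu)}}.$$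
   Context: $L^2(0,\pi,\mathbb{C}^2)$ has inner product $\langle f,g\rangle=\int_0^\pi(f_1\overline{g_1}+f_2\overline{g_2})\,dx$. For $\alpha\in\mathbb{R}$ put $\Phi(\alpha)=(\sin\alpha,\cos\alpha)^T$. The free Dirac operator $D_0$ acts by $(D_0y)(x)=\begin{pmatrix}0&1\\-1&0\end{pmatrix}y'(x)$ on the domain of all absolutely continuous $y:[0,\pi]\to\mathbb{C}^2$ with $y'\in L^2$ and $\langle y(0),\Phi(\alpha)\rangle_{\mathbb{C}^2}=0$, $\langle y(\pi),\Phi(\beta)\rangle_{\mathbb{C}^2}=0$. Its spectrum is simple: $\lambda_k(0)=k+\frac{\alpha-\beta}{\pi}$, $k\in\mathbb{Z}$, with orthonormal basis of eigenfunctions $u(\lambda_k(0),x)=\frac1{\sqrt\pi}(\cos(\lambda_k(0)x-\alpha),\sin(\lambda_k(0)x-\alpha))^T$. The operator $D=D(\mu,v)$ is $Dy=D_0y+\mu\langle y,v\rangle v$ on the same domain. Enumeration of $\sigma(D)$: put $\sigma_1=\{\lambda_k(0):v_k\neq0\}$ and $Q(\lambda)=1+\mu\sum_{s:\,v_s\ne0}\frac{|v_s|^2}{\lambda_s(0)-\lambda}$. If $v_k=0$ or $\mu=0$, then $\lambda_k(\mu)=\lambda_k(0)$. If $v_k\neq0$ and $\mu>0$ (resp. $\mu<0$), then $\lambda_k(\mu)$ is the unique zero of $Q$ in the open interval between $\lambda_k(0)$ and the next point of $\sigma_1$ to its right (resp. left), the interval being unbounded if there is no such point. This lists the eigenvalues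 of $D$ with multiplicity. $\mathrm{v.p.}\prod_k$ denotes $\lim_{N\to\infty}\prod_{|k|\le N}$ of the paired factors shown. *)

theory Defs
  imports "HOL-Analysis.Analysis" "HOL-Library.Function_Algebras"
begin

section \<open>The Hilbert space of square integrable functions on (0, pi) with values in C^2\<close>

text \<open>Elements are represented by functions on the reals; two functions represent the same
  element iff they agree almost everywhere on [0, pi]. The norm of complex ^ 2 is the
  Hermitian one.\<close>

abbreviation M_pi :: "real measure" where
  "M_pi \<equiv> lebesgue_on {0..pi}"

definition L2_pi :: "(real \<Rightarrow> complex ^ 2) set" where
  "L2_pi = {f. f \<in> borel_measurable M_pi \<and> integrable M_pi (\<lambda>x. (norm (f x))\<^sup>2)}"

definition cinner2 :: "complex ^ 2 \<Rightarrow> complex ^ 2 \<Rightarrow> complex" where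
  "cinner2 a b = a $ 1 * cnj (b $ 1) + a $ 2 * cnj (b $ 2)"

definition L2_inner :: "(real \<Rightarrow> complex ^ 2) \<Rightarrow> (real \<Rightarrow> complex ^ 2) \<Rightarrow> complex" where
  "L2_inner f g = (LINT x|M_pi. cinner2 (f x) (g x))"

definition L2_norm :: "(real \<Rightarrow> complex ^ 2) \<Rightarrow> real" where
  "L2_norm f = sqrt (LINT x|M_pi. (norm (f x))\<^sup>2)"


section \<open>The Dirac operator with non-local potential\<close>

definition abs_cont_on :: "real \<Rightarrow> real \<Rightarrow> (real \<Rightarrow> 'a::real_normed_vector) \<Rightarrow> bool" where
  "abs_cont_on a b f \<longleftrightarrow>
    (\<forall>\<epsilon>>0. \<exists>\<delta>>0. \<forall>(n::nat) s t.
      (\<forall>i<n. a \<le> s i \<and> s i \<le> t i \<and> t i \<le> b) \<and>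
      (\<forall>i<n. \<forall>j<n. i \<noteq> j \<longrightarrow> {s i<..<t i} \<inter> {s j<..<t j} = {}) \<and>
      (\<Sum>i<n. t i - s i) < \<delta>
      \<longrightarrow> (\<Sum>i<n. norm (f (t i) - f (s i))) < \<epsilon>)"

definition Phi :: "real \<Rightarrow> complex ^ 2" where
  "Phi \<alpha> = vector [of_real (sin \<alpha>), of_real (cos \<alpha>)]"

definition deriv_pi :: "(real \<Rightarrow> complex ^ 2) \<Rightarrow> real \<Rightarrow> complex ^ 2" where
  "deriv_pi y x = vector_derivative y (at x within {0..pi})"

text \<open>A function on [0, pi] is encoded by its extension by 0, so that distinct elements of the
  domain are distinct functions and kernels are honest vector spaces of functions.
  An absolutely continuous function is differentiable almost everywhere; this consequence is
  recorded because \<^term>\<open>vector_derivative\<close> is total, with a meaningless value at points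
  of non-differentiability.\<close>

definition dirac_dom :: "real \<Rightarrow> real \<Rightarrow> (real \<Rightarrow> complex ^ 2) set" where
  "dirac_dom \<alpha> \<beta> = {y.
     (\<forall>x. x \<notin> {0..pi} \<longrightarrow> y x = 0) \<and>
     abs_cont_on 0 pi y \<and>
     (AE x in M_pi. y differentiable (at x within {0..pi})) \<and>
     deriv_pi y \<in> L2_pi \<and>
     cinner2 (y 0) (Phi \<alpha>) = 0 \<and> cinner2 (y pi) (Phi \<beta>) = 0}"

definition dirac0 :: "(real \<Rightarrow> complex ^ 2) \<Rightarrow> real \<Rightarrow> complex ^ 2" where
  "dirac0 y x = (vector [vector [0, 1], vector [- 1, 0]] :: complex ^ 2 ^ 2) *v deriv_pi y x"

definition dirac :: "real \<Rightarrow> (real \<Rightarrow> complex ^ 2) \<Rightarrow> (real \<Rightarrow> complex ^ 2) \<Rightarrow> real \<Rightarrow> complex ^ 2" where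
  "dirac \<mu> v y x = dirac0 y x + (of_real \<mu> * L2_inner y v) *s v x"

definition dirac_resolvent_set :: "real \<Rightarrow> real \<Rightarrow> real \<Rightarrow> (real \<Rightarrow> complex ^ 2) \<Rightarrow> complex set" where
  "dirac_resolvent_set \<alpha> \<beta> \<mu> v = {z.
     (\<exists>C. \<forall>y\<in>dirac_dom \<alpha> \<beta>. L2_norm y \<le> C * L2_norm (\<lambda>x. dirac \<mu> v y x - z *s y x)) \<and>
     (\<forall>f\<in>L2_pi. \<exists>y\<in>dirac_dom \<alpha> \<beta>. AE x in M_pi. dirac \<mu> v y x - z *s y x = f x)}"

definition dirac_spectrum :: "real \<Rightarrow> real \<Rightarrow> real \<Rightarrow> (real \<Rightarrow> complex ^ 2) \<Rightarrow> complex set" where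
  "dirac_spectrum \<alpha> \<beta> \<mu> v = - dirac_resolvent_set \<alpha> \<beta> \<mu> v"

definition dirac_eigenspace ::
  "real \<Rightarrow> real \<Rightarrow> real \<Rightarrow> (real \<Rightarrow> complex ^ 2) \<Rightarrow> complex \<Rightarrow> (real \<Rightarrow> complex ^ 2) set" where
  "dirac_eigenspace \<alpha> \<beta> \<mu> v z =
     {y \<in> dirac_dom \<alpha> \<beta>. AE x in M_pi. dirac \<mu> v y x = z *s y x}"

definition fun_scale :: "complex \<Rightarrow> (real \<Rightarrow> complex ^ 2) \<Rightarrow> real \<Rightarrow> complex ^ 2" where
  "fun_scale c f = (\<lambda>x. c *s f x)"

lemma vector_space_fun_scale: "vector_space fun_scale"
  by unfold_locales (auto simp: fun_scale_def fun_eq_iff vec_eq_iff algebra_simps)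

text \<open>The operator is self-adjoint, so geometric and algebraic multiplicities coincide.\<close>

definition dirac_mult :: "real \<Rightarrow> real \<Rightarrow> real \<Rightarrow> (real \<Rightarrow> complex ^ 2) \<Rightarrow> complex \<Rightarrow> nat" where
  "dirac_mult \<alpha> \<beta> \<mu> v z = vector_space.dim fun_scale (dirac_eigenspace \<alpha> \<beta> \<mu> v z)"

definition same_spectrum_with_mult ::
  "real \<Rightarrow> real \<Rightarrow> real \<Rightarrow> (real \<Rightarrow> complex ^ 2) \<Rightarrow> real \<Rightarrow> (real \<Rightarrow> complex ^ 2) \<Rightarrow> bool" where
  "same_spectrum_with_mult \<alpha> \<beta> \<mu> v \<mu>' v' \<longleftrightarrow>
     dirac_spectrum \<alpha> \<beta> \<mu> v = dirac_spectrum \<alpha> \<beta> \<mu>' v' \<and>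
     (\<forall>z\<in>dirac_spectrum \<alpha> \<beta> \<mu> v. dirac_mult \<alpha> \<beta> \<mu> v z = dirac_mult \<alpha> \<beta> \<mu>' v' z)"


section \<open>Fourier coefficients and the enumeration of the eigenvalues\<close>

definition eig0 :: "real \<Rightarrow> real \<Rightarrow> int \<Rightarrow> real" where
  "eig0 \<alpha> \<beta> k = of_int k + (\<alpha> - \<beta>) / pi"

definition eigfun :: "real \<Rightarrow> real \<Rightarrow> real \<Rightarrow> complex ^ 2" where
  "eigfun \<alpha> l x = of_real (1 / sqrt pi) *s
     vector [of_real (cos (l * x - \<alpha>)), of_real (sin (l * x - \<alpha>))]"

definition fcoef :: "real \<Rightarrow> real \<Rightarrow> (real \<Rightarrow> complex ^ 2) \<Rightarrow> int \<Rightarrow> complex" where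
  "fcoef \<alpha> \<beta> v k = L2_inner v (eigfun \<alpha> (eig0 \<alpha> \<beta> k))"

definition sigma1 :: "real \<Rightarrow> real \<Rightarrow> (real \<Rightarrow> complex ^ 2) \<Rightarrow> real set" where
  "sigma1 \<alpha> \<beta> v = {eig0 \<alpha> \<beta> k |k. fcoef \<alpha> \<beta> v k \<noteq> 0}"

definition Qfun :: "real \<Rightarrow> real \<Rightarrow> real \<Rightarrow> (real \<Rightarrow> complex ^ 2) \<Rightarrow> real \<Rightarrow> real" where
  "Qfun \<alpha> \<beta> \<mu> v l =
     1 + \<mu> * (\<Sum>\<^sub>\<infinity>s\<in>{s. fcoef \<alpha> \<beta> v s \<noteq> 0}. (cmod (fcoef \<alpha> \<beta> v s))\<^sup>2 / (eig0 \<alpha> \<beta> s - l))"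

definition eig :: "real \<Rightarrow> real \<Rightarrow> real \<Rightarrow> (real \<Rightarrow> complex ^ 2) \<Rightarrow> int \<Rightarrow> real" where
  "eig \<alpha> \<beta> \<mu> v k =
    (if fcoef \<alpha> \<beta> v k = 0 \<or> \<mu> = 0 then eig0 \<alpha> \<beta> k
     else if \<mu> > 0 then
       (THE l. eig0 \<alpha> \<beta> k < l \<and> (\<forall>t\<in>sigma1 \<alpha> \<beta> v. eig0 \<alpha> \<beta> k < t \<longrightarrow> l < t) \<and>
               Qfun \<alpha> \<beta> \<mu> v l = 0)
     else
       (THE l. l < eig0 \<alpha> \<beta> k \<and> (\<forall>t\<in>sigma1 \<alpha> \<beta> v. t < eig0 \<alpha> \<beta> k \<longrightarrow> t < l) \<and>
               Qfun \<alpha> \<beta> \<mu> v l = 0))"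


section \<open>Principal value products\<close>

text \<open>The product over the indices in \<^term>\<open>S\<close> converges to \<^term>\<open>P\<close> in the
  principal value sense; only convergence of the symmetric partial products is meant, so the
  limit is allowed to be 0.\<close>

definition has_vp_prod :: "(int \<Rightarrow> 'a::real_normed_field) \<Rightarrow> int set \<Rightarrow> 'a \<Rightarrow> bool" where
  "has_vp_prod f S P \<longleftrightarrow> (\<lambda>N::nat. \<Prod>k\<in>{- int N..int N} \<inter> S. f k) \<longlonglongrightarrow> P"

end

(* The resolvent of the rank one perturbation is governed by the Herglotz type function
   Q(z) = 1 + sum_k m_k / (a_k - z) with a_k = k + (alpha - beta) / pi and m_k = mu |v_k|^2, whose
   zeros are the moved eigenvalues b_k. For finitely many non-zero m_k, comparing polynomials gives
   Q(z) = prod_k (b_k - z) / (a_k - z) and sum_k |b_k - a_k| <= sum_k |m_k|. This bound is uniform in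
   truncations of the sequence (m_k), so the tails of the products are uniformly close to 1 and the
   product formula, together with its residue at a_p, passes to the limit. Both formulas of the
   theorem follow from it, since Q(iy) tends to 1. The residue formula also gives uniqueness: as
   b_k - a_k tends to 0, two enumerations of the same multiset agree for large |k|, hence have the
   same symmetric partial products.

   That the b_k list the eigenvalues with multiplicity is read off the Fourier coefficients of
   functions in the domain. Existence of eigenfunctions needs no regularity theory: as 0 lies in the
   resolvent set, solving D w = z Y for the formal eigenfunction series Y gives w = Y. *)

theory Submission
  imports Defs
begin

section \<open>Rank one perturbations of an arithmetic progression\<close>

text \<open>The masses are known only to be absolutely summable, and no theory of entire functions
  is used to identify Q with a product; the only quantitative handle on the moved points is the
  comparison of the terms of order 1/t of a finite product and a finite sum at -t. Limits that may
  be 0 are handled by measuring errors relative to the partial products. The same estimate shows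
  that a zero limit forces a zero factor, so Q has no nonreal zeros and may stand in a denominator
  at iy. The constant A / sin(beta - alpha) is nothing but Q(0), because the product defining A has
  the value Q(0) / Q(iy). The monotonicity that locates the zeros needs masses of one sign. Negative
  mu is reduced to positive mu by the reflection k to -k, z to -z, which preserves all product
  formulas. On the operator side, coefficients of functions in the domain are square summable
  sequences divided by a_k, hence absolutely summable. Completeness is therefore needed only for
  continuous functions, and Parseval only with one factor in the domain.\<close>

definition pt :: "real \<Rightarrow> int \<Rightarrow> real" where
  "pt c k = of_int k + c"

text \<open>The function Q for arbitrary masses. The type is generic because the real version
  carries signs and monotonicity, the complex one the behaviour off the real axis. At a pole the
  offending summand is \<open>w k / 0\<close>, that is 0.\<close>

definition pert :: "real \<Rightarrow> (int \<Rightarrow> real) \<Rightarrow> 'a \<Rightarrow> 'a::{real_normed_field,banach}" where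
  "pert c w z = 1 + (\<Sum>\<^sub>\<infinity>k. of_real (w k) / (of_real (pt c k) - z))"

text \<open>Only points that carry mass bound the gap on the right, so it may run across massless
  points and is a half-line when no mass lies further right.\<close>

definition in_gap :: "real \<Rightarrow> (int \<Rightarrow> real) \<Rightarrow> int \<Rightarrow> real \<Rightarrow> bool" where
  "in_gap c w k l \<longleftrightarrow> pt c k < l \<and> (\<forall>j. w j \<noteq> 0 \<longrightarrow> pt c k < pt c j \<longrightarrow> l < pt c j)"

definition gap_root :: "real \<Rightarrow> (int \<Rightarrow> real) \<Rightarrow> int \<Rightarrow> real" where
  "gap_root c w k = (THE l. in_gap c w k l \<and> pert c w l = 0)"

lemma pt_less_iff [simp]: "pt c j < pt c k \<longleftrightarrow> j < k"
  and pt_le_iff [simp]: "pt c j \<le> pt c k \<longleftrightarrow> j \<le> k"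
  and pt_eq_iff [simp]: "pt c j = pt c k \<longleftrightarrow> j = k"
  by (auto simp: pt_def)

text \<open>Points at distance below 1 from \<open>z\<close> have indices within 2 of each other, so
  only finitely many distances compete with the default bound 1. Skipping a point equal to
  \<open>z\<close> allows \<open>z\<close> to be one of the points.\<close>

lemma pt_separation:
  fixes z :: "'a::real_normed_field"
  shows "\<exists>\<delta>>0. \<forall>k. of_real (pt c k) \<noteq> z \<longrightarrow> \<delta> \<le> norm (of_real (pt c k) - z)"
proof -
  define K where "K = {k. norm (of_real (pt c k) - z) < 1}"
  have "finite K"
  proof (cases "K = {}")
    case False
    then obtain k0 where k0: "k0 \<in> K" by auto
    have "K \<subseteq> {k0 - 2..k0 + 2}"
    proof
      fix k assume "k \<in> K"
      have "norm ((of_real (pt c k) - z) - (of_real (pt c k0) - z)) < 2"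
        using \<open>k \<in> K\<close> k0 norm_triangle_ineq4[of "of_real (pt c k) - z" "of_real (pt c k0) - z"]
        by (auto simp: K_def)
      also have "(of_real (pt c k) - z) - (of_real (pt c k0) - z) = of_real (of_int (k - k0))"
        by (simp add: pt_def)
      finally show "k \<in> {k0 - 2..k0 + 2}" by (simp only: norm_of_real) (simp add: abs_less_iff; linarith)
    qed
    then show ?thesis using finite_subset by blast
  qed auto
  define D where "D = insert 1 ((\<lambda>k. norm (of_real (pt c k) - z)) ` {k \<in> K. of_real (pt c k) \<noteq> z})"
  have D: "finite D" "D \<noteq> {}" using \<open>finite K\<close> by (auto simp: D_def)
  have "Min D > 0" using D by (subst Min_gr_iff) (auto simp: D_def)
  moreover have "Min D \<le> norm (of_real (pt c k) - z)" if "of_real (pt c k) \<noteq> z" for k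
  proof (cases "k \<in> K")
    case True
    then show ?thesis using D that by (intro Min_le) (auto simp: D_def)
  next
    case False
    have "Min D \<le> 1" using D by (intro Min_le) (auto simp: D_def)
    with False show ?thesis by (auto simp: K_def)
  qed
  ultimately show ?thesis by blast
qed

lemma pert_summable:
  fixes z :: "'a::{real_normed_field,banach}"
  assumes "m summable_on UNIV"
  shows "(\<lambda>k. of_real (m k) / (of_real (pt c k) - z)) summable_on UNIV"
proof -
  obtain \<delta> where d: "\<delta> > 0" "\<And>k. of_real (pt c k) \<noteq> z \<Longrightarrow> \<delta> \<le> norm (of_real (pt c k) - z)"
    using pt_separation by metis
  have "(\<lambda>k. inverse \<delta> * \<bar>m k\<bar>) summable_on UNIV"
    using summable_on_iff_abs_summable_on_real[THEN iffD1, OF assms]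
    by (intro summable_on_cmult_right) simp
  moreover have "norm (of_real (m k) / (of_real (pt c k) - z)) \<le> inverse \<delta> * \<bar>m k\<bar>" for k
  proof (cases "of_real (pt c k) = z")
    case False
    have "norm (of_real (m k) / (of_real (pt c k) - z)) = \<bar>m k\<bar> / norm (of_real (pt c k) - z)"
      by (simp add: norm_divide)
    also have "\<dots> \<le> \<bar>m k\<bar> / \<delta>"
      using d False by (intro divide_left_mono) (auto intro!: mult_pos_pos)
    finally show ?thesis by (simp add: field_simps)
  qed (use d in auto)
  ultimately have "(\<lambda>k. norm (of_real (m k) / (of_real (pt c k) - z))) summable_on UNIV"
    by (rule Infinite_Sum.abs_summable_on_comparison_test')
  then show ?thesis by (rule abs_summable_summable)
qed

lemma pert_has_sum:
  fixes z :: "'a::{real_normed_field,banach}"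
  assumes "m summable_on UNIV"
  shows "((\<lambda>k. of_real (m k) / (of_real (pt c k) - z)) has_sum (pert c m z - 1)) UNIV"
  using has_sum_infsum[OF pert_summable[OF assms]] by (simp add: pert_def)

lemma pert_has_sum_real:
  fixes z :: real
  assumes "m summable_on UNIV"
  shows "((\<lambda>k. m k / (pt c k - z)) has_sum (pert c m z - 1)) UNIV"
  using pert_has_sum[OF assms, of c z] by simp

lemma pert_complex_of_real:
  assumes "m summable_on UNIV"
  shows "pert c m (of_real z) = (of_real (pert c m z) :: complex)"
proof -
  have "((\<lambda>k. of_real (m k / (pt c k - z))) has_sum (of_real (pert c m z - 1) :: complex)) UNIV"
    by (intro has_sum_of_real pert_has_sum_real assms)
  then have "((\<lambda>k. of_real (m k) / (of_real (pt c k) - of_real z)) has_sum (of_real (pert c m z - 1) :: complex)) UNIV"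
    by simp
  from has_sum_unique[OF this pert_has_sum[OF assms]] show ?thesis by simp
qed

section \<open>Zeros of the perturbation function for nonnegative masses\<close>

locale point_masses =
  fixes c :: real and w :: "int \<Rightarrow> real"
  assumes w_nonneg: "\<And>k. 0 \<le> w k" and w_summable: "w summable_on UNIV"
begin

abbreviation "W \<equiv> infsum w UNIV"

lemma W_nonneg: "0 \<le> W"
  using w_nonneg by (intro infsum_nonneg) auto

text \<open>Each summand \<open>w j / (pt c j - x)\<close> increases in \<open>x\<close> on an
  interval that avoids its pole, and inside a gap no pole with mass is crossed. The summand of
  \<open>k\<close> makes the inequality strict.\<close>

lemma pert_mono:
  assumes "in_gap c w k l" "in_gap c w k h" "l < h" "w k \<noteq> 0"
  shows "pert c w l < pert c w h"
proof -
  have le: "w j / (pt c j - l) \<le> w j / (pt c j - h)" for j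
  proof (cases "w j = 0 \<or> w j > 0 \<and> pt c j > h")
    case True
    then show ?thesis
    proof
      assume "w j > 0 \<and> pt c j > h"
      then show ?thesis using assms(3) by (intro divide_left_mono) auto
    qed simp
  next
    case False
    with w_nonneg[of j] have wj: "w j > 0" "pt c j \<le> h" by (auto simp: not_less order_le_less)
    then have "pt c j \<le> pt c k" using assms(2) unfolding in_gap_def by (metis not_le order_less_irrefl)
    moreover have "pt c k < l" using assms by (simp add: in_gap_def)
    ultimately have "pt c j < l" "pt c j < h" using assms(3) by linarith+
    then have "w j / (l - pt c j) \<ge> w j / (h - pt c j)"
      using wj assms(3) by (intro divide_left_mono) auto
    then show ?thesis by (metis minus_diff_eq minus_divide_right neg_le_iff_le)
  qed
  have lt: "w k / (pt c k - l) < w k / (pt c k - h)"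
  proof -
    have "w k / (l - pt c k) > w k / (h - pt c k)"
      using assms w_nonneg[of k] by (intro divide_strict_left_mono) (auto simp: in_gap_def)
    then show ?thesis by (metis minus_diff_eq minus_divide_right neg_less_iff_less)
  qed
  have "pert c w l - 1 < pert c w h - 1"
    by (rule has_sum_strict_mono[OF pert_has_sum_real[OF w_summable] pert_has_sum_real[OF w_summable] le UNIV_I lt])
  then show ?thesis by simp
qed

lemma pert_continuous_on:
  assumes "in_gap c w k l" "in_gap c w k h"
  shows "continuous_on {l..h} (pert c w :: real \<Rightarrow> real)"
proof -
  obtain \<delta> where d: "\<delta> > 0" "\<And>j. pt c j \<noteq> h \<Longrightarrow> \<delta> \<le> \<bar>pt c j - h\<bar>"
    using pt_separation[of c h] by auto
  \<comment> \<open>A common distance from \<open>{l..h}\<close> to all points with mass: those up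
    to \<open>pt c k\<close> are at least \<open>l - pt c k\<close> away, those further right at
    least \<delta> away from \<open>h\<close>.\<close>
  define \<eta> where "\<eta> = min (l - pt c k) \<delta>"
  have "\<eta> > 0" using d assms by (auto simp: \<eta>_def in_gap_def)
  have dist: "\<eta> \<le> \<bar>pt c j - x\<bar>" if x: "x \<in> {l..h}" and "w j \<noteq> 0" for j x
  proof (cases "pt c j \<le> pt c k")
    case True
    then show ?thesis using x \<open>\<eta> > 0\<close> unfolding \<eta>_def atLeastAtMost_iff by linarith
  next
    case False
    then have "pt c j > h" using assms \<open>w j \<noteq> 0\<close> by (auto simp: in_gap_def)
    then have "\<delta> \<le> pt c j - h" using d(2)[of j] by auto
    then show ?thesis using x by (auto simp: \<eta>_def)
  qed
  have "uniform_limit {l..h} (\<lambda>F x. \<Sum>j\<in>F. w j / (pt c j - x)) (\<lambda>x. \<Sum>\<^sub>\<infinity>j. w j / (pt c j - x))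
          (finite_subsets_at_top UNIV)"
  proof (rule Weierstrass_m_test_general)
    show "(\<lambda>j. w j * inverse \<eta>) summable_on UNIV"
      by (intro summable_on_cmult_left w_summable)
    show "norm (w j / (pt c j - x)) \<le> w j * inverse \<eta>" if "x \<in> {l..h}" for j x
    proof (cases "w j = 0")
      case False
      have "norm (w j / (pt c j - x)) = w j / \<bar>pt c j - x\<bar>" using w_nonneg[of j] by simp
      also have "\<dots> \<le> w j / \<eta>" using dist[OF that False] \<open>\<eta> > 0\<close> w_nonneg[of j]
        by (intro divide_left_mono) auto
      finally show ?thesis by (simp add: field_simps)
    qed auto
  qed
  moreover have "continuous_on {l..h} (\<lambda>x. \<Sum>j\<in>F. w j / (pt c j - x))" for F
  proof (intro continuous_on_sum)
    fix j
    show "continuous_on {l..h} (\<lambda>x. w j / (pt c j - x))"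
    proof (cases "w j = 0")
      case False
      then show ?thesis using dist[of _ j] \<open>\<eta> > 0\<close> by (intro continuous_intros) fastforce
    qed simp
  qed
  ultimately have "continuous_on {l..h} (\<lambda>x. \<Sum>\<^sub>\<infinity>j. w j / (pt c j - x))"
    by (intro uniform_limit_theorem[where F = "finite_subsets_at_top UNIV"]) auto
  then show ?thesis unfolding pert_def by (auto intro!: continuous_intros)
qed

lemma in_gap_convex:
  "in_gap c w k l \<Longrightarrow> in_gap c w k h \<Longrightarrow> l \<le> x \<Longrightarrow> x \<le> h \<Longrightarrow> in_gap c w k x"
  by (force simp: in_gap_def)

lemma ex_pert_neg:
  assumes "w k \<noteq> 0"
  shows "\<exists>l. in_gap c w k l \<and> pert c w l < 0"
proof -
  have wk: "w k > 0" using assms w_nonneg[of k] by auto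
  \<comment> \<open>By \<open>e <= 1/2\<close> the masses right of \<open>k\<close> are at distance
    at least 1/2 and contribute at most \<open>2 * W\<close>; those on the left contribute nothing
    positive. The second bound makes the summand of \<open>k\<close> at most
    \<open>- (2 + 2 * W)\<close>, so the value is at most -1.\<close>
  define e where "e = min (1/2) (w k / (2 + 2 * W))"
  have e: "0 < e" "e \<le> 1/2" "e \<le> w k / (2 + 2 * W)"
    using wk W_nonneg unfolding e_def by (simp, linarith, simp)
  have sum: "((\<lambda>j. 2 * w j + (if j = k then - (w k / e) else 0)) has_sum (2 * W + - (w k / e))) UNIV"
  proof (intro has_sum_add has_sum_cmult_right has_sum_infsum w_summable)
    have "((\<lambda>j. if j = k then - (w k / e) else 0) has_sum (- (w k / e))) {k}"
      by (rule has_sum_finiteI) auto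
    then show "((\<lambda>j. if j = k then - (w k / e) else 0) has_sum (- (w k / e))) UNIV"
      by (rule has_sum_cong_neutral[THEN iffD1, rotated -1]) auto
  qed
  have le: "w j / (pt c j - (pt c k + e)) \<le> 2 * w j + (if j = k then - (w k / e) else 0)" for j
  proof -
    consider "j < k" | "j = k" | "j > k" by linarith
    then show ?thesis
    proof cases
      case 1
      then have "pt c j - (pt c k + e) < 0" using e by (auto simp: pt_def)
      then have "w j / (pt c j - (pt c k + e)) \<le> 0" using w_nonneg[of j] by (simp add: divide_nonneg_neg)
      then show ?thesis using 1 w_nonneg[of j] by auto
    next
      case 3
      then have "real_of_int j \<ge> of_int k + 1" by linarith
      then have "pt c j - (pt c k + e) \<ge> 1/2" using e by (auto simp: pt_def)
      then have "w j / (pt c j - (pt c k + e)) \<le> w j / (1/2)" using w_nonneg[of j]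
        by (intro divide_left_mono) auto
      then show ?thesis using 3 by auto
    qed (use wk in auto)
  qed
  have "pert c w (pt c k + e) - 1 \<le> 2 * W + - (w k / e)"
    by (rule has_sum_mono[OF pert_has_sum_real[OF w_summable] sum le])
  moreover have "w k / e \<ge> 2 + 2 * W"
    using e wk W_nonneg by (simp add: field_simps)
  ultimately have "pert c w (pt c k + e) < 0" by linarith
  moreover have "in_gap c w k (pt c k + e)"
    unfolding in_gap_def using e
  proof (intro conjI allI impI)
    fix j assume "pt c k < pt c j"
    then have "real_of_int j \<ge> of_int k + 1" by (simp; linarith)
    then show "pt c k + e < pt c j" using e by (auto simp: pt_def)
  qed auto
  ultimately show ?thesis by blast
qed

lemma ex_pert_pos:
  assumes "w k \<noteq> 0"
  shows "\<exists>h. in_gap c w k h \<and> pert c w h > 0"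
proof (cases "\<exists>n>k. w n \<noteq> 0")
  case True
  \<comment> \<open>The next index with mass; \<open>LEAST\<close> runs over natural offsets because
    the integers are not well-ordered.\<close>
  define n where "n = k + int (LEAST d. d > 0 \<and> w (k + int d) \<noteq> 0)"
  from True obtain n' where n': "n' > k" "w n' \<noteq> 0" by auto
  have ex: "\<exists>d. d > 0 \<and> w (k + int d) \<noteq> 0"
    using n' by (intro exI[of _ "nat (n' - k)"]) auto
  have n: "n > k" "w n \<noteq> 0" using LeastI_ex[OF ex] by (auto simp: n_def)
  have least: "n \<le> j" if "j > k" "w j \<noteq> 0" for j
  proof -
    have "(LEAST d. d > 0 \<and> w (k + int d) \<noteq> 0) \<le> nat (j - k)"
      by (rule Least_le) (use that in auto)
    then show ?thesis using that unfolding n_def by linarith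
  qed
  have wn: "w n > 0" using n w_nonneg[of n] by auto
  \<comment> \<open>The same choice as at the left end of a gap, now approaching the pole at
    \<open>n\<close> from below, where its summand is large and positive.\<close>
  define e where "e = min (1/2) (w n / (2 + 2 * W))"
  have e: "0 < e" "e \<le> 1/2" "e \<le> w n / (2 + 2 * W)"
    using wn W_nonneg unfolding e_def by (simp, linarith, simp)
  have sum: "((\<lambda>j. - 2 * w j + (if j = n then w n / e else 0)) has_sum (- 2 * W + w n / e)) UNIV"
  proof (intro has_sum_add has_sum_cmult_right has_sum_infsum w_summable)
    have "((\<lambda>j. if j = n then w n / e else 0) has_sum (w n / e)) {n}"
      by (rule has_sum_finiteI) auto
    then show "((\<lambda>j. if j = n then w n / e else 0) has_sum (w n / e)) UNIV"
      by (rule has_sum_cong_neutral[THEN iffD1, rotated -1]) auto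
  qed
  have le: "- 2 * w j + (if j = n then w n / e else 0) \<le> w j / (pt c j - (pt c n - e))" for j
  proof -
    consider "j < n" | "j = n" | "j > n" by linarith
    then show ?thesis
    proof cases
      case 3
      then have "pt c j - (pt c n - e) > 0" using e by (auto simp: pt_def)
      then have "w j / (pt c j - (pt c n - e)) \<ge> 0" using w_nonneg[of j] by simp
      then show ?thesis using 3 w_nonneg[of j] by auto
    next
      case 1
      then have "real_of_int j \<le> of_int n - 1" by linarith
      then have "pt c n - e - pt c j \<ge> 1/2" using e by (auto simp: pt_def)
      then have "w j / (pt c n - e - pt c j) \<le> w j / (1/2)" using w_nonneg[of j]
        by (intro divide_left_mono) auto
      moreover have "w j / (pt c j - (pt c n - e)) = - (w j / (pt c n - e - pt c j))"
        by (metis minus_diff_eq minus_divide_right)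
      ultimately show ?thesis using 1 by auto
    qed (use wn in auto)
  qed
  have "- 2 * W + w n / e \<le> pert c w (pt c n - e) - 1"
    by (rule has_sum_mono[OF sum pert_has_sum_real[OF w_summable] le])
  moreover have "w n / e \<ge> 2 + 2 * W"
    using e wn W_nonneg by (simp add: field_simps)
  ultimately have "pert c w (pt c n - e) > 0" by linarith
  moreover have "in_gap c w k (pt c n - e)"
    unfolding in_gap_def
  proof (intro conjI allI impI)
    have "real_of_int n \<ge> of_int k + 1" using n by linarith
    then show "pt c k < pt c n - e" using e by (auto simp: pt_def)
  next
    fix j assume "w j \<noteq> 0" "pt c k < pt c j"
    then have "n \<le> j" using least by auto
    then show "pt c n - e < pt c j" using e by (auto simp: pt_def)
  qed
  ultimately show ?thesis by blast
next
  case False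
  \<comment> \<open>With no mass further right every pole with mass is at least \<open>T\<close>
    away, so the sum is at least \<open>- W / T\<close>, which exceeds -1.\<close>
  define T where "T = W + 1"
  have T: "T > 0" "W < T" using W_nonneg by (auto simp: T_def)
  have sum: "((\<lambda>j. w j * (- inverse T)) has_sum (W * (- inverse T))) UNIV"
    by (intro has_sum_cmult_left has_sum_infsum w_summable)
  have le: "w j * (- inverse T) \<le> w j / (pt c j - (pt c k + T))" for j
  proof (cases "w j = 0")
    case False
    with \<open>\<not> (\<exists>n>k. w n \<noteq> 0)\<close> have "j \<le> k" by force
    then have "T \<le> pt c k + T - pt c j" by (simp add: pt_def)
    moreover from this T have "0 < pt c k + T - pt c j" by linarith
    ultimately have "w j / (pt c k + T - pt c j) \<le> w j / T"
      using T w_nonneg[of j] by (intro divide_left_mono mult_pos_pos)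
    moreover have "w j / (pt c j - (pt c k + T)) = - (w j / (pt c k + T - pt c j))"
      by (metis minus_diff_eq minus_divide_right)
    ultimately show ?thesis by (simp add: field_simps)
  qed auto
  have "W * (- inverse T) \<le> pert c w (pt c k + T) - 1"
    by (rule has_sum_mono[OF sum pert_has_sum_real[OF w_summable] le])
  moreover have "W * inverse T < 1" using T by (simp add: field_simps)
  ultimately have "pert c w (pt c k + T) > 0" by simp
  moreover have "in_gap c w k (pt c k + T)"
    using False T unfolding in_gap_def by force
  ultimately show ?thesis by blast
qed

lemma gap_root_unique:
  assumes "in_gap c w k l" "pert c w l = 0" "in_gap c w k h" "pert c w h = 0" "w k \<noteq> 0"
  shows "l = h"
  using pert_mono[of k l h] pert_mono[of k h l] assms by (metis linorder_neqE order_less_irrefl)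

lemma gap_root:
  assumes "w k \<noteq> 0"
  shows "in_gap c w k (gap_root c w k)" "pert c w (gap_root c w k) = 0"
proof -
  obtain l where l: "in_gap c w k l" "pert c w l < 0" using ex_pert_neg[OF assms] by auto
  obtain h where h: "in_gap c w k h" "pert c w h > 0" using ex_pert_pos[OF assms] by auto
  have "l \<le> h"
  proof (rule ccontr)
    assume "\<not> l \<le> h"
    then show False using pert_mono[of k h l] l h assms by auto
  qed
  obtain x where x: "l \<le> x" "x \<le> h" "pert c w x = 0"
    using IVT'[OF less_imp_le less_imp_le \<open>l \<le> h\<close> pert_continuous_on[OF l(1) h(1)]] l h by blast
  have "\<exists>!l. in_gap c w k l \<and> pert c w l = 0"
    using x in_gap_convex[OF l(1) h(1) x(1,2)] gap_root_unique assms by blast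
  from theI'[OF this] show "in_gap c w k (gap_root c w k)" "pert c w (gap_root c w k) = 0"
    unfolding gap_root_def by auto
qed

lemma gap_root_eqI:
  assumes "in_gap c w k l" "pert c w l = 0" "w k \<noteq> 0"
  shows "gap_root c w k = l"
  using gap_root_unique assms gap_root[OF assms(3)] by blast

lemma gap_root_gt: "w k \<noteq> 0 \<Longrightarrow> pt c k < gap_root c w k"
  using gap_root(1) by (auto simp: in_gap_def)

lemma gap_root_strict_mono:
  assumes "w j \<noteq> 0" "w k \<noteq> 0" "j < k"
  shows "gap_root c w j < gap_root c w k"
  using gap_root(1)[OF assms(1)] gap_root_gt[OF assms(2)] assms by (force simp: in_gap_def)

lemma gap_root_inj: "w j \<noteq> 0 \<Longrightarrow> w k \<noteq> 0 \<Longrightarrow> gap_root c w j = gap_root c w k \<Longrightarrow> j = k"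
  using gap_root_strict_mono[of j k] gap_root_strict_mono[of k j] by (metis linorder_neqE order_less_irrefl)

text \<open>Only poles with mass are avoided: a root may fall on a massless point, and this
  coincidence is how a double eigenvalue arises.\<close>

lemma gap_root_not_pole: "w k \<noteq> 0 \<Longrightarrow> w j \<noteq> 0 \<Longrightarrow> gap_root c w k \<noteq> pt c j"
  using gap_root(1)[of k] by (force simp: in_gap_def)

text \<open>The root belongs to the last mass on its left. Such a mass exists because otherwise all
  summands would be nonnegative and the value at least 1.\<close>

lemma pert_root_is_gap_root:
  assumes "pert c w z = 0" and "\<And>j. w j \<noteq> 0 \<Longrightarrow> z \<noteq> pt c j"
  shows "\<exists>k. w k \<noteq> 0 \<and> gap_root c w k = z"
proof -
  have "\<exists>j. w j \<noteq> 0 \<and> pt c j < z"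
  proof (rule ccontr)
    assume neg: "\<not> ?thesis"
    have "0 \<le> pert c w z - 1"
    proof (rule has_sum_nonneg[OF pert_has_sum_real[OF w_summable]])
      fix j
      show "0 \<le> w j / (pt c j - z)"
        using w_nonneg[of j] neg assms(2)[of j] by (cases "w j = 0") (auto simp: not_less)
    qed
    then show False using assms by simp
  qed
  then obtain j where j: "w j \<noteq> 0" "pt c j < z" by auto
  define k where "k = Max {i. w i \<noteq> 0 \<and> pt c i < z \<and> j \<le> i}"
  have "{i. w i \<noteq> 0 \<and> pt c i < z \<and> j \<le> i} \<subseteq> {j..\<lceil>z - c\<rceil>}"
    by (auto simp: pt_def) linarith
  then have fin: "finite {i. w i \<noteq> 0 \<and> pt c i < z \<and> j \<le> i}" using finite_subset by blast
  have k: "w k \<noteq> 0" "pt c k < z" "j \<le> k"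
    using Max_in[OF fin] j unfolding k_def by fastforce+
  have max: "i \<le> k" if "w i \<noteq> 0" "pt c i < z" for i
    using Max_ge[OF fin, of i] that k unfolding k_def by (cases "j \<le> i") (auto simp: k_def)
  have "in_gap c w k z"
    unfolding in_gap_def using k max assms(2) by (metis pt_less_iff linorder_neqE not_le)
  with k assms gap_root_eqI show ?thesis by blast
qed

end

section \<open>The product formula\<close>

text \<open>At a massless index \<open>gap_root\<close> is either unspecified or the root of another
  index, hence the explicit 0.\<close>

definition shift :: "real \<Rightarrow> (int \<Rightarrow> real) \<Rightarrow> int \<Rightarrow> real" where
  "shift c w k = (if w k = 0 then 0 else gap_root c w k - pt c k)"

definition trunc :: "(int \<Rightarrow> real) \<Rightarrow> nat \<Rightarrow> int \<Rightarrow> real" where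
  "trunc w N k = (if \<bar>k\<bar> \<le> int N then w k else 0)"

text \<open>Induction through \<open>(1 + f x) * P - 1 = (1 + f x) * (P - 1) + f x\<close> and
  \<open>1 + t <= exp t\<close>. It turns a small sum of norms into a product close to 1.\<close>

lemma norm_prod_one_plus_minus_one_le:
  fixes f :: "'b \<Rightarrow> 'a::real_normed_field"
  shows "norm ((\<Prod>k\<in>F. 1 + f k) - 1) \<le> exp (\<Sum>k\<in>F. norm (f k)) - 1"
proof (induction F rule: infinite_finite_induct)
  case (insert x F)
  let ?P = "\<Prod>k\<in>F. 1 + f k" and ?s = "\<Sum>k\<in>F. norm (f k)"
  have "norm ((\<Prod>k\<in>insert x F. 1 + f k) - 1) = norm ((1 + f x) * (?P - 1) + f x)"
    using insert.hyps by (simp add: algebra_simps)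
  also have "\<dots> \<le> (1 + norm (f x)) * norm (?P - 1) + norm (f x)"
    using norm_triangle_ineq[of 1 "f x"]
    by (intro norm_triangle_le add_mono order_refl) (simp add: norm_mult mult_right_mono)
  also have "\<dots> \<le> (1 + norm (f x)) * (exp ?s - 1) + norm (f x)"
    using insert.IH by (intro add_mono mult_left_mono) auto
  also have "\<dots> = (1 + norm (f x)) * exp ?s - 1"
    by (simp add: algebra_simps)
  also have "\<dots> \<le> exp (norm (f x)) * exp ?s - 1"
    by (intro diff_right_mono mult_right_mono) auto
  finally show ?case using insert.hyps by (simp add: exp_add)
qed auto

lemma one_plus_sum_le_prod:
  fixes f :: "'b \<Rightarrow> real"
  assumes "finite F" "\<And>k. k \<in> F \<Longrightarrow> 0 \<le> f k"
  shows "1 + (\<Sum>k\<in>F. f k) \<le> (\<Prod>k\<in>F. 1 + f k)"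
  using assms
proof (induction F)
  case (insert x F)
  have "1 + (\<Sum>k\<in>F. f k) \<le> (\<Prod>k\<in>F. 1 + f k)" using insert by auto
  moreover have "0 \<le> (\<Sum>k\<in>F. f k)" "0 \<le> f x" using insert by (auto intro: sum_nonneg)
  then have "f x * 1 \<le> f x * (1 + (\<Sum>k\<in>F. f k))" by (intro mult_left_mono) auto
  moreover have "f x * (1 + (\<Sum>k\<in>F. f k)) \<le> f x * (\<Prod>k\<in>F. 1 + f k)"
    using calculation(1) \<open>0 \<le> f x\<close> by (intro mult_left_mono) auto
  ultimately show ?case using insert.hyps by (simp add: algebra_simps)
qed auto

text \<open>The tails of the products are uniformly close to 1, because the numerators are uniformly
  summable while the denominators tend to infinity.\<close>

lemma vp_prod_interchange:
  fixes d :: "nat \<Rightarrow> int \<Rightarrow> 'a::real_normed_field"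
  assumes sum_le: "\<And>N F. finite F \<Longrightarrow> (\<Sum>k\<in>F. norm (d N k)) \<le> M"
    and lim: "\<And>k. (\<lambda>N. d N k) \<longlonglongrightarrow> d' k"
    and inf: "\<And>R. \<exists>n::nat. \<forall>k. int n < \<bar>k\<bar> \<longrightarrow> R \<le> norm (e k)"
    and X: "\<And>N. B N * (\<Prod>k\<in>{- int N..int N}. 1 + d N k / e k) = X N"
    and B: "B \<longlonglongrightarrow> B'" and X': "X \<longlonglongrightarrow> X'"
  shows "(\<lambda>n::nat. B' * (\<Prod>k\<in>{- int n..int n}. 1 + d' k / e k)) \<longlonglongrightarrow> X'"
    and "\<forall>\<^sub>F n in sequentially. norm (B' * (\<Prod>k\<in>{- int n..int n}. 1 + d' k / e k)) \<le> 2 * norm X'"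
proof -
  define I where "I n = {- int n..int n}" for n
  define P where "P n = B' * (\<Prod>k\<in>I n. 1 + d' k / e k)" for n
  have "0 \<le> M" using sum_le[of "{}"] by simp
  \<comment> \<open>The error is measured relative to \<open>P n\<close>, which splits off as a
    common factor; the limit itself may be 0 and does not yet control the partial products.\<close>
  have close: "\<exists>n0. \<forall>n\<ge>n0. norm (X' - P n) \<le> norm (P n) * \<epsilon>" if "\<epsilon> > 0" for \<epsilon>
  proof -
    \<comment> \<open>Chosen so that \<open>M / R <= ln (1 + \<epsilon>)\<close>; the added 1 keeps
      \<open>R\<close> positive when \<open>M\<close> is 0.\<close>
    define R where "R = (M + 1) / ln (1 + \<epsilon>)"
    have R: "R > 0" "exp (M / R) \<le> 1 + \<epsilon>"
    proof -
      have "ln (1 + \<epsilon>) > 0" using that by simp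
      then show "R > 0" using \<open>0 \<le> M\<close> by (simp add: R_def)
      have "M / R = ln (1 + \<epsilon>) * (M / (M + 1))" by (simp add: R_def)
      also have "\<dots> \<le> ln (1 + \<epsilon>) * 1" using \<open>ln (1 + \<epsilon>) > 0\<close> \<open>0 \<le> M\<close>
        by (intro mult_left_mono) auto
      finally have "exp (M / R) \<le> exp (ln (1 + \<epsilon>))" by simp
      then show "exp (M / R) \<le> 1 + \<epsilon>" using that by simp
    qed
    obtain n0 where n0: "\<And>k. int n0 < \<bar>k\<bar> \<Longrightarrow> R \<le> norm (e k)" using inf by blast
    have "norm (X' - P n) \<le> norm (P n) * \<epsilon>" if "n \<ge> n0" for n
    proof (rule tendsto_le[OF sequentially_bot])
      show "(\<lambda>N. norm (X N - B N * (\<Prod>k\<in>I n. 1 + d N k / e k))) \<longlonglongrightarrow> norm (X' - P n)"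
        unfolding P_def divide_inverse by (intro tendsto_intros X' B lim)
      show "(\<lambda>N. norm (B N * (\<Prod>k\<in>I n. 1 + d N k / e k)) * \<epsilon>) \<longlonglongrightarrow> norm (P n) * \<epsilon>"
        unfolding P_def divide_inverse by (intro tendsto_intros X' B lim)
      show "\<forall>\<^sub>F N in sequentially. norm (X N - B N * (\<Prod>k\<in>I n. 1 + d N k / e k))
              \<le> norm (B N * (\<Prod>k\<in>I n. 1 + d N k / e k)) * \<epsilon>"
        using eventually_ge_at_top[of n]
      proof eventually_elim
        case (elim N)
        let ?T = "\<Prod>k\<in>I N - I n. 1 + d N k / e k" and ?Q = "B N * (\<Prod>k\<in>I n. 1 + d N k / e k)"
        have "(\<Prod>k\<in>I N. 1 + d N k / e k) = ?T * (\<Prod>k\<in>I n. 1 + d N k / e k)"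
          by (rule prod.subset_diff) (use elim in \<open>auto simp: I_def\<close>)
        then have "X N - ?Q = ?Q * (?T - 1)"
          using X[of N] by (simp add: I_def algebra_simps)
        moreover have "norm (?T - 1) \<le> \<epsilon>"
        proof -
          have "(\<Sum>k\<in>I N - I n. norm (d N k / e k)) \<le> (\<Sum>k\<in>I N - I n. norm (d N k) / R)"
          proof (rule sum_mono)
            fix k assume "k \<in> I N - I n"
            then have "R \<le> norm (e k)" using that by (intro n0) (auto simp: I_def)
            then show "norm (d N k / e k) \<le> norm (d N k) / R"
              using R by (auto simp: norm_divide intro!: divide_left_mono mult_pos_pos)
          qed
          also have "\<dots> \<le> M / R"
            using sum_le[of "I N - I n" N] R
            by (auto simp: sum_divide_distrib[symmetric] I_def intro!: divide_right_mono)
          finally have "exp (\<Sum>k\<in>I N - I n. norm (d N k / e k)) \<le> exp (M / R)" by simp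
          with norm_prod_one_plus_minus_one_le[of "\<lambda>k. d N k / e k" "I N - I n"] R(2)
          show ?thesis by linarith
        qed
        ultimately show ?case by (simp add: norm_mult mult_left_mono)
      qed
    qed
    then show ?thesis by blast
  qed
  \<comment> \<open>With tolerance 1/2 the relative estimate bounds the partial products by the
    limit. In particular they vanish eventually if the limit is 0, which later excludes nonreal
    zeros.\<close>
  have bound: "\<exists>n0. \<forall>n\<ge>n0. norm (P n) \<le> 2 * norm X'"
  proof -
    obtain n0 where n0: "\<And>n. n \<ge> n0 \<Longrightarrow> norm (X' - P n) \<le> norm (P n) * (1/2)"
      using close[of "1/2"] by auto
    have "norm (P n) \<le> 2 * norm X'" if "n \<ge> n0" for n
      using n0[OF that] norm_triangle_ineq3[of X' "P n"] by linarith
    then show ?thesis by blast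
  qed
  then show "\<forall>\<^sub>F n in sequentially. norm (B' * (\<Prod>k\<in>{- int n..int n}. 1 + d' k / e k)) \<le> 2 * norm X'"
    unfolding eventually_sequentially P_def I_def .
  have "P \<longlonglongrightarrow> X'"
  proof (rule LIMSEQ_I)
    fix r :: real assume "r > 0"
    define \<epsilon> where "\<epsilon> = r / (2 * norm X' + 1)"
    have "\<epsilon> > 0" using \<open>r > 0\<close> by (simp add: \<epsilon>_def add_nonneg_pos)
    obtain n0 where n0: "\<And>n. n \<ge> n0 \<Longrightarrow> norm (X' - P n) \<le> norm (P n) * \<epsilon>"
      using close[OF \<open>\<epsilon> > 0\<close>] by auto
    obtain n1 where n1: "\<And>n. n \<ge> n1 \<Longrightarrow> norm (P n) \<le> 2 * norm X'" using bound by auto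
    have "norm (P n - X') < r" if "n \<ge> max n0 n1" for n
    proof -
      have "norm (P n - X') \<le> norm (P n) * \<epsilon>" using n0[of n] that by (simp add: norm_minus_commute)
      also have "\<dots> \<le> (2 * norm X') * \<epsilon>" using n1[of n] that \<open>\<epsilon> > 0\<close> by (intro mult_right_mono) auto
      also have "\<dots> < (2 * norm X' + 1) * \<epsilon>" using \<open>\<epsilon> > 0\<close> by simp
      also have "\<dots> = r" using norm_ge_zero[of X'] by (simp add: \<epsilon>_def add_nonneg_eq_0_iff)
      finally show ?thesis .
    qed
    then show "\<exists>no. \<forall>n\<ge>no. norm (P n - X') < r" by blast
  qed
  then show "(\<lambda>n::nat. B' * (\<Prod>k\<in>{- int n..int n}. 1 + d' k / e k)) \<longlonglongrightarrow> X'"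
    by (simp add: P_def[abs_def] I_def)
qed

lemma norm_pt_minus_at_infinity:
  fixes z :: "'a::real_normed_field"
  shows "\<exists>n::nat. \<forall>k. int n < \<bar>k\<bar> \<longrightarrow> R \<le> norm (of_real (pt c k) - z)"
proof -
  obtain n :: nat where n: "R + norm z + \<bar>c\<bar> \<le> real n" using real_arch_simple by blast
  have "R \<le> norm (of_real (pt c k) - z)" if "int n < \<bar>k\<bar>" for k
  proof -
    have "real n \<le> \<bar>real_of_int k\<bar>" using that by linarith
    then have "\<bar>pt c k\<bar> \<ge> R + norm z" using n by (auto simp: pt_def)
    then show ?thesis using norm_triangle_ineq2[of "of_real (pt c k)" z] by simp
  qed
  then show ?thesis by blast
qed

section \<open>Finitely many masses\<close>

context point_masses
begin

lemma pert_finite: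
  fixes z :: "'a::{real_normed_field,banach}"
  assumes "finite {k. w k \<noteq> 0}"
  shows "pert c w z = 1 + (\<Sum>k\<in>{k. w k \<noteq> 0}. of_real (w k) / (of_real (pt c k) - z))"
proof -
  have "(\<Sum>\<^sub>\<infinity>k. of_real (w k) / (of_real (pt c k) - z)) =
        (\<Sum>\<^sub>\<infinity>k\<in>{k. w k \<noteq> 0}. of_real (w k) / (of_real (pt c k) - z))"
    by (rule infsum_cong_neutral) auto
  then show ?thesis using assms by (simp add: pert_def)
qed

text \<open>Both sides are polynomials of degree \<open>card ?F\<close> with the same leading
  coefficient that agree at the \<open>card ?F\<close> distinct gap roots. The denominators are
  cleared so that the identity can also be evaluated at the poles.\<close>

lemma finite_gap_root_identity:
  fixes z :: "'a::{real_normed_field,banach}"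
  assumes fin: "finite {k. w k \<noteq> 0}" (is "finite ?F")
  shows "(\<Prod>k\<in>?F. of_real (gap_root c w k) - z) =
    (\<Prod>k\<in>?F. of_real (pt c k) - z) +
    (\<Sum>k\<in>?F. of_real (w k) * (\<Prod>j\<in>?F - {k}. of_real (pt c j) - z))"
proof -
  let ?a = "\<lambda>k. of_real (pt c k) :: 'a" and ?b = "\<lambda>k. of_real (gap_root c w k) :: 'a"
  define p where "p = (\<Prod>k\<in>?F. [:?b k, -1:])"
  define r where "r = (\<Sum>k\<in>?F. smult (of_real (w k)) (\<Prod>j\<in>?F - {k}. [:?a j, -1:]))"
  define q where "q = (\<Prod>k\<in>?F. [:?a k, -1:])"
  let ?n = "card ?F"
  have deg: "degree (\<Prod>k\<in>G. [:u k, -1:]) = card G" for u :: "int \<Rightarrow> 'a" and G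
    by (subst degree_prod_eq_sum_degree) auto
  have lead: "coeff (\<Prod>k\<in>G. [:u k, -1:]) (card G) = (-1) ^ card G" for u :: "int \<Rightarrow> 'a" and G
    using lead_coeff_prod[of "\<lambda>k. [:u k, -1:]" G] by (simp add: deg)
  have small: "coeff (smult (of_real (w k)) (\<Prod>j\<in>?F - {k}. [:?a j, -1:])) ?n = 0"
      "degree (smult (of_real (w k)) (\<Prod>j\<in>?F - {k}. [:?a j, -1:])) \<le> ?n" if "k \<in> ?F" for k
  proof -
    have "degree (smult (of_real (w k)) (\<Prod>j\<in>?F - {k}. [:?a j, -1:])) \<le> card (?F - {k})"
      by (metis deg degree_smult_le)
    also have "\<dots> < ?n" using fin that by (rule card_Diff1_less)
    finally show "coeff (smult (of_real (w k)) (\<Prod>j\<in>?F - {k}. [:?a j, -1:])) ?n = 0"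
      "degree (smult (of_real (w k)) (\<Prod>j\<in>?F - {k}. [:?a j, -1:])) \<le> ?n"
      by (auto intro: coeff_eq_0)
  qed
  have "p = q + r"
  proof (rule poly_eqI_degree_lead_coeff)
    show "card (?b ` ?F) \<ge> ?n"
      by (subst card_image) (auto simp: inj_on_def dest: gap_root_inj)
    have "coeff r ?n = 0" unfolding r_def coeff_sum by (rule sum.neutral) (use small in auto)
    then show "coeff p ?n = coeff (q + r) ?n" by (simp add: p_def q_def lead)
    show "degree p \<le> ?n" by (simp add: p_def deg)
    show "degree (q + r) \<le> ?n"
      unfolding q_def r_def using small fin
      by (intro degree_add_le degree_sum_le) (auto simp: deg)
    fix z assume "z \<in> ?b ` ?F"
    then obtain i where i: "w i \<noteq> 0" "z = ?b i" by auto
    have pz: "poly p z = 0" using i fin by (auto simp: p_def poly_prod)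
    have ne: "?a k - z \<noteq> 0" if "w k \<noteq> 0" for k
      using gap_root_not_pole[OF i(1) that] i by (metis eq_iff_diff_eq_0 of_real_eq_iff)
    have "poly (q + r) z = (\<Prod>k\<in>?F. ?a k - z) + (\<Sum>k\<in>?F. of_real (w k) * (\<Prod>j\<in>?F - {k}. ?a j - z))"
      by (simp add: q_def r_def poly_prod poly_sum)
    \<comment> \<open>A gap root is not a pole, so the denominators may be restored; the second
      factor is then the value of \<open>pert\<close>, which is 0.\<close>
    also have "\<dots> = (\<Prod>k\<in>?F. ?a k - z) * (1 + (\<Sum>k\<in>?F. of_real (w k) / (?a k - z)))"
      using fin ne by (auto simp: distrib_left sum_distrib_left prod.remove intro!: sum.cong)
    also have "1 + (\<Sum>k\<in>?F. of_real (w k) / (?a k - z)) = of_real (1 + (\<Sum>k\<in>?F. w k / (pt c k - gap_root c w i)))"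
      by (simp add: i)
    also have "1 + (\<Sum>k\<in>?F. w k / (pt c k - gap_root c w i)) = 0"
      using gap_root(2)[OF i(1)] pert_finite[OF fin, of "gap_root c w i"] by simp
    finally show "poly p z = poly (q + r) z" using pz by simp
  qed
  then have "poly p z = poly (q + r) z" by simp
  then show ?thesis by (simp add: p_def q_def r_def poly_prod poly_sum)
qed

text \<open>Factors outside the support are 1, so \<open>G\<close> may be any finite superset, in
  particular a symmetric interval.\<close>

lemma finite_pert_eq_prod:
  fixes z :: "'a::{real_normed_field,banach}"
  assumes fin: "finite {k. w k \<noteq> 0}" and ne: "\<And>k. w k \<noteq> 0 \<Longrightarrow> of_real (pt c k) \<noteq> z"
    and sub: "{k. w k \<noteq> 0} \<subseteq> G" "finite G"
  shows "(\<Prod>k\<in>G. 1 + of_real (shift c w k) / (of_real (pt c k) - z)) = pert c w z"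
proof -
  let ?F = "{k. w k \<noteq> 0}"
  have ne': "of_real (pt c k) - z \<noteq> 0" if "w k \<noteq> 0" for k using ne[OF that] by simp
  have "(\<Prod>k\<in>G. 1 + of_real (shift c w k) / (of_real (pt c k) - z)) =
        (\<Prod>k\<in>?F. 1 + of_real (shift c w k) / (of_real (pt c k) - z))"
    using sub by (intro prod.mono_neutral_right) (auto simp: shift_def)
  also have "\<dots> = (\<Prod>k\<in>?F. (of_real (gap_root c w k) - z) / (of_real (pt c k) - z))"
    using ne' by (intro prod.cong) (auto simp: shift_def field_simps)
  also have "\<dots> = (\<Prod>k\<in>?F. of_real (gap_root c w k) - z) / (\<Prod>k\<in>?F. of_real (pt c k) - z)"
    by (rule prod_dividef)
  also have "\<dots> = 1 + (\<Sum>k\<in>?F. of_real (w k) * (\<Prod>j\<in>?F - {k}. of_real (pt c j) - z)) / (\<Prod>k\<in>?F. of_real (pt c k) - z)"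
    using ne' fin unfolding finite_gap_root_identity[OF fin] by (simp add: add_divide_distrib)
  also have "(\<Sum>k\<in>?F. of_real (w k) * (\<Prod>j\<in>?F - {k}. of_real (pt c j) - z)) / (\<Prod>k\<in>?F. of_real (pt c k) - z)
     = (\<Sum>k\<in>?F. of_real (w k) / (of_real (pt c k) - z))"
    unfolding sum_divide_distrib using ne' fin by (intro sum.cong) (auto simp: prod.remove)
  finally show ?thesis unfolding pert_finite[OF fin] .
qed

text \<open>This is the cleared identity at \<open>pt c p\<close>: every product that still contains
  the factor of \<open>p\<close> vanishes, so only the summand of \<open>p\<close> survives. In the
  product below the factor at \<open>p\<close> is \<open>1 + x / 0 = 1\<close>, hence no index has
  to be removed.\<close>

lemma finite_residue:
  assumes fin: "finite {k. w k \<noteq> 0}" and sub: "{k. w k \<noteq> 0} \<subseteq> G" "finite G"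
  shows "shift c w p * (\<Prod>k\<in>G. 1 + shift c w k / (pt c k - pt c p)) = w p"
proof (cases "w p = 0")
  case False
  let ?F = "{k. w k \<noteq> 0}"
  have prem: "(\<Prod>k\<in>?F. u k) = u p * (\<Prod>k\<in>?F - {p}. u k)" for u :: "int \<Rightarrow> real"
    using fin False by (intro prod.remove) auto
  have "(\<Prod>k\<in>?F. pt c k - pt c p) = 0"
    using fin False by auto
  moreover have "(\<Sum>k\<in>?F. w k * (\<Prod>j\<in>?F - {k}. pt c j - pt c p)) = w p * (\<Prod>j\<in>?F - {p}. pt c j - pt c p)"
  proof -
    have "(\<Prod>j\<in>?F - {k}. pt c j - pt c p) = 0" if "k \<noteq> p" for k
      using fin False that by (intro prod_zero) auto
    then have "(\<Sum>k\<in>?F - {p}. w k * (\<Prod>j\<in>?F - {k}. pt c j - pt c p)) = 0"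
      by (intro sum.neutral) auto
    then show ?thesis using fin False by (subst sum.remove[of _ p]) auto
  qed
  ultimately have eq: "(\<Prod>k\<in>?F. gap_root c w k - pt c p) = w p * (\<Prod>j\<in>?F - {p}. pt c j - pt c p)"
    using finite_gap_root_identity[OF fin, of "pt c p"] by simp
  have "(\<Prod>k\<in>G. 1 + shift c w k / (pt c k - pt c p)) = (\<Prod>k\<in>?F - {p}. 1 + shift c w k / (pt c k - pt c p))"
    using sub by (intro prod.mono_neutral_right) (auto simp: shift_def)
  also have "\<dots> = (\<Prod>k\<in>?F - {p}. (gap_root c w k - pt c p) / (pt c k - pt c p))"
    by (intro prod.cong) (auto simp: shift_def field_simps)
  also have "\<dots> = (\<Prod>k\<in>?F - {p}. gap_root c w k - pt c p) / (\<Prod>j\<in>?F - {p}. pt c j - pt c p)"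
    by (rule prod_dividef)
  finally have "shift c w p * (\<Prod>k\<in>G. 1 + shift c w k / (pt c k - pt c p)) =
     (\<Prod>k\<in>?F. gap_root c w k - pt c p) / (\<Prod>j\<in>?F - {p}. pt c j - pt c p)"
    using False prem[of "\<lambda>k. gap_root c w k - pt c p"] by (simp add: shift_def)
  moreover have "(\<Prod>j\<in>?F - {p}. pt c j - pt c p) \<noteq> 0" using fin by auto
  ultimately show ?thesis unfolding eq by simp
qed (simp add: shift_def)

lemma shift_nonneg: "0 \<le> shift c w k"
  using gap_root_gt[of k] by (auto simp: shift_def)

text \<open>Compare the two sides of the product formula at \<^term>\<open>- t\<close> as \<^term>\<open>t\<close> tends to infinity.\<close>

lemma finite_sum_shift_le:
  assumes fin: "finite {k. w k \<noteq> 0}" (is "finite ?F")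
  shows "(\<Sum>k\<in>?F. shift c w k) \<le> W"
proof -
  have lim: "((\<lambda>t. t / (pt c k + t)) \<longlongrightarrow> 1) at_top" for k
  proof -
    have "((\<lambda>t. 1 - pt c k / (pt c k + t)) \<longlongrightarrow> 1 - 0) at_top"
      by (intro tendsto_diff tendsto_const tendsto_divide_0[OF tendsto_const]
            filterlim_at_top_imp_at_infinity filterlim_tendsto_add_at_top[OF tendsto_const] filterlim_ident)
    moreover have "\<forall>\<^sub>F t in at_top. 1 - pt c k / (pt c k + t) = t / (pt c k + t)"
      using eventually_gt_at_top[of "- pt c k"] by eventually_elim (simp add: field_simps)
    ultimately show ?thesis using Lim_transform_eventually by fastforce
  qed
  have "(\<Sum>k\<in>?F. shift c w k * 1) \<le> (\<Sum>k\<in>?F. w k * 1)"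
  proof (rule tendsto_le[OF trivial_limit_at_top_linorder])
    show "((\<lambda>t. \<Sum>k\<in>?F. w k * (t / (pt c k + t))) \<longlongrightarrow> (\<Sum>k\<in>?F. w k * 1)) at_top"
      by (intro tendsto_sum tendsto_mult tendsto_const lim)
    show "((\<lambda>t. \<Sum>k\<in>?F. shift c w k * (t / (pt c k + t))) \<longlongrightarrow> (\<Sum>k\<in>?F. shift c w k * 1)) at_top"
      by (intro tendsto_sum tendsto_mult tendsto_const lim)
    have "\<forall>\<^sub>F t in at_top. \<forall>k\<in>?F. - pt c k < t"
      using fin by (intro eventually_ball_finite ballI eventually_gt_at_top)
    with eventually_gt_at_top[of 0]
    show "\<forall>\<^sub>F t in at_top. (\<Sum>k\<in>?F. shift c w k * (t / (pt c k + t))) \<le> (\<Sum>k\<in>?F. w k * (t / (pt c k + t)))"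
    proof eventually_elim
      case (elim t)
      \<comment> \<open>As the shifts are nonnegative, dropping the higher order products leaves an
        inequality between terms of order \<open>1 / t\<close>, which multiplication by
        \<open>t\<close> isolates.\<close>
      have "1 + (\<Sum>k\<in>?F. shift c w k / (pt c k + t)) \<le> (\<Prod>k\<in>?F. 1 + shift c w k / (pt c k + t))"
        by (rule one_plus_sum_le_prod[OF fin])
           (use elim shift_nonneg in \<open>auto intro!: divide_nonneg_nonneg simp: algebra_simps dest!: bspec\<close>)
      also have "\<dots> = pert c w (- t)"
        using finite_pert_eq_prod[OF fin _ order_refl fin, of "- t"] elim by force
      also have "\<dots> = 1 + (\<Sum>k\<in>?F. w k / (pt c k + t))"
        using pert_finite[OF fin, of "- t"] by simp
      finally have "t * (\<Sum>k\<in>?F. shift c w k / (pt c k + t)) \<le> t * (\<Sum>k\<in>?F. w k / (pt c k + t))"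
        using elim by (intro mult_left_mono) auto
      then show ?case by (simp add: sum_distrib_left mult_ac)
    qed
  qed
  also have "(\<Sum>k\<in>?F. w k * 1) \<le> W"
    using fin w_nonneg by (auto intro!: finite_sum_le_infsum w_summable)
  finally show ?thesis by simp
qed

section \<open>Truncation of the masses and passage to the limit\<close>

lemma trunc_point_masses: "point_masses (trunc w N)"
proof
  show "0 \<le> trunc w N k" for k using w_nonneg by (simp add: trunc_def)
  show "trunc w N summable_on UNIV"
  proof (rule summable_on_cong_neutral[THEN iffD1, rotated -1])
    show "w summable_on {- int N..int N}" by simp
  qed (auto simp: trunc_def)
qed

lemma trunc_finite: "finite {k. trunc w N k \<noteq> 0}" and trunc_sub: "{k. trunc w N k \<noteq> 0} \<subseteq> {- int N..int N}"
proof -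
  show "{k. trunc w N k \<noteq> 0} \<subseteq> {- int N..int N}" by (auto simp: trunc_def split: if_splits)
  then show "finite {k. trunc w N k \<noteq> 0}" using finite_subset by blast
qed

lemma trunc_W_le: "infsum (trunc w N) UNIV \<le> W"
  using w_nonneg
  by (intro infsum_mono w_summable point_masses.w_summable[OF trunc_point_masses]) (auto simp: trunc_def)

text \<open>Consequently an unordered sum is also the limit of its symmetric partial sums.\<close>

lemma filterlim_symmetric_intervals:
  "filterlim (\<lambda>n::nat. {- int n..int n}) (finite_subsets_at_top UNIV) sequentially"
  unfolding filterlim_finite_subsets_at_top
proof (intro allI impI)
  fix X :: "int set" assume X: "finite X \<and> X \<subseteq> UNIV"
  define n0 where "n0 = nat (Max (insert 0 (abs ` X)))"
  have "\<bar>k\<bar> \<le> int n0" if "k \<in> X" for k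
    using X that Max_ge[of "insert 0 (abs ` X)" "\<bar>k\<bar>"] by (auto simp: n0_def)
  then have "X \<subseteq> {- int n..int n}" if "n0 \<le> n" for n using that by (force simp: abs_le_iff)
  then show "\<forall>\<^sub>F n in sequentially. finite {- int n..int n} \<and> X \<subseteq> {- int n..int n} \<and> {- int n..int n} \<subseteq> UNIV"
    by (auto intro!: eventually_sequentiallyI[of n0])
qed

lemma pert_trunc_tendsto:
  fixes z :: "'a::{real_normed_field,banach}"
  shows "(\<lambda>N. pert c (trunc w N) z) \<longlonglongrightarrow> pert c w z"
proof -
  have "pert c (trunc w N) z = 1 + (\<Sum>k\<in>{- int N..int N}. of_real (w k) / (of_real (pt c k) - z))" for N
  proof -
    have "(\<Sum>\<^sub>\<infinity>k. of_real (trunc w N k) / (of_real (pt c k) - z)) =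
          (\<Sum>\<^sub>\<infinity>k\<in>{- int N..int N}. of_real (w k) / (of_real (pt c k) - z))"
      by (rule infsum_cong_neutral) (auto simp: trunc_def)
    then show ?thesis by (simp add: pert_def)
  qed
  moreover have "(\<lambda>N. \<Sum>k\<in>{- int N..int N}. of_real (w k) / (of_real (pt c k) - z)) \<longlonglongrightarrow> pert c w z - 1"
    using filterlim_compose[OF pert_has_sum[OF w_summable, of c z, unfolded has_sum_def] filterlim_symmetric_intervals]
    by simp
  from tendsto_add[OF tendsto_const[of 1] this] have
    "(\<lambda>N. 1 + (\<Sum>k\<in>{- int N..int N}. of_real (w k) / (of_real (pt c k) - z))) \<longlonglongrightarrow> pert c w z"
    by simp
  ultimately show ?thesis by presburger
qed

text \<open>Two points close to the root at which \<open>pert\<close> has opposite signs keep these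
  signs for large truncations, and monotonicity then traps the truncated root between them.\<close>

lemma gap_root_trunc_tendsto:
  assumes "w k \<noteq> 0"
  shows "(\<lambda>N. gap_root c (trunc w N) k) \<longlonglongrightarrow> gap_root c w k"
proof (rule LIMSEQ_I)
  fix r :: real assume "r > 0"
  let ?g = "gap_root c w k"
  note g = gap_root[OF assms]
  obtain l0 where l0: "in_gap c w k l0" "pert c w l0 < 0" using ex_pert_neg[OF assms] by auto
  obtain h0 where h0: "in_gap c w k h0" "pert c w h0 > 0" using ex_pert_pos[OF assms] by auto
  have "l0 < ?g" "?g < h0"
    using pert_mono[OF g(1) l0(1) _ assms] pert_mono[OF h0(1) g(1) _ assms] l0 h0 g
    by (metis linorder_neqE order_less_asym)+
  \<comment> \<open>The outer points \<open>l0\<close> and \<open>h0\<close> keep the bracket inside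
    the gap.\<close>
  define l where "l = max l0 (?g - r/2)"
  define h where "h = min h0 (?g + r/2)"
  have l: "in_gap c w k l" "l < ?g" "?g - r < l"
    using in_gap_convex[OF l0(1) g(1)] \<open>l0 < ?g\<close> \<open>r > 0\<close> by (auto simp: l_def)
  have h: "in_gap c w k h" "?g < h" "h < ?g + r"
    using in_gap_convex[OF g(1) h0(1)] \<open>?g < h0\<close> \<open>r > 0\<close> by (auto simp: h_def)
  have "pert c w l < 0" "pert c w h > 0"
    using pert_mono[OF l(1) g(1) l(2) assms] pert_mono[OF g(1) h(1) h(2) assms] g by auto
  then have "\<forall>\<^sub>F N in sequentially. pert c (trunc w N) l < 0" "\<forall>\<^sub>F N in sequentially. pert c (trunc w N) h > 0"
    using order_tendstoD[OF pert_trunc_tendsto] by auto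
  moreover have "\<forall>\<^sub>F N in sequentially. nat \<bar>k\<bar> \<le> N" by (rule eventually_ge_at_top)
  ultimately have "\<forall>\<^sub>F N in sequentially. norm (gap_root c (trunc w N) k - ?g) < r"
  proof eventually_elim
    case (elim N)
    interpret T: point_masses c "trunc w N" by (rule trunc_point_masses)
    have wk: "trunc w N k \<noteq> 0" using elim assms by (simp add: trunc_def)
    \<comment> \<open>Deleting masses can only widen the gap.\<close>
    have gap: "in_gap c (trunc w N) k x" if "in_gap c w k x" for x
      using that by (auto simp: in_gap_def trunc_def)
    note gN = T.gap_root[OF wk]
    have "l < gap_root c (trunc w N) k" "gap_root c (trunc w N) k < h"
      using T.pert_mono[OF gN(1) gap[OF l(1)] _ wk] T.pert_mono[OF gap[OF h(1)] gN(1) _ wk] elim gN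
      by (metis linorder_neqE order_less_asym)+
    then show ?case using l h by (auto simp: abs_less_iff)
  qed
  then show "\<exists>no. \<forall>n\<ge>no. norm (gap_root c (trunc w n) k - ?g) < r"
    by (simp add: eventually_sequentially)
qed

lemma shift_trunc_tendsto: "(\<lambda>N. shift c (trunc w N) k) \<longlonglongrightarrow> shift c w k"
proof (cases "w k = 0")
  case True
  then have "trunc w N k = 0" for N by (simp add: trunc_def)
  with True show ?thesis by (simp add: shift_def)
next
  case False
  have "\<forall>\<^sub>F N in sequentially. gap_root c (trunc w N) k - pt c k = shift c (trunc w N) k"
    using eventually_ge_at_top[of "nat \<bar>k\<bar>"] by eventually_elim (use False in \<open>auto simp: shift_def trunc_def\<close>)
  moreover have "(\<lambda>N. gap_root c (trunc w N) k - pt c k) \<longlonglongrightarrow> shift c w k"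
    using tendsto_diff[OF gap_root_trunc_tendsto[OF False] tendsto_const] False by (simp add: shift_def)
  ultimately show ?thesis using Lim_transform_eventually by fast
qed

text \<open>The bound does not depend on \<open>N\<close>; it serves as the constant
  \<open>M\<close> of \<open>vp_prod_interchange\<close>.\<close>

lemma sum_shift_trunc_le:
  assumes "finite F"
  shows "(\<Sum>k\<in>F. shift c (trunc w N) k) \<le> W"
proof -
  interpret T: point_masses c "trunc w N" by (rule trunc_point_masses)
  have "(\<Sum>k\<in>F. shift c (trunc w N) k) \<le> (\<Sum>k\<in>F \<union> {k. trunc w N k \<noteq> 0}. shift c (trunc w N) k)"
    using assms trunc_finite T.shift_nonneg by (intro sum_mono2) auto
  also have "\<dots> = (\<Sum>k\<in>{k. trunc w N k \<noteq> 0}. shift c (trunc w N) k)"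
    using assms trunc_finite by (intro sum.mono_neutral_right) (auto simp: shift_def)
  also have "\<dots> \<le> infsum (trunc w N) UNIV"
    by (rule T.finite_sum_shift_le[OF trunc_finite])
  also have "\<dots> \<le> W" by (rule trunc_W_le)
  finally show ?thesis .
qed

lemma sum_shift_le:
  assumes "finite F"
  shows "(\<Sum>k\<in>F. shift c w k) \<le> W"
proof (rule LIMSEQ_le_const2)
  show "(\<lambda>N. \<Sum>k\<in>F. shift c (trunc w N) k) \<longlonglongrightarrow> (\<Sum>k\<in>F. shift c w k)"
    by (intro tendsto_sum shift_trunc_tendsto)
qed (use sum_shift_trunc_le[OF assms] in auto)

text \<open>More than \<open>2 * W\<close> shifts of size at least 1/2 would exceed the total
  \<open>W\<close>. The threshold is half the spacing of the points, so that far out a moved point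
  determines its index.\<close>

lemma shift_small: "\<exists>n::nat. \<forall>k. int n < \<bar>k\<bar> \<longrightarrow> \<bar>shift c w k\<bar> < 1/2"
proof -
  have "finite {k. 1/2 \<le> shift c w k}"
  proof (rule ccontr)
    assume inf: "infinite {k. 1/2 \<le> shift c w k}"
    obtain n :: nat where n: "2 * W < real n" using reals_Archimedean2 by blast
    obtain F where F: "F \<subseteq> {k. 1/2 \<le> shift c w k}" "finite F" "card F = n"
      using infinite_arbitrarily_large[OF inf] by blast
    have "real n * (1/2) \<le> (\<Sum>k\<in>F. shift c w k)"
      using F sum_bounded_below[of F "1/2" "shift c w"] by auto
    with sum_shift_le[OF F(2)] n show False by linarith
  qed
  then obtain n where "\<And>k. k \<in> {k. 1/2 \<le> shift c w k} \<Longrightarrow> \<bar>k\<bar> \<le> n"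
    by (metis bdd_above.E bdd_above_finite finite_imageI image_eqI)
  then have "\<forall>k. int (nat n) < \<bar>k\<bar> \<longrightarrow> \<bar>shift c w k\<bar> < 1/2"
    using shift_nonneg by (metis abs_of_nonneg int_nat_eq mem_Collect_eq not_le order_le_less_trans linorder_linear nat_le_0 of_nat_0)
  then show ?thesis by blast
qed

lemma pert_vp_prod:
  fixes z :: complex
  assumes "\<And>k. w k \<noteq> 0 \<Longrightarrow> of_real (pt c k) \<noteq> z"
  shows "(\<lambda>n::nat. \<Prod>k\<in>{- int n..int n}. 1 + of_real (shift c w k) / (of_real (pt c k) - z)) \<longlonglongrightarrow> pert c w z"
    and "\<forall>\<^sub>F n in sequentially. norm (\<Prod>k\<in>{- int n..int n}. 1 + of_real (shift c w k) / (of_real (pt c k) - z))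
          \<le> 2 * norm (pert c w z)"
proof -
  have "(\<Sum>k\<in>F. norm (of_real (shift c (trunc w N) k) :: complex)) \<le> W" if "finite F" for F N
    using sum_shift_trunc_le[OF that] point_masses.shift_nonneg[OF trunc_point_masses]
    by (simp add: abs_of_nonneg)
  moreover have "(\<lambda>N. of_real (shift c (trunc w N) k) :: complex) \<longlonglongrightarrow> of_real (shift c w k)" for k
    by (intro tendsto_of_real shift_trunc_tendsto)
  moreover have "1 * (\<Prod>k\<in>{- int N..int N}. 1 + of_real (shift c (trunc w N) k) / (of_real (pt c k) - z)) = pert c (trunc w N) z" for N
  proof -
    interpret T: point_masses c "trunc w N" by (rule trunc_point_masses)
    have "of_real (pt c k) \<noteq> z" if "trunc w N k \<noteq> 0" for k
      using assms[of k] that by (auto simp: trunc_def split: if_splits)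
    then show ?thesis using T.finite_pert_eq_prod[OF trunc_finite _ trunc_sub, of z] by simp
  qed
  ultimately show "(\<lambda>n::nat. \<Prod>k\<in>{- int n..int n}. 1 + of_real (shift c w k) / (of_real (pt c k) - z)) \<longlonglongrightarrow> pert c w z"
    and "\<forall>\<^sub>F n in sequentially. norm (\<Prod>k\<in>{- int n..int n}. 1 + of_real (shift c w k) / (of_real (pt c k) - z))
          \<le> 2 * norm (pert c w z)"
    using vp_prod_interchange[where d = "\<lambda>N k. of_real (shift c (trunc w N) k)" and M = W
        and d' = "\<lambda>k. of_real (shift c w k)" and e = "\<lambda>k. of_real (pt c k) - z" and B = "\<lambda>_. 1" and B' = 1
        and X = "\<lambda>N. pert c (trunc w N) z", OF _ _ norm_pt_minus_at_infinity _ tendsto_const pert_trunc_tendsto]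
    by simp_all
qed

text \<open>Here the prefactor \<open>B\<close> of \<open>vp_prod_interchange\<close> is the shift
  of \<open>p\<close>, and the right hand sides are the truncated masses at \<open>p\<close>, which
  are eventually constant.\<close>

lemma residue_vp_prod:
  "(\<lambda>n::nat. shift c w p * (\<Prod>k\<in>{- int n..int n}. 1 + shift c w k / (pt c k - pt c p))) \<longlonglongrightarrow> w p"
proof (rule vp_prod_interchange)
  show "(\<Sum>k\<in>F. norm (shift c (trunc w N) k)) \<le> W" if "finite F" for F N
    using sum_shift_trunc_le[OF that] point_masses.shift_nonneg[OF trunc_point_masses]
    by (simp add: abs_of_nonneg)
  show "(\<lambda>N. shift c (trunc w N) k) \<longlonglongrightarrow> shift c w k" for k
    by (rule shift_trunc_tendsto)
  then show "(\<lambda>N. shift c (trunc w N) p) \<longlonglongrightarrow> shift c w p" .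
  show "\<exists>n::nat. \<forall>k. int n < \<bar>k\<bar> \<longrightarrow> R \<le> norm (pt c k - pt c p)" for R
    using norm_pt_minus_at_infinity[of R c "pt c p"] by simp
  show "shift c (trunc w N) p * (\<Prod>k\<in>{- int N..int N}. 1 + shift c (trunc w N) k / (pt c k - pt c p)) = trunc w N p" for N
    by (rule point_masses.finite_residue[OF trunc_point_masses trunc_finite trunc_sub]) simp
  show "(\<lambda>N. trunc w N p) \<longlonglongrightarrow> w p"
    by (rule tendsto_eventually)
       (use eventually_ge_at_top[of "nat \<bar>p\<bar>"] in \<open>eventually_elim; simp add: trunc_def\<close>)
qed

end

text \<open>Isolates what is needed of the moved points; the set of assumptions is invariant under
  \<open>k \<mapsto> - k\<close>, which reduces negative masses to positive ones.\<close>

locale perturbed_points =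
  fixes c :: real and m b :: "int \<Rightarrow> real"
  assumes m_summable: "m summable_on UNIV"
    and unperturbed: "\<And>k. m k = 0 \<Longrightarrow> b k = pt c k"
    and root: "\<And>k. m k \<noteq> 0 \<Longrightarrow> pert c m (b k) = 0"
    and not_pole: "\<And>j k. m k \<noteq> 0 \<Longrightarrow> m j \<noteq> 0 \<Longrightarrow> b k \<noteq> pt c j"
    and root_inj: "\<And>j k. m j \<noteq> 0 \<Longrightarrow> m k \<noteq> 0 \<Longrightarrow> b j = b k \<Longrightarrow> j = k"
    and ex_root: "\<And>z. pert c m z = 0 \<Longrightarrow> (\<And>j. m j \<noteq> 0 \<Longrightarrow> z \<noteq> pt c j) \<Longrightarrow> \<exists>k. m k \<noteq> 0 \<and> b k = z"
    and vp_pert: "\<And>z :: complex. (\<And>k. m k \<noteq> 0 \<Longrightarrow> of_real (pt c k) \<noteq> z) \<Longrightarrow>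
      (\<lambda>n::nat. \<Prod>k\<in>{- int n..int n}. 1 + of_real (b k - pt c k) / (of_real (pt c k) - z)) \<longlonglongrightarrow> pert c m z"
    and vp_bound: "\<And>z :: complex. (\<And>k. m k \<noteq> 0 \<Longrightarrow> of_real (pt c k) \<noteq> z) \<Longrightarrow>
      \<forall>\<^sub>F n in sequentially. norm (\<Prod>k\<in>{- int n..int n}. 1 + of_real (b k - pt c k) / (of_real (pt c k) - z))
          \<le> 2 * norm (pert c m z)"
    and vp_residue: "\<And>p. (\<lambda>n::nat. (b p - pt c p) *
      (\<Prod>k\<in>{- int n..int n}. 1 + (b k - pt c k) / (pt c k - pt c p))) \<longlonglongrightarrow> m p"
    and shift_lt_half: "\<exists>n::nat. \<forall>k. int n < \<bar>k\<bar> \<longrightarrow> \<bar>b k - pt c k\<bar> < 1/2"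

lemma (in point_masses) perturbed_points_gap_root:
  "perturbed_points c w (\<lambda>k. if w k = 0 then pt c k else gap_root c w k)"
proof -
  have eq: "(if w k = 0 then pt c k else gap_root c w k) - pt c k = shift c w k" for k
    by (simp add: shift_def)
  show ?thesis
  proof (unfold_locales, unfold eq)
    fix z assume "pert c w z = 0" "\<And>j. w j \<noteq> 0 \<Longrightarrow> z \<noteq> pt c j"
    then obtain k where "w k \<noteq> 0" "gap_root c w k = z" using pert_root_is_gap_root by blast
    then show "\<exists>k. w k \<noteq> 0 \<and> (if w k = 0 then pt c k else gap_root c w k) = z" by auto
  qed (use w_summable gap_root gap_root_not_pole gap_root_inj pert_vp_prod residue_vp_prod shift_small in auto)
qed

section \<open>Reflection, exchanging positive and negative masses\<close>

lemma bij_uminus: "bij (uminus :: int \<Rightarrow> int)"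
  by (rule bij_betwI[where g = uminus]) auto

lemma pt_uminus: "pt (- c) k = - pt c (- k)"
  by (simp add: pt_def)

text \<open>The reflected mass and the reflected denominator both change sign, so after reindexing
  the summands agree one by one.\<close>

lemma pert_reflect:
  fixes z :: "'a::{real_normed_field,banach}"
  shows "pert (- c) (\<lambda>k. - m (- k)) z = pert c m (- z)"
proof -
  have "of_real (- m (- k)) / (of_real (pt (- c) k) - z) = of_real (m (- k)) / (of_real (pt c (- k)) - (- z))" for k
  proof -
    have "of_real (pt (- c) k) - z = - (of_real (pt c (- k)) - (- z))" by (simp add: pt_uminus)
    then show ?thesis by (simp only: of_real_minus minus_divide_divide)
  qed
  then have "(\<Sum>\<^sub>\<infinity>k. of_real (- m (- k)) / (of_real (pt (- c) k) - z)) =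
        (\<Sum>\<^sub>\<infinity>k. of_real (m (- k)) / (of_real (pt c (- k)) - (- z)))"
    by simp
  also have "\<dots> = (\<Sum>\<^sub>\<infinity>k. of_real (m k) / (of_real (pt c k) - (- z)))"
    by (rule infsum_reindex_bij_betw) (auto intro!: bij_betwI[where g = uminus])
  finally show ?thesis by (simp add: pert_def)
qed

lemma vp_prod_reflect:
  fixes z :: "'a::real_normed_field"
  shows "(\<Prod>k\<in>{- int n..int n}. 1 + of_real (- b (- k) - pt (- c) k) / (of_real (pt (- c) k) - z)) =
    (\<Prod>k\<in>{- int n..int n}. 1 + of_real (b k - pt c k) / (of_real (pt c k) - (- z)))"
proof -
  have factor: "1 + of_real (- b (- k) - pt (- c) k) / (of_real (pt (- c) k) - z) =
      1 + of_real (b (- k) - pt c (- k)) / (of_real (pt c (- k)) - (- z))" for k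
  proof -
    have "of_real (- b (- k) - pt (- c) k) = - (of_real (b (- k) - pt c (- k)) :: 'a)"
      "of_real (pt (- c) k) - z = - (of_real (pt c (- k)) - (- z))"
      by (simp_all add: pt_uminus)
    then show ?thesis by (metis minus_divide_divide)
  qed
  show ?thesis unfolding factor
    by (rule prod.reindex_bij_witness[of _ uminus uminus]) auto
qed

lemma (in perturbed_points) reflected:
  "perturbed_points (- c) (\<lambda>k. - m (- k)) (\<lambda>k. - b (- k))"
proof
    show "(\<lambda>k. - m (- k)) summable_on UNIV"
    proof (rule summable_on_uminus[THEN iffD2])
      show "(\<lambda>k. m (- k)) summable_on UNIV"
        using m_summable summable_on_reindex_bij_betw[OF bij_uminus, of m] by simp
    qed
    show "- m (- k) = 0 \<Longrightarrow> - b (- k) = pt (- c) k" for k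
      using unperturbed by (simp add: pt_uminus)
    show "- m (- k) \<noteq> 0 \<Longrightarrow> pert (- c) (\<lambda>k. - m (- k)) (- b (- k)) = 0" for k
      using root by (simp add: pert_reflect)
    show "- m (- k) \<noteq> 0 \<Longrightarrow> - m (- j) \<noteq> 0 \<Longrightarrow> - b (- k) \<noteq> pt (- c) j" for j k
      using not_pole by (simp add: pt_uminus)
    show "- m (- j) \<noteq> 0 \<Longrightarrow> - m (- k) \<noteq> 0 \<Longrightarrow> - b (- j) = - b (- k) \<Longrightarrow> j = k" for j k
      using root_inj[of "- j" "- k"] by simp
    show "\<exists>k. - m (- k) \<noteq> 0 \<and> - b (- k) = z"
      if "pert (- c) (\<lambda>k. - m (- k)) z = 0" "\<And>j. - m (- j) \<noteq> 0 \<Longrightarrow> z \<noteq> pt (- c) j" for z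
    proof -
      have "pert c m (- z) = 0" using that(1) by (simp add: pert_reflect)
      moreover have "- z \<noteq> pt c j" if "m j \<noteq> 0" for j
        using \<open>\<And>j. - m (- j) \<noteq> 0 \<Longrightarrow> z \<noteq> pt (- c) j\<close>[of "- j"] that by (auto simp: pt_uminus)
      ultimately obtain k where "m k \<noteq> 0" "b k = - z" using ex_root by blast
      then show ?thesis by (intro exI[of _ "- k"]) auto
    qed
    fix z :: complex
    assume "\<And>k. - m (- k) \<noteq> 0 \<Longrightarrow> of_real (pt (- c) k) \<noteq> z"
    note ne = this
    have z: "of_real (pt c k) \<noteq> - z" if "m k \<noteq> 0" for k
      using ne[of "- k"] that by (auto simp: pt_uminus)
    show "(\<lambda>n::nat. \<Prod>k\<in>{- int n..int n}. 1 + of_real (- b (- k) - pt (- c) k) / (of_real (pt (- c) k) - z))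
        \<longlonglongrightarrow> pert (- c) (\<lambda>k. - m (- k)) z"
      unfolding vp_prod_reflect pert_reflect by (rule vp_pert) (use z in auto)
    show "\<forall>\<^sub>F n in sequentially. norm (\<Prod>k\<in>{- int n..int n}. 1 + of_real (- b (- k) - pt (- c) k) / (of_real (pt (- c) k) - z))
          \<le> 2 * norm (pert (- c) (\<lambda>k. - m (- k)) z)"
      unfolding vp_prod_reflect pert_reflect by (rule vp_bound) (use z in auto)
  next
    fix p
    \<comment> \<open>The prefactor changes sign under reflection, as the masses do, while the
      product is preserved.\<close>
    have "(\<lambda>n::nat. - ((b (- p) - pt c (- p)) *
      (\<Prod>k\<in>{- int n..int n}. 1 + (b k - pt c k) / (pt c k - pt c (- p))))) \<longlonglongrightarrow> - m (- p)"
      by (intro tendsto_minus vp_residue)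
    moreover have "(- b (- p) - pt (- c) p) *
      (\<Prod>k\<in>{- int n..int n}. 1 + (- b (- k) - pt (- c) k) / (pt (- c) k - pt (- c) p)) =
      - ((b (- p) - pt c (- p)) * (\<Prod>k\<in>{- int n..int n}. 1 + (b k - pt c k) / (pt c k - pt c (- p))))" for n
      using vp_prod_reflect[of b c "pt (- c) p" n] by (simp add: pt_uminus flip: mult_minus_left)
    ultimately show "(\<lambda>n::nat. (- b (- p) - pt (- c) p) *
      (\<Prod>k\<in>{- int n..int n}. 1 + (- b (- k) - pt (- c) k) / (pt (- c) k - pt (- c) p))) \<longlonglongrightarrow> - m (- p)"
      by presburger
  next
    obtain n :: nat where n: "\<And>k. int n < \<bar>k\<bar> \<Longrightarrow> \<bar>b k - pt c k\<bar> < 1/2" using shift_lt_half by blast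
    have "\<bar>- b (- k) - pt (- c) k\<bar> < 1/2" if "int n < \<bar>k\<bar>" for k
      using n[of "- k"] that by (simp add: pt_uminus abs_minus_commute)
    then show "\<exists>n::nat. \<forall>k. int n < \<bar>k\<bar> \<longrightarrow> \<bar>- b (- k) - pt (- c) k\<bar> < 1/2" by blast
qed

section \<open>Product formulas and residues for the moved points\<close>

context perturbed_points
begin

text \<open>Far out the moved points stay within 1/2 of points with spacing 1. Finiteness matters
  because multiplicities are counted by \<open>card\<close>, which is 0 on infinite sets.\<close>

lemma finite_fibre: "finite {k. b k = z}"
proof -
  obtain n :: nat where n: "\<And>k. int n < \<bar>k\<bar> \<Longrightarrow> \<bar>b k - pt c k\<bar> < 1/2" using shift_lt_half by blast
  have "{k. b k = z} \<subseteq> {- int n..int n} \<union> {\<lfloor>z - c\<rfloor> - 1..\<lceil>z - c\<rceil> + 1}"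
  proof
    fix k assume k: "k \<in> {k. b k = z}"
    then show "k \<in> {- int n..int n} \<union> {\<lfloor>z - c\<rfloor> - 1..\<lceil>z - c\<rceil> + 1}"
    proof (cases "int n < \<bar>k\<bar>")
      case True
      then have "\<bar>z - (of_int k + c)\<bar> < 1/2" using n[of k] k by (simp add: pt_def)
      then have "k \<in> {\<lfloor>z - c\<rfloor> - 1..\<lceil>z - c\<rceil> + 1}" unfolding atLeastAtMost_iff by linarith
      then show ?thesis by blast
    qed auto
  qed
  then show ?thesis using finite_subset by blast
qed

text \<open>The factor at \<open>p\<close> is 1 through division by 0, and
  \<open>b p - pt c p\<close> supplies the missing one. The result depends on the \<open>b k\<close>
  only through a product symmetric in them, so it is insensitive to the order of
  enumeration.\<close>

lemma residue_partial_product: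
  assumes "\<bar>p\<bar> \<le> int n"
  shows "(b p - pt c p) * (\<Prod>k\<in>{- int n..int n}. 1 + (b k - pt c k) / (pt c k - pt c p)) =
    (\<Prod>k\<in>{- int n..int n}. b k - pt c p) / (\<Prod>k\<in>{- int n..int n} - {p}. pt c k - pt c p)"
proof -
  have p: "p \<in> {- int n..int n}" using assms by (auto simp: abs_le_iff)
  have "(\<Prod>k\<in>{- int n..int n} - {p}. 1 + (b k - pt c k) / (pt c k - pt c p)) =
      (\<Prod>k\<in>{- int n..int n} - {p}. (b k - pt c p) / (pt c k - pt c p))"
    by (intro prod.cong) (auto simp: field_simps)
  then have "(\<Prod>k\<in>{- int n..int n}. 1 + (b k - pt c k) / (pt c k - pt c p)) =
      (\<Prod>k\<in>{- int n..int n} - {p}. (b k - pt c p)) / (\<Prod>k\<in>{- int n..int n} - {p}. pt c k - pt c p)"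
    by (subst prod.remove[OF _ p]) (auto simp: prod_dividef)
  moreover have "(\<Prod>k\<in>{- int n..int n}. b k - pt c p) = (b p - pt c p) * (\<Prod>k\<in>{- int n..int n} - {p}. b k - pt c p)"
    by (subst prod.remove[OF _ p]) auto
  ultimately show ?thesis by simp
qed

text \<open>By \<open>vp_bound\<close> a zero value would make some partial product vanish, hence
  one of its factors, and then \<open>z\<close> would equal a real \<open>b k\<close>.\<close>

lemma pert_nonreal_nonzero:
  assumes "z \<notin> \<real>"
  shows "pert c m z \<noteq> (0 :: complex)"
proof
  assume zero: "pert c m z = 0"
  have ne: "of_real (x :: real) \<noteq> z" for x using assms Reals_of_real by metis
  have "\<forall>\<^sub>F n in sequentially. norm (\<Prod>k\<in>{- int n..int n}. 1 + of_real (b k - pt c k) / (of_real (pt c k) - z)) \<le> 0"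
    using vp_bound[OF ne] zero by simp
  then obtain n :: nat where "(\<Prod>k\<in>{- int n..int n}. 1 + of_real (b k - pt c k) / (of_real (pt c k) - z)) = 0"
    by (metis (no_types, lifting) eventually_happens' norm_le_zero_iff sequentially_bot)
  then obtain k where k: "1 + of_real (b k - pt c k) / (of_real (pt c k) - z) = 0" by auto
  have "of_real (pt c k) - z \<noteq> 0" using ne by simp
  then have "of_real (b k - pt c k) = - (of_real (pt c k) - z)"
    using k by (simp only: add_eq_0_iff divide_eq_eq_1 divide_eq_minus_1_iff)
  then have "of_real (b k) = z" by simp
  then show False using ne by blast
qed

lemma pert_imaginary_tendsto: "((\<lambda>y. pert c m (\<i> * of_real y)) \<longlongrightarrow> 1) at_top"
proof -
  have abs: "(\<lambda>k. \<bar>m k\<bar>) summable_on UNIV"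
    using summable_on_iff_abs_summable_on_real[THEN iffD1, OF m_summable] by simp
  define M where "M = (\<Sum>\<^sub>\<infinity>k. \<bar>m k\<bar>)"
  have "norm (pert c m (\<i> * of_real y) - 1) \<le> M * inverse y" if "y > 0" for y
  proof -
    \<comment> \<open>From a point at height \<open>y\<close> on the imaginary axis every pole is at
      distance at least \<open>y\<close>.\<close>
    have bd: "norm (of_real (m k) / (of_real (pt c k) - \<i> * of_real y)) \<le> \<bar>m k\<bar> * inverse y" for k
    proof -
      have "y \<le> norm (of_real (pt c k) - \<i> * of_real y)"
        using abs_Im_le_cmod[of "of_real (pt c k) - \<i> * of_real y"] that by simp
      then have "\<bar>m k\<bar> / norm (of_real (pt c k) - \<i> * of_real y) \<le> \<bar>m k\<bar> / y"
        using that by (intro divide_left_mono mult_pos_pos) auto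
      then show ?thesis by (simp add: norm_divide norm_mult norm_inverse divide_inverse)
    qed
    have s: "(\<lambda>k. \<bar>m k\<bar> * inverse y) summable_on UNIV"
      by (intro summable_on_cmult_left abs)
    have "norm (\<Sum>\<^sub>\<infinity>k. of_real (m k) / (of_real (pt c k) - \<i> * of_real y)) \<le> (\<Sum>\<^sub>\<infinity>k. \<bar>m k\<bar> * inverse y)"
      using norm_infsum_le[OF has_sum_infsum[OF pert_summable[OF m_summable]] has_sum_infsum[OF s] bd] .
    also have "\<dots> = M * inverse y" by (simp add: M_def infsum_cmult_left')
    finally show ?thesis by (simp add: pert_def)
  qed
  then have "\<forall>\<^sub>F y in at_top. norm (pert c m (\<i> * of_real y) - 1) \<le> M * inverse y"
    by (rule eventually_mono[OF eventually_gt_at_top[of 0]])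
  moreover have "((\<lambda>y. M * inverse y) \<longlongrightarrow> M * 0) at_top"
    by (intro tendsto_mult tendsto_const tendsto_inverse_0_at_top filterlim_ident)
  ultimately have "((\<lambda>y. pert c m (\<i> * of_real y) - 1) \<longlongrightarrow> 0) at_top"
    by (simp add: Lim_null_comparison)
  from tendsto_add[OF this tendsto_const[of 1]] show ?thesis by simp
qed

lemma vp_pert_real:
  assumes "\<And>k. m k \<noteq> 0 \<Longrightarrow> pt c k \<noteq> z"
  shows "(\<lambda>n::nat. \<Prod>k\<in>{- int n..int n}. 1 + (b k - pt c k) / (pt c k - z)) \<longlonglongrightarrow> pert c m z"
proof -
  have "(\<lambda>n::nat. of_real (\<Prod>k\<in>{- int n..int n}. 1 + (b k - pt c k) / (pt c k - z)) :: complex) \<longlonglongrightarrow> of_real (pert c m z)"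
    using vp_pert[of "of_real z"] assms by (simp add: pert_complex_of_real[OF m_summable])
  then show ?thesis by (simp only: tendsto_of_real_iff)
qed

text \<open>Each factor is the quotient of the factors of the product formula at 0 and at
  \<open>z\<close>. The denominator has a nonzero limit because \<open>z\<close> is not
  real.\<close>

lemma vp_prod_ratio:
  fixes z :: complex
  assumes "\<And>k. pt c k \<noteq> 0" "\<And>k. b k \<noteq> 0" "z \<notin> \<real>"
  shows "(\<lambda>n::nat. \<Prod>k\<in>{- int n..int n}. (1 - z / of_real (pt c k)) / (1 - z / of_real (b k)))
    \<longlonglongrightarrow> of_real (pert c m 0) / pert c m z"
proof -
  have ne: "of_real (x :: real) \<noteq> z" for x using assms by auto
  have "(1 - z / of_real (pt c k)) / (1 - z / of_real (b k)) =
      (1 + of_real (b k - pt c k) / (of_real (pt c k) - of_real 0)) / (1 + of_real (b k - pt c k) / (of_real (pt c k) - z))" for k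
    using ne[of "pt c k"] ne[of "b k"] assms(1,2)[of k] by (simp add: divide_simps)
  then have "(\<Prod>k\<in>{- int n..int n}. (1 - z / of_real (pt c k)) / (1 - z / of_real (b k))) =
      (\<Prod>k\<in>{- int n..int n}. 1 + of_real (b k - pt c k) / (of_real (pt c k) - of_real 0)) /
      (\<Prod>k\<in>{- int n..int n}. 1 + of_real (b k - pt c k) / (of_real (pt c k) - z))" for n
    by (simp add: prod_dividef)
  moreover have "(\<lambda>n::nat. (\<Prod>k\<in>{- int n..int n}. 1 + of_real (b k - pt c k) / (of_real (pt c k) - of_real 0)) /
      (\<Prod>k\<in>{- int n..int n}. 1 + of_real (b k - pt c k) / (of_real (pt c k) - z))) \<longlonglongrightarrow> pert c m (of_real 0) / pert c m z"
    using assms ne by (intro tendsto_divide vp_pert pert_nonreal_nonzero) auto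
  ultimately show ?thesis unfolding pert_complex_of_real[OF m_summable] by presburger
qed

text \<open>The product separates into that of \<open>pt c k / b k\<close>, with limit the inverse
  of \<open>pert c m 0\<close>, and the residue product at \<open>p\<close>; the factor
  \<open>b p / pt c p\<close> removes the index \<open>p\<close> from the former.\<close>

lemma vp_prod_mass:
  assumes "\<And>k. pt c k \<noteq> 0" "\<And>k. b k \<noteq> 0" "pert c m (0::real) \<noteq> 0"
  shows "\<exists>P. (\<lambda>n::nat. \<Prod>k\<in>{- int n..int n} \<inter> - {p}. pt c k / b k * (1 + (b k - pt c k) / (pt c k - pt c p))) \<longlonglongrightarrow> P \<and>
    m p = pert c m 0 * (pt c p / b p * (b p - pt c p)) * P"
proof -
  \<comment> \<open>For \<open>m p = 0\<close> the prefactor \<open>b p - pt c p\<close> is 0 and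
    the residue formula says nothing about the product, so the limit is taken from the product
    formula at the regular point \<open>pt c p\<close>.\<close>
  define R where "R = (if m p = 0 then pert c m (pt c p) else m p / (b p - pt c p))"
  have shift_ne: "b p - pt c p \<noteq> 0" if "m p \<noteq> 0" using not_pole[OF that that] by simp
  have R: "(\<lambda>n::nat. \<Prod>k\<in>{- int n..int n}. 1 + (b k - pt c k) / (pt c k - pt c p)) \<longlonglongrightarrow> R"
  proof (cases "m p = 0")
    case True
    then show ?thesis using vp_pert_real[of "pt c p"] by (auto simp: R_def)
  next
    case False
    from tendsto_divide[OF vp_residue[of p] tendsto_const shift_ne[OF False]] shift_ne[OF False]
    show ?thesis by (simp add: R_def False)
  qed
  have mR: "m p = (b p - pt c p) * R"
    using shift_ne unperturbed[of p] by (auto simp: R_def)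
  have "(\<lambda>n::nat. inverse (\<Prod>k\<in>{- int n..int n}. 1 + (b k - pt c k) / (pt c k - 0))) \<longlonglongrightarrow> inverse (pert c m 0)"
    by (intro tendsto_inverse vp_pert_real assms(1,3))
  moreover have "inverse (\<Prod>k\<in>{- int n..int n}. 1 + (b k - pt c k) / (pt c k - 0)) = (\<Prod>k\<in>{- int n..int n}. pt c k / b k)" for n
    unfolding prod_inversef[symmetric] using assms by (intro prod.cong) (auto simp: field_simps)
  ultimately have inv: "(\<lambda>n::nat. \<Prod>k\<in>{- int n..int n}. pt c k / b k) \<longlonglongrightarrow> inverse (pert c m 0)" by simp
  have lim: "(\<lambda>n::nat. b p / pt c p * (\<Prod>k\<in>{- int n..int n}. pt c k / b k) *
     (\<Prod>k\<in>{- int n..int n}. 1 + (b k - pt c k) / (pt c k - pt c p))) \<longlonglongrightarrow> b p / pt c p * inverse (pert c m 0) * R"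
    by (intro tendsto_mult tendsto_const inv R)
  have "b p / pt c p * (\<Prod>k\<in>{- int n..int n}. pt c k / b k) *
     (\<Prod>k\<in>{- int n..int n}. 1 + (b k - pt c k) / (pt c k - pt c p)) =
     (\<Prod>k\<in>{- int n..int n} \<inter> - {p}. pt c k / b k * (1 + (b k - pt c k) / (pt c k - pt c p)))"
    if "nat \<bar>p\<bar> \<le> n" for n
  proof -
    have p: "p \<in> {- int n..int n}" using that by auto
    have D: "{- int n..int n} \<inter> - {p} = {- int n..int n} - {p}" by auto
    have "(\<Prod>k\<in>{- int n..int n}. pt c k / b k) = pt c p / b p * (\<Prod>k\<in>{- int n..int n} - {p}. pt c k / b k)"
      by (rule prod.remove[OF _ p]) simp
    moreover have "(\<Prod>k\<in>{- int n..int n}. 1 + (b k - pt c k) / (pt c k - pt c p)) =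
        (\<Prod>k\<in>{- int n..int n} - {p}. 1 + (b k - pt c k) / (pt c k - pt c p))"
      by (subst prod.remove[OF _ p]) simp_all
    ultimately show ?thesis using assms unfolding D prod.distrib by simp
  qed
  then have "(\<lambda>n::nat. \<Prod>k\<in>{- int n..int n} \<inter> - {p}. pt c k / b k * (1 + (b k - pt c k) / (pt c k - pt c p)))
      \<longlonglongrightarrow> b p / pt c p * inverse (pert c m 0) * R"
    by (intro Lim_transform_eventually[OF lim] eventually_sequentiallyI)
  moreover have "m p = pert c m 0 * (pt c p / b p * (b p - pt c p)) * (b p / pt c p * inverse (pert c m 0) * R)"
    using mR assms by simp
  ultimately show ?thesis by blast
qed

end

text \<open>The masses are limits of residue products that do not see the order of the
  \<open>b k\<close>. It remains that equal multisets have equal symmetric sections, which holds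
  once the two sequences agree outside a finite interval.\<close>

lemma perturbed_points_masses_unique:
  assumes "perturbed_points c m b" "perturbed_points c m' b'"
    and card_eq: "\<And>z. card {k. b k = z} = card {k. b' k = z}"
  shows "m p = m' p"
proof -
  interpret M: perturbed_points c m b by fact
  interpret M': perturbed_points c m' b' by fact
  obtain n1 :: nat where n1: "\<And>k. int n1 < \<bar>k\<bar> \<Longrightarrow> \<bar>b k - pt c k\<bar> < 1/2" using M.shift_lt_half by blast
  obtain n2 :: nat where n2: "\<And>k. int n2 < \<bar>k\<bar> \<Longrightarrow> \<bar>b' k - pt c k\<bar> < 1/2" using M'.shift_lt_half by blast
  obtain B where B: "\<And>k. \<bar>k\<bar> \<le> int n2 \<Longrightarrow> \<bar>b' k\<bar> \<le> B"
  proof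
    show "\<bar>b' k\<bar> \<le> Max ((\<lambda>k. \<bar>b' k\<bar>) ` {- int n2..int n2})" if "\<bar>k\<bar> \<le> int n2" for k
      using that by (intro Max_ge imageI) auto
  qed
  \<comment> \<open>A value \<open>b k\<close> within 1/2 of such a \<open>pt c k\<close> exceeds
    \<open>B\<close> in absolute value, so it cannot be one of the early, uncontrolled values of
    \<open>b'\<close>.\<close>
  obtain n3 :: nat where n3: "\<And>k. int n3 < \<bar>k\<bar> \<Longrightarrow> B + 1 \<le> \<bar>pt c k\<bar>"
    using norm_pt_minus_at_infinity[of "B + 1" c "0::real"] by auto
  define N where "N = max n1 n3"
  have eq: "b k = b' k" if k: "int N < \<bar>k\<bar>" for k
  proof -
    have bk: "\<bar>b k - pt c k\<bar> < 1/2" "B + 1 \<le> \<bar>pt c k\<bar>" using n1 n3 k by (auto simp: N_def)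
    have "card {j. b j = b k} > 0" using M.finite_fibre by (subst card_gt_0_iff) auto
    then have "{j. b' j = b k} \<noteq> {}" unfolding card_eq by (metis card.empty less_irrefl)
    then obtain j where j: "b' j = b k" by auto
    have "int n2 < \<bar>j\<bar>"
    proof (rule ccontr)
      assume "\<not> int n2 < \<bar>j\<bar>"
      then have "\<bar>b k\<bar> \<le> B" using B[of j] j by simp
      then show False using bk by linarith
    qed
    then have "\<bar>b' j - pt c j\<bar> < 1/2" by (rule n2)
    then have "\<bar>pt c j - pt c k\<bar> < 1" using bk j by linarith
    then have "j = k" by (simp add: pt_def)
    then show ?thesis using j by simp
  qed
  have mset: "image_mset b (mset_set {- int n..int n}) = image_mset b' (mset_set {- int n..int n})" if "N \<le> n" for n
  proof (rule multiset_eqI)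
    fix z
    let ?I = "{- int n..int n}"
    have split: "card {k. f k = z} = card {k \<in> ?I. f k = z} + card {k. k \<notin> ?I \<and> f k = z}"
      if "finite {k. f k = z}" for f :: "int \<Rightarrow> real"
    proof -
      have eq: "{k. f k = z} = {k \<in> ?I. f k = z} \<union> {k. k \<notin> ?I \<and> f k = z}" by auto
      have "card {k. f k = z} = card ({k \<in> ?I. f k = z} \<union> {k. k \<notin> ?I \<and> f k = z})"
        by (rule arg_cong[OF eq])
      also have "\<dots> = card {k \<in> ?I. f k = z} + card {k. k \<notin> ?I \<and> f k = z}"
        using that by (intro card_Un_disjoint) (auto intro: rev_finite_subset)
      finally show ?thesis .
    qed
    have "b k = b' k" if "k \<notin> ?I" for k using that \<open>N \<le> n\<close> by (intro eq) auto
    then have "{k. k \<notin> ?I \<and> b k = z} = {k. k \<notin> ?I \<and> b' k = z}" by auto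
    then have "card {k \<in> ?I. b k = z} = card {k \<in> ?I. b' k = z}"
      using card_eq[of z] split[OF M.finite_fibre] split[OF M'.finite_fibre] by simp
    then show "count (image_mset b (mset_set ?I)) z = count (image_mset b' (mset_set ?I)) z"
      by (simp add: count_image_mset_eq_card_vimage)
  qed
  have "(\<Prod>k\<in>{- int n..int n}. b k - pt c p) = (\<Prod>k\<in>{- int n..int n}. b' k - pt c p)" if "N \<le> n" for n
  proof -
    have "image_mset (\<lambda>x. x - pt c p) (image_mset b (mset_set {- int n..int n})) =
        image_mset (\<lambda>x. x - pt c p) (image_mset b' (mset_set {- int n..int n}))"
      using mset[OF that] by simp
    then show ?thesis by (simp add: prod_unfold_prod_mset image_mset.compositionality comp_def)
  qed
  then have "\<forall>\<^sub>F n in sequentially. (b p - pt c p) * (\<Prod>k\<in>{- int n..int n}. 1 + (b k - pt c k) / (pt c k - pt c p)) =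
      (b' p - pt c p) * (\<Prod>k\<in>{- int n..int n}. 1 + (b' k - pt c k) / (pt c k - pt c p))"
  proof (intro eventually_sequentiallyI[of "max N (nat \<bar>p\<bar>)"], goal_cases)
    case (1 n)
    then have "\<bar>p\<bar> \<le> int n" "N \<le> n" by auto
    then show ?case using 1(1) by (simp only: M.residue_partial_product M'.residue_partial_product)
  qed
  from LIMSEQ_unique[OF Lim_transform_eventually[OF M.vp_residue this] M'.vp_residue] show ?thesis .
qed

section \<open>Square integrable functions\<close>

lemma norm_complex2: "(norm (a :: complex ^ 2))\<^sup>2 = (cmod (a $ 1))\<^sup>2 + (cmod (a $ 2))\<^sup>2"
  by (simp add: norm_vec_def L2_set_def sum_2)

lemma norm_scale_complex2: "norm (c *s (a :: complex ^ 2)) = cmod c * norm a"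
proof (rule power2_eq_imp_eq)
  show "(norm (c *s a))\<^sup>2 = (cmod c * norm a)\<^sup>2"
    by (simp add: norm_complex2 norm_mult power_mult_distrib algebra_simps)
qed auto

text \<open>The crude constant 2 comes from bounding the two components separately; any constant
  would serve for integrability and for uniform limits.\<close>

lemma norm_cinner2_le: "cmod (cinner2 a b) \<le> 2 * (norm a * norm b)"
proof -
  have "cmod (cinner2 a b) \<le> cmod (a $ 1) * cmod (b $ 1) + cmod (a $ 2) * cmod (b $ 2)"
    unfolding cinner2_def by (rule order_trans[OF norm_triangle_ineq]) (simp add: norm_mult)
  also have "\<dots> \<le> norm a * norm b + norm a * norm b"
    by (intro add_mono mult_mono Finite_Cartesian_Product.norm_nth_le) auto
  finally show ?thesis by simp
qed

lemma norm_cinner2_le_squares: "cmod (cinner2 a b) \<le> (norm a)\<^sup>2 + (norm b)\<^sup>2"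
  using norm_cinner2_le[of a b] sum_squares_bound[of "norm a" "norm b"] by simp

lemma cinner2_add_left: "cinner2 (a + b) d = cinner2 a d + cinner2 b d"
  and cinner2_diff_left: "cinner2 (a - b) d = cinner2 a d - cinner2 b d"
  and cinner2_scale_left: "cinner2 (z *s a) d = z * cinner2 a d"
  and cinner2_commute: "cinner2 a b = cnj (cinner2 b a)"
  by (simp_all add: cinner2_def algebra_simps)

lemma cinner2_same: "cinner2 a a = of_real ((norm a)\<^sup>2)"
  unfolding cinner2_def norm_complex2 of_real_add complex_norm_square ..

lemma continuous_on_vector2:
  fixes f g :: "'a::topological_space \<Rightarrow> complex"
  assumes "continuous_on S f" "continuous_on S g"
  shows "continuous_on S (\<lambda>x. vector [f x, g x] :: complex ^ 2)"
proof -
  have "(\<lambda>x. vector [f x, g x] :: complex ^ 2) = (\<lambda>x. \<chi> i. if i = 1 then f x else g x)"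
    by (auto simp: vec_eq_iff forall_2)
  moreover have "continuous_on S (\<lambda>x. if i = 1 then f x else g x)" for i :: 2
    using assms by (cases "i = 1") auto
  ultimately show ?thesis by (simp only:) (rule continuous_on_vec_lambda)
qed

lemma continuous_on_scale_complex2:
  fixes f :: "'a::topological_space \<Rightarrow> complex ^ 2"
  assumes "continuous_on S c" "continuous_on S f"
  shows "continuous_on S (\<lambda>x. c x *s f x)"
  unfolding vector_scalar_mult_def using assms by (intro continuous_intros)

lemma continuous_on_cinner2:
  assumes "continuous_on S f" "continuous_on S g"
  shows "continuous_on S (\<lambda>x. cinner2 (f x) (g x))"
  unfolding cinner2_def using assms by (intro continuous_intros)

lemma measurable_cinner2 [measurable]:
  assumes "f \<in> borel_measurable M" "g \<in> borel_measurable M"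
  shows "(\<lambda>x. cinner2 (f x) (g x)) \<in> borel_measurable M"
  by (rule borel_measurable_continuous_Pair[OF assms])
     (intro continuous_on_cinner2 continuous_intros)

lemma measurable_scale_complex2 [measurable]:
  fixes f :: "'a \<Rightarrow> complex ^ 2"
  assumes "c \<in> borel_measurable M" "f \<in> borel_measurable M"
  shows "(\<lambda>x. c x *s f x) \<in> borel_measurable M"
  by (rule borel_measurable_continuous_Pair[OF assms])
     (intro continuous_on_scale_complex2 continuous_intros)

lemma L2_pi_measurable: "f \<in> L2_pi \<Longrightarrow> f \<in> borel_measurable M_pi"
  and L2_pi_integrable: "f \<in> L2_pi \<Longrightarrow> integrable M_pi (\<lambda>x. (norm (f x))\<^sup>2)"
  by (auto simp: L2_pi_def)

lemma integrable_cinner2: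
  assumes "f \<in> L2_pi" "g \<in> L2_pi"
  shows "integrable M_pi (\<lambda>x. cinner2 (f x) (g x))"
proof (rule Bochner_Integration.integrable_bound)
  show "integrable M_pi (\<lambda>x. (norm (f x))\<^sup>2 + (norm (g x))\<^sup>2)"
    using assms by (intro Bochner_Integration.integrable_add L2_pi_integrable)
  show "(\<lambda>x. cinner2 (f x) (g x)) \<in> borel_measurable M_pi"
    using assms by (intro measurable_cinner2 L2_pi_measurable)
  show "AE x in M_pi. norm (cinner2 (f x) (g x)) \<le> norm ((norm (f x))\<^sup>2 + (norm (g x))\<^sup>2)"
    using norm_cinner2_le_squares by (intro always_eventually allI) (simp add: order_trans)
qed

lemma L2_pi_add:
  assumes "f \<in> L2_pi" "g \<in> L2_pi"
  shows "(\<lambda>x. f x + g x) \<in> L2_pi"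
  unfolding L2_pi_def
proof (intro CollectI conjI)
  show m: "(\<lambda>x. f x + g x) \<in> borel_measurable M_pi"
    using assms by (intro borel_measurable_add L2_pi_measurable)
  show "integrable M_pi (\<lambda>x. (norm (f x + g x))\<^sup>2)"
  proof (rule Bochner_Integration.integrable_bound)
    show "integrable M_pi (\<lambda>x. 2 * (norm (f x))\<^sup>2 + 2 * (norm (g x))\<^sup>2)"
      using assms by (intro Bochner_Integration.integrable_add integrable_mult_right L2_pi_integrable)
    show "(\<lambda>x. (norm (f x + g x))\<^sup>2) \<in> borel_measurable M_pi"
      using m by measurable
    have "(norm (f x + g x))\<^sup>2 \<le> 2 * (norm (f x))\<^sup>2 + 2 * (norm (g x))\<^sup>2" for x
    proof -
      have "(norm (f x + g x))\<^sup>2 \<le> (norm (f x) + norm (g x))\<^sup>2"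
        by (intro power_mono norm_triangle_ineq) auto
      also have "\<dots> \<le> 2 * (norm (f x))\<^sup>2 + 2 * (norm (g x))\<^sup>2"
        using sum_squares_bound[of "norm (f x)" "norm (g x)"] by (simp add: power2_sum)
      finally show ?thesis .
    qed
    then show "AE x in M_pi. norm ((norm (f x + g x))\<^sup>2) \<le> norm (2 * (norm (f x))\<^sup>2 + 2 * (norm (g x))\<^sup>2)"
      by (intro always_eventually allI) (simp add: order_trans)
  qed
qed

lemma L2_pi_scale:
  assumes "f \<in> L2_pi"
  shows "(\<lambda>x. c *s f x) \<in> L2_pi"
  unfolding L2_pi_def
proof (intro CollectI conjI)
  show "(\<lambda>x. c *s f x) \<in> borel_measurable M_pi"
    using assms by (intro measurable_scale_complex2 L2_pi_measurable) auto
  show "integrable M_pi (\<lambda>x. (norm (c *s f x))\<^sup>2)"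
    using L2_pi_integrable[OF assms] by (simp add: norm_scale_complex2 power_mult_distrib)
qed

lemma L2_pi_diff:
  assumes "f \<in> L2_pi" "g \<in> L2_pi"
  shows "(\<lambda>x. f x - g x) \<in> L2_pi"
  using L2_pi_add[OF assms(1) L2_pi_scale[OF assms(2), of "-1"]] by simp

lemma continuous_in_L2_pi:
  assumes "continuous_on {0..pi} f"
  shows "f \<in> L2_pi"
  unfolding L2_pi_def
  using assms by (auto intro!: continuous_imp_measurable_on_sets_lebesgue continuous_imp_integrable_real continuous_intros)

lemma L2_pi_sum:
  assumes "\<And>k. k \<in> F \<Longrightarrow> f k \<in> L2_pi"
  shows "(\<lambda>x. \<Sum>k\<in>F. f k x) \<in> L2_pi"
  using assms
proof (induction F rule: infinite_finite_induct)
  case (insert k F)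
  then show ?case using L2_pi_add[of "f k" "\<lambda>x. \<Sum>k\<in>F. f k x"] by simp
qed (auto intro!: continuous_in_L2_pi)

lemma L2_inner_add_left:
  "f \<in> L2_pi \<Longrightarrow> g \<in> L2_pi \<Longrightarrow> h \<in> L2_pi \<Longrightarrow> L2_inner (\<lambda>x. f x + g x) h = L2_inner f h + L2_inner g h"
  unfolding L2_inner_def cinner2_add_left by (intro Bochner_Integration.integral_add integrable_cinner2)

lemma L2_inner_diff_left:
  "f \<in> L2_pi \<Longrightarrow> g \<in> L2_pi \<Longrightarrow> h \<in> L2_pi \<Longrightarrow> L2_inner (\<lambda>x. f x - g x) h = L2_inner f h - L2_inner g h"
  unfolding L2_inner_def cinner2_diff_left by (intro Bochner_Integration.integral_diff integrable_cinner2)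

lemma L2_inner_scale_left: "L2_inner (\<lambda>x. c *s f x) g = c * L2_inner f g"
  unfolding L2_inner_def cinner2_scale_left by (rule integral_mult_right_zero)

lemma L2_inner_commute: "L2_inner f g = cnj (L2_inner g f)"
  unfolding L2_inner_def integral_cnj[symmetric] by (subst cinner2_commute) simp

lemma L2_inner_same: "L2_inner f f = of_real (LINT x|M_pi. (norm (f x))\<^sup>2)"
  unfolding L2_inner_def cinner2_same by (rule integral_complex_of_real)

lemma L2_inner_sum_left:
  assumes "\<And>k. k \<in> F \<Longrightarrow> f k \<in> L2_pi" "g \<in> L2_pi"
  shows "L2_inner (\<lambda>x. \<Sum>k\<in>F. f k x) g = (\<Sum>k\<in>F. L2_inner (f k) g)"
  using assms
proof (induction F rule: infinite_finite_induct)
  case (insert k F)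
  then show ?case
    using L2_inner_add_left[OF _ L2_pi_sum, of "f k" F f g] by simp
qed (simp_all add: L2_inner_def cinner2_def)

lemma L2_inner_cong_AE:
  assumes "AE x in M_pi. f x = f' x" "f \<in> L2_pi" "f' \<in> L2_pi" "g \<in> L2_pi"
  shows "L2_inner f g = L2_inner f' g"
  unfolding L2_inner_def
  using assms by (intro integral_cong_AE measurable_cinner2 L2_pi_measurable) auto

section \<open>The eigenfunctions of the free operator\<close>

lemma eig0_eq_pt: "eig0 \<alpha> \<beta> k = pt ((\<alpha> - \<beta>) / pi) k"
  by (simp add: eig0_def pt_def)

lemma eigfun_nth:
  "eigfun \<alpha> l x $ 1 = of_real (cos (l * x - \<alpha>) / sqrt pi)"
  "eigfun \<alpha> l x $ 2 = of_real (sin (l * x - \<alpha>) / sqrt pi)"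
  by (simp_all add: eigfun_def)

lemma norm_eigfun_le: "norm (eigfun \<alpha> l x) \<le> 1"
proof (rule power2_le_imp_le)
  have "(norm (eigfun \<alpha> l x))\<^sup>2 = ((cos (l * x - \<alpha>))\<^sup>2 + (sin (l * x - \<alpha>))\<^sup>2) / pi"
    unfolding norm_complex2 eigfun_nth norm_of_real
    by (simp add: power_divide flip: add_divide_distrib)
  also have "\<dots> \<le> 1" using pi_gt3 by (simp add: sin_cos_squared_add2)
  finally show "(norm (eigfun \<alpha> l x))\<^sup>2 \<le> 1\<^sup>2" by simp
qed simp

lemma continuous_on_eigfun: "continuous_on S (eigfun \<alpha> l)"
  unfolding eigfun_def
  by (intro continuous_on_scale_complex2 continuous_on_vector2 continuous_intros)

lemma eigfun_in_L2_pi: "eigfun \<alpha> l \<in> L2_pi"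
  by (rule continuous_in_L2_pi) (rule continuous_on_eigfun)

lemma eigfun_orthonormal:
  "L2_inner (eigfun \<alpha> (eig0 \<alpha> \<beta> j)) (eigfun \<alpha> (eig0 \<alpha> \<beta> k)) = (if j = k then 1 else 0)"
proof -
  define n where "n = of_int (j - k) * (1::real)"
  have ci: "cinner2 (eigfun \<alpha> (eig0 \<alpha> \<beta> j) x) (eigfun \<alpha> (eig0 \<alpha> \<beta> k) x) = of_real (cos (n * x) / pi)" for x
  proof -
    define A where "A = eig0 \<alpha> \<beta> j * x - \<alpha>"
    define B where "B = eig0 \<alpha> \<beta> k * x - \<alpha>"
    \<comment> \<open>The phases \<alpha> cancel and the frequencies differ by the integer
      \<open>j - k\<close>.\<close>
    have "cos (n * x) = cos (A - B)"
      by (simp add: n_def A_def B_def eig0_def algebra_simps)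
    also have "\<dots> / pi = cos A / sqrt pi * (cos B / sqrt pi) + sin A / sqrt pi * (sin B / sqrt pi)"
      by (simp add: cos_diff add_divide_distrib)
    finally have "of_real (cos (n * x) / pi) =
        (of_real (cos A / sqrt pi * (cos B / sqrt pi) + sin A / sqrt pi * (sin B / sqrt pi)) :: complex)"
      by (simp only:)
    then show ?thesis
      unfolding cinner2_def eigfun_nth A_def[symmetric] B_def[symmetric]
      by (simp only: of_real_add of_real_mult complex_cnj_complex_of_real)
  qed
  have "(LINT x|M_pi. cos (n * x) / pi) = integral {0..pi} (\<lambda>x. cos (n * x) / pi)"
    by (rule lebesgue_integral_eq_integral) (auto intro!: continuous_imp_integrable_real continuous_intros)
  also have "\<dots> = (if j = k then 1 else 0)"
  proof (cases "j = k")
    case True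
    then show ?thesis by (simp add: n_def)
  next
    case False
    then have "n \<noteq> 0" by (simp add: n_def)
    have "((\<lambda>x. cos (n * x) / pi) has_integral (sin (n * pi) / (n * pi) - sin (n * 0) / (n * pi))) {0..pi}"
      using \<open>n \<noteq> 0\<close> by (intro fundamental_theorem_of_calculus)
        (auto intro!: derivative_eq_intros simp flip: has_real_derivative_iff_has_vector_derivative)
    moreover have "sin (n * pi) = 0"
      unfolding sin_zero_iff_int2 by (rule exI[of _ "j - k"]) (simp add: n_def)
    ultimately have "((\<lambda>x. cos (n * x) / pi) has_integral 0) {0..pi}" by simp
    from integral_unique[OF this] False show ?thesis by (simp only: if_False)
  qed
  finally have "(LINT x|M_pi. complex_of_real (cos (n * x) / pi)) = of_real (if j = k then 1 else 0)"
    by (simp only: integral_complex_of_real)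
  then show ?thesis unfolding L2_inner_def ci by (simp split: if_splits)
qed

lemma fcoef_eigfun: "fcoef \<alpha> \<beta> (eigfun \<alpha> (eig0 \<alpha> \<beta> j)) k = (if j = k then 1 else 0)"
  by (simp add: fcoef_def eigfun_orthonormal)

lemma fcoef_add: "f \<in> L2_pi \<Longrightarrow> g \<in> L2_pi \<Longrightarrow> fcoef \<alpha> \<beta> (\<lambda>x. f x + g x) k = fcoef \<alpha> \<beta> f k + fcoef \<alpha> \<beta> g k"
  and fcoef_diff: "f \<in> L2_pi \<Longrightarrow> g \<in> L2_pi \<Longrightarrow> fcoef \<alpha> \<beta> (\<lambda>x. f x - g x) k = fcoef \<alpha> \<beta> f k - fcoef \<alpha> \<beta> g k"
  and fcoef_scale: "fcoef \<alpha> \<beta> (\<lambda>x. c *s f x) k = c * fcoef \<alpha> \<beta> f k"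
  by (simp_all add: fcoef_def L2_inner_add_left L2_inner_diff_left L2_inner_scale_left eigfun_in_L2_pi)

lemma fcoef_sum:
  "(\<And>i. i \<in> F \<Longrightarrow> f i \<in> L2_pi) \<Longrightarrow> fcoef \<alpha> \<beta> (\<lambda>x. \<Sum>i\<in>F. f i x) k = (\<Sum>i\<in>F. fcoef \<alpha> \<beta> (f i) k)"
  by (simp add: fcoef_def L2_inner_sum_left eigfun_in_L2_pi)

lemma fcoef_cong_AE:
  "AE x in M_pi. f x = g x \<Longrightarrow> f \<in> L2_pi \<Longrightarrow> g \<in> L2_pi \<Longrightarrow> fcoef \<alpha> \<beta> f k = fcoef \<alpha> \<beta> g k"
  unfolding fcoef_def by (intro L2_inner_cong_AE eigfun_in_L2_pi)

text \<open>The partial sum \<open>s\<close> has the coefficients of \<open>f\<close> on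
  \<open>F\<close>, so \<open>f - s\<close> is orthogonal to \<open>s\<close>, and the squared norm
  of \<open>f - s\<close> is the difference of the two sides.\<close>

lemma bessel:
  assumes "f \<in> L2_pi" "finite F"
  shows "(\<Sum>k\<in>F. (cmod (fcoef \<alpha> \<beta> f k))\<^sup>2) \<le> (LINT x|M_pi. (norm (f x))\<^sup>2)"
proof -
  let ?c = "fcoef \<alpha> \<beta> f" and ?u = "\<lambda>k. eigfun \<alpha> (eig0 \<alpha> \<beta> k)"
  define s where "s = (\<lambda>x. \<Sum>k\<in>F. ?c k *s ?u k x)"
  have s: "s \<in> L2_pi" unfolding s_def by (intro L2_pi_sum L2_pi_scale eigfun_in_L2_pi)
  have coef: "fcoef \<alpha> \<beta> s k = (if k \<in> F then ?c k else 0)" for k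
    unfolding s_def using assms(2)
    by (subst fcoef_sum) (auto intro!: L2_pi_scale eigfun_in_L2_pi simp: fcoef_scale fcoef_eigfun if_distrib cong: if_cong)
  have inner_s: "L2_inner s g = (\<Sum>k\<in>F. ?c k * cnj (fcoef \<alpha> \<beta> g k))" if "g \<in> L2_pi" for g
    unfolding s_def fcoef_def using that
    by (subst L2_inner_sum_left) (auto intro!: L2_pi_scale eigfun_in_L2_pi sum.cong simp: L2_inner_scale_left L2_inner_commute[of "?u _"])
  have sq: "(\<Sum>k\<in>F. ?c k * cnj (?c k)) = of_real (\<Sum>k\<in>F. (cmod (?c k))\<^sup>2)"
    by (simp only: of_real_sum complex_norm_square)
  have "L2_inner (\<lambda>x. f x - s x) (\<lambda>x. f x - s x) = L2_inner f (\<lambda>x. f x - s x) - L2_inner s (\<lambda>x. f x - s x)"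
    by (intro L2_inner_diff_left assms s L2_pi_diff)
  also have "L2_inner s (\<lambda>x. f x - s x) = 0"
    using assms s by (subst inner_s) (auto simp: L2_pi_diff fcoef_diff coef)
  also have "L2_inner f (\<lambda>x. f x - s x) = cnj (L2_inner f f - L2_inner s f)"
    using assms s by (subst L2_inner_commute) (simp add: L2_inner_diff_left)
  also have "L2_inner s f = of_real (\<Sum>k\<in>F. (cmod (?c k))\<^sup>2)"
    using inner_s[OF assms(1)] sq by simp
  finally have "of_real (LINT x|M_pi. (norm (f x - s x))\<^sup>2) =
      (of_real ((LINT x|M_pi. (norm (f x))\<^sup>2) - (\<Sum>k\<in>F. (cmod (?c k))\<^sup>2)) :: complex)"
    unfolding L2_inner_same by simp
  then have "(LINT x|M_pi. (norm (f x - s x))\<^sup>2) = (LINT x|M_pi. (norm (f x))\<^sup>2) - (\<Sum>k\<in>F. (cmod (?c k))\<^sup>2)"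
    by (simp only: of_real_eq_iff)
  moreover have "(LINT x|M_pi. (norm (f x - s x))\<^sup>2) \<ge> 0" by simp
  ultimately show ?thesis by linarith
qed

lemma fcoef_square_summable:
  assumes "f \<in> L2_pi"
  shows "(\<lambda>k. (cmod (fcoef \<alpha> \<beta> f k))\<^sup>2) summable_on UNIV"
  by (rule nonneg_bdd_above_summable_on)
     (use bessel[OF assms] in \<open>auto intro!: bdd_aboveI2[where M = "LINT x|M_pi. (norm (f x))\<^sup>2"]\<close>)

section \<open>Completeness of the eigenfunctions\<close>

text \<open>Since \<open>cos\<close> maps \<open>{0..pi}\<close> homeomorphically onto
  \<open>{-1..1}\<close>, Weierstrass approximation of \<open>h (arccos t)\<close> makes
  \<open>h\<close> a uniform limit of polynomials in \<open>cos x\<close>; hence \<open>h\<close> is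
  orthogonal to itself.\<close>

lemma continuous_orth_cos_powers_eq_0:
  fixes h :: "real \<Rightarrow> real"
  assumes h: "continuous_on {0..pi} h"
    and orth: "\<And>k::nat. integral {0..pi} (\<lambda>x. h x * cos x ^ k) = 0"
    and x: "x \<in> {0..pi}"
  shows "h x = 0"
proof -
  have int: "(\<lambda>x. h x * g x) integrable_on {0..pi}" if "continuous_on {0..pi} g" for g
    by (intro integrable_continuous_real continuous_intros h that)
  have poly: "integral {0..pi} (\<lambda>x. h x * p (cos x)) = 0" if p: "real_polynomial_function p" for p
  proof -
    obtain a n where p_eq: "p = (\<lambda>x. \<Sum>i\<le>n. a i * x ^ i)"
      using p unfolding real_polynomial_function_iff_sum by auto
    have "integral {0..pi} (\<lambda>x. h x * p (cos x)) = integral {0..pi} (\<lambda>x. \<Sum>i\<le>n. a i * (h x * cos x ^ i))"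
      by (simp add: p_eq sum_distrib_left mult_ac)
    also have "\<dots> = (\<Sum>i\<le>n. integral {0..pi} (\<lambda>x. a i * (h x * cos x ^ i)))"
      by (intro integral_sum integrable_continuous_real continuous_intros h) auto
    also have "\<dots> = 0" by (simp add: orth)
    finally show ?thesis .
  qed
  have "continuous_on {-1..1} (\<lambda>t. h (arccos t))"
    by (rule continuous_on_compose2[OF h continuous_on_arccos']) (auto simp: arccos_lbound arccos_ubound)
  then have approx: "\<exists>p. real_polynomial_function p \<and> (\<forall>x\<in>{0..pi}. \<bar>h x - p (cos x)\<bar> < e)" if "e > 0" for e
  proof -
    obtain p where p: "real_polynomial_function p" "\<And>t. t \<in> {-1..1} \<Longrightarrow> \<bar>h (arccos t) - p t\<bar> < e"
      using Stone_Weierstrass_real_polynomial_function[OF compact_Icc \<open>continuous_on {-1..1} (\<lambda>t. h (arccos t))\<close> \<open>e > 0\<close>]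
      by blast
    have "\<bar>h x - p (cos x)\<bar> < e" if "x \<in> {0..pi}" for x
      using p(2)[of "cos x"] that by (simp add: arccos_cos)
    then show ?thesis using p(1) by blast
  qed
  have hh: "integral {0..pi} (\<lambda>x. h x * h x) = 0"
  proof (rule ccontr)
    let ?J = "integral {0..pi} (\<lambda>x. h x * h x)" and ?H = "integral {0..pi} (\<lambda>x. \<bar>h x\<bar>)"
    assume "?J \<noteq> 0"
    moreover have "?J \<ge> 0" by (rule integral_nonneg[OF int[OF h]]) auto
    moreover have "?H \<ge> 0"
      by (rule integral_nonneg) (auto intro!: integrable_continuous_real continuous_intros h)
    \<comment> \<open>With this tolerance the estimate below becomes the contradiction
      \<open>?J <= ?H * (?J / (?H + 1)) < ?J\<close>.\<close>
    ultimately have e: "?J / (?H + 1) > 0" by simp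
    then obtain p where p: "real_polynomial_function p" "\<And>x. x \<in> {0..pi} \<Longrightarrow> \<bar>h x - p (cos x)\<bar> < ?J / (?H + 1)"
      using approx[OF e] by auto
    have pc: "continuous_on {0..pi} (\<lambda>x. p (cos x))"
      by (rule continuous_on_compose2[OF continuous_on_polymonial_function[of p UNIV]])
         (use p(1) in \<open>auto intro!: continuous_intros simp: real_polynomial_function_eq\<close>)
    have "?J = integral {0..pi} (\<lambda>x. h x * h x - h x * p (cos x))"
      using integral_diff[OF int[OF h] int[OF pc]] poly[OF p(1)] by simp
    also have "\<dots> \<le> integral {0..pi} (\<lambda>x. \<bar>h x\<bar> * (?J / (?H + 1)))"
    proof (rule integral_le)
      show "(\<lambda>x. h x * h x - h x * p (cos x)) integrable_on {0..pi}"
        by (intro integrable_diff int h pc)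
      show "(\<lambda>x. \<bar>h x\<bar> * (?J / (?H + 1))) integrable_on {0..pi}"
        by (intro integrable_continuous_real continuous_intros h)
      show "h x * h x - h x * p (cos x) \<le> \<bar>h x\<bar> * (?J / (?H + 1))" if "x \<in> {0..pi}" for x
      proof -
        have "h x * h x - h x * p (cos x) \<le> \<bar>h x * (h x - p (cos x))\<bar>" by (simp add: algebra_simps)
        also have "\<dots> \<le> \<bar>h x\<bar> * (?J / (?H + 1))"
          unfolding abs_mult using p(2)[OF that] by (intro mult_left_mono) auto
        finally show ?thesis .
      qed
    qed
    also have "\<dots> = ?H * (?J / (?H + 1))" by (rule integral_mult_left)
    also have "\<dots> < ?J" using \<open>?H \<ge> 0\<close> \<open>?J \<ge> 0\<close> \<open>?J \<noteq> 0\<close> by (simp add: field_simps)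
    finally show False by simp
  qed
  have "continuous_on (cbox 0 pi) (\<lambda>x. h x * h x)" using h by (auto intro!: continuous_intros)
  moreover have "((\<lambda>x. h x * h x) has_integral 0) (cbox 0 pi)"
    using integrable_integral[OF int[OF h]] hh by simp
  ultimately have "h x * h x = 0"
    using has_integral_0_cbox_imp_0[of 0 pi "\<lambda>x. h x * h x" x] x by (auto simp: not_le)
  then show ?thesis by simp
qed

lemma continuous_orth_cos_eq_0:
  fixes h :: "real \<Rightarrow> complex"
  assumes h: "continuous_on {0..pi} h"
    and orth: "\<And>k::nat. integral {0..pi} (\<lambda>x. h x * of_real (cos x ^ k)) = 0"
    and x: "x \<in> {0..pi}"
  shows "h x = 0"
proof -
  have int: "(\<lambda>x. h x * of_real (cos x ^ k)) integrable_on {0..pi}" for k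
    by (intro integrable_continuous_real continuous_intros h)
  have "integral {0..pi} (\<lambda>x. Re (h x) * cos x ^ k) = 0" for k
    using integral_linear[OF int bounded_linear_Re, of k] orth[of k] by (simp add: o_def)
  then have "Re (h x) = 0"
    by (intro continuous_orth_cos_powers_eq_0[of "\<lambda>x. Re (h x)"] continuous_intros h x) auto
  have "integral {0..pi} (\<lambda>x. Im (h x) * cos x ^ k) = 0" for k
    using integral_linear[OF int bounded_linear_Im, of k] orth[of k] by (simp add: o_def)
  then have "Im (h x) = 0"
    by (intro continuous_orth_cos_powers_eq_0[of "\<lambda>x. Im (h x)"] continuous_intros h x) auto
  with \<open>Re (h x) = 0\<close> show ?thesis by (simp add: complex_eq_iff)
qed

text \<open>Multiplying by \<^term>\<open>cos x\<close> turns a frequency into the mean of its two neighbours.\<close>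

lemma integral_cos_power_mult_eq_0:
  fixes h :: "real \<Rightarrow> complex" and f :: "int \<Rightarrow> real \<Rightarrow> real"
  assumes h: "continuous_on {0..pi} h" and f: "\<And>n. continuous_on {0..pi} (f n)"
    and step: "\<And>n x. cos x * f n x = (f (n + 1) x + f (n - 1) x) / 2"
    and orth: "\<And>n. integral {0..pi} (\<lambda>x. h x * of_real (f n x)) = 0"
  shows "integral {0..pi} (\<lambda>x. h x * of_real (cos x ^ k * f n x)) = 0"
proof (induction k arbitrary: n)
  case (Suc k)
  have int: "(\<lambda>x. h x * of_real (cos x ^ k * f n x)) integrable_on {0..pi}" for n
    by (intro integrable_continuous_real continuous_intros h f)
  have "cos x ^ Suc k * f n x = (cos x ^ k * f (n + 1) x + cos x ^ k * f (n - 1) x) / 2" for x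
  proof -
    have "cos x ^ Suc k * f n x = cos x ^ k * (cos x * f n x)" by simp
    then show ?thesis unfolding step by (simp add: algebra_simps)
  qed
  then have "integral {0..pi} (\<lambda>x. h x * of_real (cos x ^ Suc k * f n x)) =
     integral {0..pi} (\<lambda>x. (h x * of_real (cos x ^ k * f (n + 1) x) + h x * of_real (cos x ^ k * f (n - 1) x)) * (1/2))"
    by (simp add: algebra_simps add_divide_distrib)
  also have "\<dots> = integral {0..pi} (\<lambda>x. h x * of_real (cos x ^ k * f (n + 1) x) + h x * of_real (cos x ^ k * f (n - 1) x)) * (1/2)"
    by (rule integral_mult_left)
  also have "\<dots> = 0"
    using Suc.IH by (subst integral_add[OF int int]) simp
  finally show ?case .
qed (simp add: orth)

lemma continuous_eq_0_at_endpoints: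
  fixes f :: "real \<Rightarrow> complex ^ 2"
  assumes f: "continuous_on {0..pi} f" and zero: "\<And>x. 0 < x \<Longrightarrow> x < pi \<Longrightarrow> f x = 0" and x: "x \<in> {0..pi}"
  shows "f x = 0"
proof -
  have "closure {0<..<pi} = {0..pi}" using pi_gt_zero by (intro closure_greaterThanLessThan) auto
  then show ?thesis
    using continuous_constant_on_closure[of "{0<..<pi}" f 0 x] f zero x by auto
qed

text \<open>Absorbing the offset \<open>c\<close> and the phase into \<open>f\<close> leaves integer
  frequencies. Adding and subtracting the relations for \<open>k\<close> and \<open>-k\<close>
  separates \<open>P + M\<close>, orthogonal to all cosines, from \<open>P - M\<close>, orthogonal
  to all sines; both are then reduced to powers of \<open>cos x\<close>.\<close>

lemma fcoef_complete:
  assumes f: "continuous_on {0..pi} f" and coef: "\<And>k. fcoef \<alpha> \<beta> f k = 0" and x: "x \<in> {0..pi}"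
  shows "f x = 0"
proof -
  define c where "c = (\<alpha> - \<beta>) / pi"
  \<comment> \<open>\<open>P\<close> and \<open>M\<close> come from the combinations of the
    components that diagonalise rotations of the plane, twisted by the offset and the phase of the
    eigenfunctions.\<close>
  define P where "P x = (f x $ 1 - \<i> * f x $ 2) * exp (\<i> * of_real (c * x - \<alpha>))" for x
  define M where "M x = (f x $ 1 + \<i> * f x $ 2) * exp (- \<i> * of_real (c * x - \<alpha>))" for x
  have cont: "continuous_on {0..pi} P" "continuous_on {0..pi} M"
    unfolding P_def M_def by (intro continuous_intros f)+
  define g where "g k x = P x * exp (\<i> * of_real (of_int k * x)) + M x * exp (- \<i> * of_real (of_int k * x))" for k x
  have contg: "continuous_on {0..pi} (g k)" for k
    unfolding g_def by (intro continuous_intros cont)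
  have "integral {0..pi} (g k) = 0" for k
  proof -
    have eq: "g k x = of_real (2 * sqrt pi) * cinner2 (f x) (eigfun \<alpha> (eig0 \<alpha> \<beta> k) x)" for x
    proof -
      define t where "t = of_real (eig0 \<alpha> \<beta> k * x - \<alpha>) * (1 :: complex)"
      have "t = of_real (c * x - \<alpha>) + of_real (of_int k * x)"
        by (simp add: t_def eig0_def c_def algebra_simps)
      note t_eq = this
      have e: "exp (\<i> * of_real (c * x - \<alpha>)) * exp (\<i> * of_real (of_int k * x)) = exp (\<i> * t)"
        "exp (- \<i> * of_real (c * x - \<alpha>)) * exp (- \<i> * of_real (of_int k * x)) = exp (- (\<i> * t))"
        unfolding exp_add[symmetric] t_eq by (simp_all only: distrib_left mult_minus_left minus_add_distrib)
      have "g k x = (f x $ 1 - \<i> * f x $ 2) * exp (\<i> * t) + (f x $ 1 + \<i> * f x $ 2) * exp (- (\<i> * t))"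
        unfolding g_def P_def M_def mult.assoc e ..
      also have "\<dots> = 2 * (f x $ 1 * cos t + f x $ 2 * sin t)"
        unfolding exp_Euler exp_minus_Euler by (simp add: algebra_simps)
      also have "\<dots> = of_real (2 * sqrt pi) * cinner2 (f x) (eigfun \<alpha> (eig0 \<alpha> \<beta> k) x)"
        unfolding cinner2_def eigfun_nth t_def mult_1_right cos_of_real sin_of_real
        by (simp add: algebra_simps)
      finally show ?thesis .
    qed
    have "integral {0..pi} (g k) = (LINT x|M_pi. g k x)"
      by (rule lebesgue_integral_eq_integral[symmetric]) (auto intro!: continuous_imp_integrable_real contg)
    also have "\<dots> = of_real (2 * sqrt pi) * fcoef \<alpha> \<beta> f k"
      unfolding eq fcoef_def L2_inner_def by (rule integral_mult_right_zero)
    finally show ?thesis using coef by simp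
  qed note g0 = this
  have g_eq: "g n x = (P x + M x) * of_real (cos (of_int n * x)) + \<i> * ((P x - M x) * of_real (sin (of_int n * x)))" for n x
  proof -
    define \<theta> where "\<theta> = of_int n * x"
    have "exp (\<i> * of_real \<theta>) = of_real (cos \<theta>) + \<i> * of_real (sin \<theta>)"
      "exp (- \<i> * of_real \<theta>) = of_real (cos \<theta>) - \<i> * of_real (sin \<theta>)"
      using exp_Euler[of "of_real \<theta>"] exp_minus_Euler[of "of_real \<theta>"] by (simp_all add: cos_of_real sin_of_real)
    then show ?thesis unfolding g_def \<theta>_def[symmetric] by (simp only:) (simp add: algebra_simps)
  qed
  have gint: "g k integrable_on {0..pi}" for k
    by (rule integrable_continuous_real[OF contg])
  have "integral {0..pi} (\<lambda>x. (P x + M x) * of_real (cos (of_int n * x))) = 0" for n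
  proof -
    have "(P x + M x) * of_real (cos (of_int n * x)) = (g n x + g (- n) x) * (1/2)" for x
      unfolding g_eq by simp
    then have "integral {0..pi} (\<lambda>x. (P x + M x) * of_real (cos (of_int n * x))) = integral {0..pi} (\<lambda>x. (g n x + g (- n) x) * (1/2))"
      by (simp only:)
    also have "\<dots> = 0" by (simp only: integral_mult_left integral_add[OF gint gint] g0) simp
    finally show ?thesis .
  qed
  then have "integral {0..pi} (\<lambda>x. (P x + M x) * of_real (cos x ^ k * cos (of_int 0 * x))) = 0" for k
    by (intro integral_cos_power_mult_eq_0[where f = "\<lambda>n x. cos (of_int n * x)"] continuous_intros cont)
       (auto simp: algebra_simps cos_add cos_diff)
  then have PM: "P x + M x = 0" if "x \<in> {0..pi}" for x
    using that by (intro continuous_orth_cos_eq_0[of "\<lambda>x. P x + M x"] continuous_intros cont) auto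
  have "integral {0..pi} (\<lambda>x. (P x - M x) * of_real (sin (of_int n * x))) = 0" for n
  proof -
    have "(P x - M x) * of_real (sin (of_int n * x)) = (g n x - g (- n) x) * (- \<i> / 2)" for x
      unfolding g_eq by (simp add: algebra_simps)
    then have "integral {0..pi} (\<lambda>x. (P x - M x) * of_real (sin (of_int n * x))) = integral {0..pi} (\<lambda>x. (g n x - g (- n) x) * (- \<i> / 2))"
      by (simp only:)
    also have "\<dots> = 0" by (simp only: integral_mult_left integral_diff[OF gint gint] g0) simp
    finally show ?thesis .
  qed
  \<comment> \<open>Starting from frequency 1 leaves a factor \<open>sin x\<close>. It can be
    cancelled on the open interval, and continuity recovers the end points.\<close>
  then have "integral {0..pi} (\<lambda>x. (P x - M x) * of_real (cos x ^ k * sin (of_int 1 * x))) = 0" for k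
    by (intro integral_cos_power_mult_eq_0[where f = "\<lambda>n x. sin (of_int n * x)"] continuous_intros cont)
       (auto simp: algebra_simps sin_add sin_diff)
  then have "integral {0..pi} (\<lambda>x. ((P x - M x) * of_real (sin x)) * of_real (cos x ^ k)) = 0" for k
    by (simp add: mult_ac)
  then have "(P x - M x) * of_real (sin x) = 0" if "x \<in> {0..pi}" for x
    using that by (intro continuous_orth_cos_eq_0[of "\<lambda>x. (P x - M x) * of_real (sin x)"] continuous_intros cont) auto
  then have PM': "P x - M x = 0" if "0 < x" "x < pi" for x
  proof -
    have "sin x \<noteq> 0" using sin_gt_zero[of x] that by simp
    then show ?thesis using \<open>\<And>x. x \<in> {0..pi} \<Longrightarrow> (P x - M x) * of_real (sin x) = 0\<close>[of x] that by simp
  qed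
  have "f x = 0" if "0 < x" "x < pi" for x
  proof -
    have "P x = 0" "M x = 0" using PM[of x] PM'[of x] that by auto
    then have "f x $ 1 - \<i> * f x $ 2 = 0" "f x $ 1 + \<i> * f x $ 2 = 0" by (auto simp: P_def M_def)
    then have "f x $ 1 = 0" "f x $ 2 = 0" by (auto simp: complex_eq_iff)
    then show ?thesis by (auto simp: vec_eq_iff forall_2)
  qed
  then show ?thesis using continuous_eq_0_at_endpoints[OF f _ x] by blast
qed

section \<open>Absolutely continuous functions\<close>

definition ac_modulus :: "real \<Rightarrow> real \<Rightarrow> (real \<Rightarrow> 'a::real_normed_vector) \<Rightarrow> real \<Rightarrow> real \<Rightarrow> bool" where
  "ac_modulus a b f \<epsilon> \<delta> \<longleftrightarrow> (\<forall>(n::nat) s t.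
      (\<forall>i<n. a \<le> s i \<and> s i \<le> t i \<and> t i \<le> b) \<and>
      (\<forall>i<n. \<forall>j<n. i \<noteq> j \<longrightarrow> {s i<..<t i} \<inter> {s j<..<t j} = {}) \<and>
      (\<Sum>i<n. t i - s i) < \<delta>
      \<longrightarrow> (\<Sum>i<n. norm (f (t i) - f (s i))) < \<epsilon>)"

lemma abs_cont_on_iff: "abs_cont_on a b f \<longleftrightarrow> (\<forall>\<epsilon>>0. \<exists>\<delta>>0. ac_modulus a b f \<epsilon> \<delta>)"
  unfolding abs_cont_on_def ac_modulus_def ..

lemma ac_modulusD:
  assumes "ac_modulus a b f \<epsilon> \<delta>"
    and "\<And>i. i < n \<Longrightarrow> a \<le> s i \<and> s i \<le> t i \<and> t i \<le> b"
    and "\<And>i j. i < n \<Longrightarrow> j < n \<Longrightarrow> i \<noteq> j \<Longrightarrow> {s i<..<t i} \<inter> {s j<..<t j} = {}"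
    and "(\<Sum>i<n. t i - s i) < \<delta>"
  shows "(\<Sum>i<n::nat. norm (f (t i) - f (s i))) < \<epsilon>"
  by (rule assms(1)[unfolded ac_modulus_def, rule_format], intro conjI allI impI assms)

lemma ac_modulusI:
  assumes "\<And>n s t. (\<And>i. i < n \<Longrightarrow> a \<le> s i \<and> s i \<le> t i \<and> t i \<le> b) \<Longrightarrow>
    (\<And>i j. i < n \<Longrightarrow> j < n \<Longrightarrow> i \<noteq> j \<Longrightarrow> {s i<..<t i} \<inter> {s j<..<t j} = {}) \<Longrightarrow>
    (\<Sum>i<n. t i - s i) < \<delta> \<Longrightarrow> (\<Sum>i<n::nat. norm (f (t i) - f (s i))) < \<epsilon>"
  shows "ac_modulus a b f \<epsilon> \<delta>"
  unfolding ac_modulus_def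
proof (intro allI impI, elim conjE)
  fix n :: nat and s t
  assume "\<forall>i<n. a \<le> s i \<and> s i \<le> t i \<and> t i \<le> b" "(\<Sum>i<n. t i - s i) < \<delta>"
    "\<forall>i<n. \<forall>j<n. i \<noteq> j \<longrightarrow> {s i<..<t i} \<inter> {s j<..<t j} = {}"
  then show "(\<Sum>i<n. norm (f (t i) - f (s i))) < \<epsilon>"
    by (intro assms[rule_format]) simp_all
qed

text \<open>Absolute continuity is phrased with intervals numbered by natural numbers; the cells of
  a tagged division need an arbitrary finite index set.\<close>

lemma ac_modulus_finite:
  fixes s t :: "'c \<Rightarrow> real"
  assumes ac: "ac_modulus a b f \<epsilon> \<delta>" and fin: "finite D"
    and st: "\<And>i. i \<in> D \<Longrightarrow> a \<le> s i \<and> s i \<le> t i \<and> t i \<le> b"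
    and disj: "\<And>i j. i \<in> D \<Longrightarrow> j \<in> D \<Longrightarrow> i \<noteq> j \<Longrightarrow> {s i<..<t i} \<inter> {s j<..<t j} = {}"
    and small: "(\<Sum>i\<in>D. t i - s i) < \<delta>"
  shows "(\<Sum>i\<in>D. norm (f (t i) - f (s i))) < \<epsilon>"
proof -
  obtain h where h: "bij_betw h {..<card D} D"
    using ex_bij_betw_nat_finite[OF fin] by (auto simp: atLeast0LessThan)
  have hD: "h i \<in> D" if "i < card D" for i using h that by (auto simp: bij_betw_def)
  have inj: "h i \<noteq> h j" if "i < card D" "j < card D" "i \<noteq> j" for i j
    using h that by (auto simp: bij_betw_def inj_on_def)
  have reindex: "(\<Sum>i<card D. g (h i)) = (\<Sum>i\<in>D. g i)" for g :: "'c \<Rightarrow> real"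
    by (rule sum.reindex_bij_betw[OF h])
  have "(\<Sum>i<card D. norm (f (t (h i)) - f (s (h i)))) < \<epsilon>"
    by (rule ac_modulusD[OF ac, where n = "card D" and s = "\<lambda>i. s (h i)" and t = "\<lambda>i. t (h i)"])
       (use st disj hD inj small reindex[of "\<lambda>i. t i - s i"] in simp_all)
  then show ?thesis
    using reindex[of "\<lambda>i. norm (f (t i) - f (s i))"] by simp
qed

text \<open>Tags in the exceptional null set contribute intervals of small total length, hence by absolute
  continuity a small total increment; the other tags are treated as in the classical case.\<close>

theorem fundamental_theorem_of_calculus_abs_cont:
  fixes F :: "real \<Rightarrow> 'b::euclidean_space"
  assumes "a \<le> b" and ac: "abs_cont_on a b F" and N: "negligible N"
    and deriv: "\<And>x. x \<in> {a..b} - N \<Longrightarrow> (F has_vector_derivative f x) (at x within {a..b})"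
  shows "(f has_integral (F b - F a)) {a..b}"
proof -
  \<comment> \<open>The value 0 on the null set removes the unknown \<open>f x\<close> from Riemann
    sums at exceptional tags.\<close>
  define g where "g x = (if x \<in> N then 0 else f x)" for x
  have "(g has_integral (F b - F a)) {a..b}"
    unfolding has_integral_real
  proof (intro allI impI)
    fix e :: real assume "e > 0"
    \<comment> \<open>The added 1 covers \<open>a = b\<close>.\<close>
    define e1 where "e1 = e / (2 * (b - a + 1))"
    have "e1 > 0" using \<open>e > 0\<close> \<open>a \<le> b\<close> by (simp add: e1_def)
    have "e1 * (b - a) < e / 2"
    proof -
      have "e1 * (b - a) < e1 * (b - a + 1)" using \<open>e1 > 0\<close> by simp
      also have "\<dots> = e / 2"
      proof -
        have "b - a + 1 \<noteq> 0" using \<open>a \<le> b\<close> by linarith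
        then show ?thesis unfolding e1_def by (metis mult.commute nonzero_mult_divide_mult_cancel_left2 times_divide_eq_right)
      qed
      finally show ?thesis .
    qed
    obtain \<delta> where \<delta>: "\<delta> > 0" "ac_modulus a b F (e / 2) \<delta>"
      using ac half_gt_zero[OF \<open>e > 0\<close>] unfolding abs_cont_on_iff by blast
    \<comment> \<open>A gauge for this null integral forces the cells tagged in \<open>N\<close> to
      have total length below \<delta>.\<close>
    have "((indicator N :: real \<Rightarrow> real) has_integral 0) {a..b}"
      using N unfolding negligible_def box_real(2)[symmetric] by blast
    from this[unfolded has_integral_real, THEN spec, THEN mp, OF \<delta>(1)] obtain \<gamma>1 where \<gamma>1: "gauge \<gamma>1"
      and small: "\<forall>p. p tagged_division_of {a..b} \<and> \<gamma>1 fine p \<longrightarrow>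
        norm ((\<Sum>(x,K)\<in>p. measure lborel K *\<^sub>R (indicator N x :: real)) - 0) < \<delta>"
      by blast
    have "\<exists>d>0. x \<in> {a..b} - N \<longrightarrow> (\<forall>y\<in>{a..b}. norm (y - x) < d \<longrightarrow> norm (F y - F x - (y - x) *\<^sub>R f x) \<le> e1 * norm (y - x))" for x
    proof (cases "x \<in> {a..b} - N")
      case True
      from deriv[OF True] \<open>e1 > 0\<close> show ?thesis
        unfolding has_vector_derivative_def has_derivative_within_alt by fast
    qed (auto intro: exI[of _ 1])
    then obtain d where d: "\<And>x. d x > 0" "\<And>x y. x \<in> {a..b} - N \<Longrightarrow> y \<in> {a..b} \<Longrightarrow> norm (y - x) < d x \<Longrightarrow>
        norm (F y - F x - (y - x) *\<^sub>R f x) \<le> e1 * norm (y - x)"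
      by metis
    define \<gamma> where "\<gamma> x = \<gamma>1 x \<inter> ball x (d x)" for x
    have gauge: "gauge \<gamma>" unfolding \<gamma>_def using \<gamma>1 d(1) by (intro gauge_Int gauge_ball_dependent) auto
    have inner: "norm ((\<Sum>(x,K)\<in>p. measure lborel K *\<^sub>R g x) - (F b - F a)) < e"
      if p: "p tagged_division_of {a..b}" and fine: "\<gamma> fine p" for p
    proof -
      have "finite p" using p by blast
      define p' where "p' = {z \<in> p. fst z \<in> N}"
      have cell: "\<exists>u v. snd z = {u..v} \<and> u \<le> v \<and> fst z \<in> {u..v} \<and> a \<le> u \<and> v \<le> b \<and> {u..v} \<subseteq> \<gamma> (fst z)" if "z \<in> p" for z
      proof -
        obtain x K where z: "z = (x, K)" by force
        obtain u v where "K = cbox u v" using tagged_division_ofD(4)[OF p] \<open>z \<in> p\<close> z by blast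
        moreover have "x \<in> K" "K \<subseteq> {a..b}" using tagged_division_ofD(2,3)[OF p] that z by blast+
        moreover have "K \<subseteq> \<gamma> x" using fine that z by (auto simp: fine_def)
        ultimately show ?thesis using z by (intro exI[of _ u] exI[of _ v]) auto
      qed
      let ?s = "\<lambda>z. Inf (snd z)" and ?t = "\<lambda>z. Sup (snd z)"
      have st: "snd z = {?s z..?t z}" "?s z \<le> fst z" "fst z \<le> ?t z" "a \<le> ?s z" "?t z \<le> b"
        "{?s z..?t z} \<subseteq> \<gamma> (fst z)" "measure lborel (snd z) = ?t z - ?s z" if z: "z \<in> p" for z
      proof -
        obtain u v where "snd z = {u..v}" "u \<le> v" "fst z \<in> {u..v}" "a \<le> u" "v \<le> b" "{u..v} \<subseteq> \<gamma> (fst z)"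
          using cell[OF z] by blast
        then show "snd z = {?s z..?t z}" "?s z \<le> fst z" "fst z \<le> ?t z" "a \<le> ?s z" "?t z \<le> b"
          "{?s z..?t z} \<subseteq> \<gamma> (fst z)" "measure lborel (snd z) = ?t z - ?s z" by auto
      qed
      have disj: "{?s z<..<?t z} \<inter> {?s w<..<?t w} = {}" if "z \<in> p" "w \<in> p" "z \<noteq> w" for z w
      proof -
        have "interior (snd z) \<inter> interior (snd w) = {}"
          using tagged_division_ofD(5)[OF p, of "fst z" "snd z" "fst w" "snd w"] that by (cases z, cases w) auto
        then show ?thesis using st(1)[OF that(1)] st(1)[OF that(2)] by (metis interior_atLeastAtMost_real)
      qed
      have regular: "norm (measure lborel (snd z) *\<^sub>R g (fst z) - (F (?t z) - F (?s z))) \<le> e1 * measure lborel (snd z)" if z: "z \<in> p - p'" for z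
      proof -
        let ?x = "fst z"
        have zp: "z \<in> p" using z by blast
        note stz = st(2-7)[OF zp]
        then have x: "?x \<in> {a..b} - N" using z by (auto simp: p'_def)
        have "?s z \<in> \<gamma> ?x" "?t z \<in> \<gamma> ?x" using stz by auto
        then have near: "norm (?s z - ?x) < d ?x" "norm (?t z - ?x) < d ?x"
          by (auto simp: \<gamma>_def dist_norm norm_minus_commute)
        \<comment> \<open>Splitting the increment at the tag compares both end points with the
          linear approximation there; as the tag lies between them, the two errors add up to
          \<open>e1\<close> times the length.\<close>
        have "norm (measure lborel (snd z) *\<^sub>R g ?x - (F (?t z) - F (?s z))) =
            norm ((F (?s z) - F ?x - (?s z - ?x) *\<^sub>R f ?x) - (F (?t z) - F ?x - (?t z - ?x) *\<^sub>R f ?x))"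
          using x by (intro arg_cong[where f = norm]) (simp add: g_def stz(6) algebra_simps)
        also have "\<dots> \<le> e1 * norm (?s z - ?x) + e1 * norm (?t z - ?x)"
          using d(2)[OF x _ near(1)] d(2)[OF x _ near(2)] stz by (intro order_trans[OF norm_triangle_ineq4 add_mono]) auto
        also have "\<dots> = e1 * measure lborel (snd z)"
          unfolding stz(6) using stz(1,2) by (simp add: right_diff_distrib)
        finally show ?thesis .
      qed
      have "(\<Sum>z\<in>p'. ?t z - ?s z) = (\<Sum>(x,K)\<in>p. measure lborel K *\<^sub>R (indicator N x :: real))"
      proof -
        have "(\<Sum>z\<in>p'. ?t z - ?s z) = (\<Sum>z\<in>p. if fst z \<in> N then ?t z - ?s z else 0)"
          unfolding p'_def by (rule sum.inter_filter[OF \<open>finite p\<close>])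
        also have "\<dots> = (\<Sum>(x,K)\<in>p. measure lborel K *\<^sub>R (indicator N x :: real))"
          by (intro sum.cong refl) (use st(7) in \<open>force simp: case_prod_beta\<close>)
        finally show ?thesis .
      qed
      also have "\<dots> < \<delta>"
      proof -
        have "\<gamma>1 fine p" using fine by (auto simp: \<gamma>_def fine_def)
        then show ?thesis using small[rule_format, of p] p by (simp add: abs_less_iff)
      qed
      finally have irregular: "(\<Sum>z\<in>p'. norm (F (?t z) - F (?s z))) < e / 2"
        using \<open>finite p\<close> st(2-5) disj order_trans[OF st(2) st(3)]
        by (intro ac_modulus_finite[OF \<delta>(2)]) (simp_all add: p'_def)
      have "(\<Sum>(x,K)\<in>p. measure lborel K *\<^sub>R g x) - (F b - F a) =
          (\<Sum>z\<in>p. measure lborel (snd z) *\<^sub>R g (fst z) - (F (?t z) - F (?s z)))"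
        using additive_tagged_division_1[OF \<open>a \<le> b\<close> p, of F] by (simp add: case_prod_beta sum_subtractf)
      also have "\<dots> = (\<Sum>z\<in>p - p'. measure lborel (snd z) *\<^sub>R g (fst z) - (F (?t z) - F (?s z))) +
          (\<Sum>z\<in>p'. measure lborel (snd z) *\<^sub>R g (fst z) - (F (?t z) - F (?s z)))"
        using \<open>finite p\<close> by (intro sum.subset_diff) (auto simp: p'_def)
      also have "norm \<dots> \<le> (\<Sum>z\<in>p - p'. e1 * measure lborel (snd z)) + (\<Sum>z\<in>p'. norm (F (?t z) - F (?s z)))"
      proof (intro norm_triangle_le add_mono)
        show "norm (\<Sum>z\<in>p - p'. measure lborel (snd z) *\<^sub>R g (fst z) - (F (?t z) - F (?s z))) \<le> (\<Sum>z\<in>p - p'. e1 * measure lborel (snd z))"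
          by (rule sum_norm_le) (rule regular)
        show "norm (\<Sum>z\<in>p'. measure lborel (snd z) *\<^sub>R g (fst z) - (F (?t z) - F (?s z))) \<le> (\<Sum>z\<in>p'. norm (F (?t z) - F (?s z)))"
          by (rule sum_norm_le) (auto simp: p'_def g_def norm_minus_commute)
      qed
      also have "(\<Sum>z\<in>p - p'. e1 * measure lborel (snd z)) \<le> (\<Sum>z\<in>p. e1 * measure lborel (snd z))"
        using \<open>finite p\<close> \<open>e1 > 0\<close> by (intro sum_mono2) auto
      also have "(\<Sum>z\<in>p. e1 * measure lborel (snd z)) = e1 * (b - a)"
        using additive_content_tagged_division[of p a b] p \<open>a \<le> b\<close>
        by (simp add: case_prod_beta sum_distrib_left[symmetric])
      finally show ?thesis using irregular \<open>e1 * (b - a) < e / 2\<close> by linarith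
    qed
    show "\<exists>\<gamma>. gauge \<gamma> \<and> (\<forall>p. p tagged_division_of {a..b} \<and> \<gamma> fine p \<longrightarrow>
        norm ((\<Sum>(x,K)\<in>p. measure lborel K *\<^sub>R g x) - (F b - F a)) < e)"
      by (rule exI[of _ \<gamma>], intro conjI allI impI, rule gauge, elim conjE, rule inner)
  qed
  then show ?thesis
    by (rule has_integral_spike[OF N, rotated]) (auto simp: g_def)
qed

lemma abs_cont_on_continuous:
  assumes "abs_cont_on a b F"
  shows "continuous_on {a..b} F"
  unfolding continuous_on_iff
proof (intro ballI allI impI)
  fix x e :: real assume x: "x \<in> {a..b}" and "e > 0"
  obtain \<delta> where \<delta>: "\<delta> > 0" "ac_modulus a b F e \<delta>"
    using assms \<open>e > 0\<close> unfolding abs_cont_on_iff by blast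
  have "dist (F y) (F x) < e" if "y \<in> {a..b}" "dist y x < \<delta>" for y
    using ac_modulusD[OF \<delta>(2), of 1 "\<lambda>_. min x y" "\<lambda>_. max x y"] that x
    by (cases "x \<le> y") (auto simp: dist_norm norm_minus_commute)
  then show "\<exists>d>0. \<forall>y\<in>{a..b}. dist y x < d \<longrightarrow> dist (F y) (F x) < e" using \<delta>(1) by blast
qed

text \<open>With \<open>G\<close> the identity this covers products of a bounded absolutely
  continuous function with a bounded Lipschitz function.\<close>

lemma abs_cont_on_bound:
  assumes "abs_cont_on a b F" "abs_cont_on a b G" "0 \<le> K" "0 \<le> L"
    and le: "\<And>x y. a \<le> x \<Longrightarrow> x \<le> y \<Longrightarrow> y \<le> b \<Longrightarrow>
      norm (H y - H x) \<le> K * norm (F y - F x) + L * norm (G y - G x)"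
  shows "abs_cont_on a b H"
  unfolding abs_cont_on_iff
proof (intro allI impI)
  fix e :: real assume "e > 0"
  define e' where "e' = e / (K + L + 1)"
  have "e' > 0" using \<open>e > 0\<close> assms(3,4) by (simp add: e'_def)
  then have "(K + L) * e' < (K + L + 1) * e'" by simp
  also have "\<dots> = e"
  proof -
    have "K + L + 1 \<noteq> 0" using assms(3,4) by linarith
    then show ?thesis unfolding e'_def by simp
  qed
  finally have e': "(K + L) * e' < e" .
  obtain \<delta>1 where \<delta>1: "\<delta>1 > 0" "ac_modulus a b F e' \<delta>1"
    using assms(1) \<open>e' > 0\<close> unfolding abs_cont_on_iff by blast
  obtain \<delta>2 where \<delta>2: "\<delta>2 > 0" "ac_modulus a b G e' \<delta>2"
    using assms(2) \<open>e' > 0\<close> unfolding abs_cont_on_iff by blast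
  have "ac_modulus a b H e (min \<delta>1 \<delta>2)"
  proof (rule ac_modulusI)
    fix n :: nat and s t :: "nat \<Rightarrow> real"
    assume st: "\<And>i. i < n \<Longrightarrow> a \<le> s i \<and> s i \<le> t i \<and> t i \<le> b"
      "\<And>i j. i < n \<Longrightarrow> j < n \<Longrightarrow> i \<noteq> j \<Longrightarrow> {s i<..<t i} \<inter> {s j<..<t j} = {}"
      "(\<Sum>i<n. t i - s i) < min \<delta>1 \<delta>2"
    have "(\<Sum>i<n. norm (F (t i) - F (s i))) < e'" "(\<Sum>i<n. norm (G (t i) - G (s i))) < e'"
      using st by (auto intro!: ac_modulusD[OF \<delta>1(2)] ac_modulusD[OF \<delta>2(2)] simp del: greaterThanLessThan_iff Int_greaterThanLessThan)
    then have "K * (\<Sum>i<n. norm (F (t i) - F (s i))) + L * (\<Sum>i<n. norm (G (t i) - G (s i))) \<le> K * e' + L * e'"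
      using assms(3,4) by (intro add_mono mult_left_mono less_imp_le[of _ e'])
    moreover have "(\<Sum>i<n. norm (H (t i) - H (s i))) \<le> (\<Sum>i<n. K * norm (F (t i) - F (s i)) + L * norm (G (t i) - G (s i)))"
      using st(1) by (intro sum_mono le) auto
    moreover have "\<dots> = K * (\<Sum>i<n. norm (F (t i) - F (s i))) + L * (\<Sum>i<n. norm (G (t i) - G (s i)))"
      by (simp add: sum.distrib sum_distrib_left)
    ultimately show "(\<Sum>i<n. norm (H (t i) - H (s i))) < e" using e' by (simp add: distrib_right)
  qed
  moreover have "min \<delta>1 \<delta>2 > 0" using \<delta>1(1) \<delta>2(1) by simp
  ultimately show "\<exists>\<delta>>0. ac_modulus a b H e \<delta>" by blast
qed

lemma abs_cont_on_ident: "abs_cont_on a b (\<lambda>x::real. x)"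
  unfolding abs_cont_on_iff
proof (intro allI impI)
  fix e :: real assume "e > 0"
  have "ac_modulus a b (\<lambda>x::real. x) e e"
  proof (rule ac_modulusI)
    fix n :: nat and s t :: "nat \<Rightarrow> real"
    assume st: "\<And>i. i < n \<Longrightarrow> a \<le> s i \<and> s i \<le> t i \<and> t i \<le> b" "(\<Sum>i<n. t i - s i) < e"
    have "(\<Sum>i<n. norm (t i - s i)) = (\<Sum>i<n. t i - s i)" using st(1) by (intro sum.cong) auto
    then show "(\<Sum>i<n. norm (t i - s i)) < e" using st(2) by simp
  qed
  then show "\<exists>\<delta>>0. ac_modulus a b (\<lambda>x::real. x) e \<delta>" using \<open>e > 0\<close> by blast
qed

section \<open>The domain of the operator\<close>

lemma dirac0_eq: "dirac0 y x = vector [deriv_pi y x $ 2, - (deriv_pi y x $ 1)]"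
  by (simp add: dirac0_def vec_eq_iff forall_2 matrix_vector_mult_def sum_2)

lemma dirac_dom_continuous: "y \<in> dirac_dom \<alpha> \<beta> \<Longrightarrow> continuous_on {0..pi} y"
  by (auto simp: dirac_dom_def intro: abs_cont_on_continuous)

lemma dirac_dom_L2: "y \<in> dirac_dom \<alpha> \<beta> \<Longrightarrow> y \<in> L2_pi"
  by (rule continuous_in_L2_pi[OF dirac_dom_continuous])

lemma dirac0_L2:
  assumes "y \<in> dirac_dom \<alpha> \<beta>"
  shows "dirac0 y \<in> L2_pi"
proof -
  have d: "deriv_pi y \<in> L2_pi" using assms by (simp add: dirac_dom_def)
  have "continuous_on UNIV (\<lambda>a :: complex ^ 2. vector [a $ 2, - (a $ 1)] :: complex ^ 2)"
    by (intro continuous_on_vector2 continuous_intros)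
  then have "(\<lambda>a :: complex ^ 2. vector [a $ 2, - (a $ 1)] :: complex ^ 2) \<in> borel_measurable borel"
    by (rule borel_measurable_continuous_onI)
  from measurable_compose[OF L2_pi_measurable[OF d] this] have "dirac0 y \<in> borel_measurable M_pi"
    by (simp add: dirac0_eq[abs_def])
  moreover have "(norm (dirac0 y x))\<^sup>2 = (norm (deriv_pi y x))\<^sup>2" for x
    by (simp add: dirac0_eq norm_complex2)
  ultimately show ?thesis using L2_pi_integrable[OF d] by (simp add: L2_pi_def)
qed

text \<open>At \<open>pi\<close> the phase is \<open>k * pi - \<beta>\<close>, so every
  eigenfunction there is a multiple of \<open>(cos \<beta>, - sin \<beta>)\<close>, which is
  orthogonal to \<open>Phi \<beta>\<close>.\<close>

lemma cos_sin_pi_eig0: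
  "cos (eig0 \<alpha> \<beta> k * pi - \<alpha>) = cos (of_int k * pi) * cos \<beta>"
  "sin (eig0 \<alpha> \<beta> k * pi - \<alpha>) = - (cos (of_int k * pi) * sin \<beta>)"
proof -
  have eq: "eig0 \<alpha> \<beta> k * pi - \<alpha> = of_int k * pi - \<beta>" by (simp add: eig0_def field_simps)
  have "sin (of_int k * pi) = 0" unfolding sin_zero_iff_int2 by blast
  then show "cos (eig0 \<alpha> \<beta> k * pi - \<alpha>) = cos (of_int k * pi) * cos \<beta>"
    "sin (eig0 \<alpha> \<beta> k * pi - \<alpha>) = - (cos (of_int k * pi) * sin \<beta>)"
    unfolding eq cos_diff sin_diff by simp_all
qed

lemma AE_negligible:
  assumes "AE x in M_pi. P x"
  shows "\<exists>N. negligible N \<and> (\<forall>x\<in>{0..pi} - N. P x)"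
proof -
  obtain N where N: "N \<in> null_sets M_pi" "\<And>x. x \<in> space M_pi - N \<Longrightarrow> P x"
    using AE_E3[OF assms] by metis
  have "N \<in> null_sets lebesgue" using N(1) by (simp add: null_sets_restrict_space)
  then show ?thesis using N(2) by (intro exI[of _ N]) (simp add: negligible_iff_null_sets)
qed

lemma sin_cos_lipschitz:
  fixes a b :: real
  shows "\<bar>cos a - cos b\<bar> \<le> \<bar>a - b\<bar>" "\<bar>sin a - sin b\<bar> \<le> \<bar>a - b\<bar>"
proof -
  have "\<bar>cos a - cos b\<bar> = 2 * (\<bar>sin ((a + b) / 2)\<bar> * \<bar>sin ((b - a) / 2)\<bar>)"
    by (simp add: cos_diff_cos abs_mult)
  also have "\<dots> \<le> 2 * (1 * \<bar>(b - a) / 2\<bar>)"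
    by (intro mult_left_mono mult_mono abs_sin_x_le_abs_x) auto
  finally show "\<bar>cos a - cos b\<bar> \<le> \<bar>a - b\<bar>" by simp
  have "\<bar>sin a - sin b\<bar> = 2 * (\<bar>sin ((a - b) / 2)\<bar> * \<bar>cos ((a + b) / 2)\<bar>)"
    by (simp add: sin_diff_sin abs_mult)
  also have "\<dots> \<le> 2 * (\<bar>(a - b) / 2\<bar> * 1)"
    by (intro mult_left_mono mult_mono abs_sin_x_le_abs_x) auto
  finally show "\<bar>sin a - sin b\<bar> \<le> \<bar>a - b\<bar>" by simp
qed

text \<open>Integration by parts: \<open>F\<close> is a primitive almost everywhere of
  \<open>h\<close>, the difference of the two integrands, and it vanishes at both ends by the
  boundary conditions.\<close>

lemma fcoef_dirac0:
  assumes y: "y \<in> dirac_dom \<alpha> \<beta>"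
  shows "fcoef \<alpha> \<beta> (dirac0 y) k = of_real (eig0 \<alpha> \<beta> k) * fcoef \<alpha> \<beta> y k"
proof -
  define l where "l = eig0 \<alpha> \<beta> k"
  define C where "C x = cos (l * x - \<alpha>) / sqrt pi" for x
  define S where "S x = sin (l * x - \<alpha>) / sqrt pi" for x
  define F where "F x = y x $ 2 * of_real (C x) - y x $ 1 * of_real (S x)" for x
  define h where "h x = cinner2 (dirac0 y x) (eigfun \<alpha> l x) - of_real l * cinner2 (y x) (eigfun \<alpha> l x)" for x
  have u: "eigfun \<alpha> l x $ 1 = of_real (C x)" "eigfun \<alpha> l x $ 2 = of_real (S x)" for x
    by (simp_all add: eigfun_nth C_def S_def)
  have sp: "sqrt pi \<ge> 1" using pi_gt3 by simp
  have CS: "\<bar>C x\<bar> \<le> 1" "\<bar>S x\<bar> \<le> 1" "\<bar>C x - C x'\<bar> \<le> \<bar>l\<bar> * \<bar>x - x'\<bar>" "\<bar>S x - S x'\<bar> \<le> \<bar>l\<bar> * \<bar>x - x'\<bar>" for x x'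
  proof -
    have div: "\<bar>t\<bar> / sqrt pi \<le> \<bar>t\<bar>" for t
      using divide_left_mono[OF sp, of "\<bar>t\<bar>"] sp by simp
    have "l * x - \<alpha> - (l * x' - \<alpha>) = l * (x - x')" by (simp add: algebra_simps)
    then have lip: "\<bar>cos (l * x - \<alpha>) - cos (l * x' - \<alpha>)\<bar> \<le> \<bar>l\<bar> * \<bar>x - x'\<bar>"
      "\<bar>sin (l * x - \<alpha>) - sin (l * x' - \<alpha>)\<bar> \<le> \<bar>l\<bar> * \<bar>x - x'\<bar>"
      using sin_cos_lipschitz[of "l * x - \<alpha>" "l * x' - \<alpha>"] by (simp_all add: abs_mult)
    show "\<bar>C x\<bar> \<le> 1" "\<bar>S x\<bar> \<le> 1"
      using order_trans[OF div abs_cos_le_one] order_trans[OF div abs_sin_le_one] sp by (simp_all add: C_def S_def)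
    show "\<bar>C x - C x'\<bar> \<le> \<bar>l\<bar> * \<bar>x - x'\<bar>" "\<bar>S x - S x'\<bar> \<le> \<bar>l\<bar> * \<bar>x - x'\<bar>"
      using order_trans[OF div lip(1)] order_trans[OF div lip(2)] sp
      by (simp_all add: C_def S_def diff_divide_distrib[symmetric])
  qed
  have "compact (y ` {0..pi})"
    by (intro compact_continuous_image dirac_dom_continuous[OF y]) auto
  then obtain B where B: "\<And>x. x \<in> {0..pi} \<Longrightarrow> norm (y x) \<le> B"
    using compact_imp_bounded bounded_iff by (metis imageI)
  have "0 \<le> B" using order_trans[OF norm_ge_zero B[of 0]] pi_ge_zero by simp
  have acF: "abs_cont_on 0 pi F"
  \<comment> \<open>Each of the two products changes by at most \<open>norm (y t - y s)\<close> plus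
    \<open>B * |l|\<close> times the step, because \<open>C\<close> and \<open>S\<close> are bounded
    by 1 and Lipschitz with constant \<open>|l|\<close>.\<close>
  proof (rule abs_cont_on_bound[where F = y and G = "\<lambda>x. x" and K = 2 and L = "2 * (B * \<bar>l\<bar>)"])
    show "abs_cont_on 0 pi y" using y by (simp add: dirac_dom_def)
    show "abs_cont_on 0 pi (\<lambda>x::real. x)" by (rule abs_cont_on_ident)
    show "0 \<le> 2 * (B * \<bar>l\<bar>)" using \<open>0 \<le> B\<close> by simp
    fix s t :: real assume st: "0 \<le> s" "s \<le> t" "t \<le> pi"
    have summand: "cmod (y t $ i * of_real (G t) - y s $ i * of_real (G s)) \<le> norm (y t - y s) + B * (\<bar>l\<bar> * norm (t - s))"
      if G: "\<bar>G t\<bar> \<le> 1" "\<bar>G t - G s\<bar> \<le> \<bar>l\<bar> * \<bar>t - s\<bar>" for i G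
    proof -
      have "y t $ i * of_real (G t) - y s $ i * of_real (G s) = (y t - y s) $ i * of_real (G t) + y s $ i * of_real (G t - G s)"
        by (simp add: algebra_simps)
      also have "cmod \<dots> \<le> cmod ((y t - y s) $ i) * \<bar>G t\<bar> + cmod (y s $ i) * \<bar>G t - G s\<bar>"
        by (rule order_trans[OF norm_triangle_ineq]) (simp only: norm_mult norm_of_real order_refl)
      also have "\<dots> \<le> norm (y t - y s) * 1 + B * (\<bar>l\<bar> * norm (t - s))"
        using G \<open>0 \<le> B\<close> B[of s] st Finite_Cartesian_Product.norm_nth_le[of "y s" i]
        by (intro add_mono mult_mono Finite_Cartesian_Product.norm_nth_le) auto
      finally show ?thesis by simp
    qed
    have "F t - F s = (y t $ 2 * of_real (C t) - y s $ 2 * of_real (C s)) - (y t $ 1 * of_real (S t) - y s $ 1 * of_real (S s))"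
      by (simp add: F_def)
    also have "norm \<dots> \<le> (norm (y t - y s) + B * (\<bar>l\<bar> * norm (t - s))) + (norm (y t - y s) + B * (\<bar>l\<bar> * norm (t - s)))"
      by (rule order_trans[OF norm_triangle_ineq4 add_mono]) (intro summand CS)+
    finally show "norm (F t - F s) \<le> 2 * norm (y t - y s) + 2 * (B * \<bar>l\<bar>) * norm (t - s)"
      by simp
  qed auto
  have "AE x in M_pi. y differentiable (at x within {0..pi})"
    using y by (simp add: dirac_dom_def)
  from AE_negligible[OF this]
  obtain N where N: "negligible N" "\<forall>x\<in>{0..pi} - N. y differentiable (at x within {0..pi})"
    by blast
  have "(h has_integral (F pi - F 0)) {0..pi}"
  proof (rule fundamental_theorem_of_calculus_abs_cont[OF pi_ge_zero acF N(1)])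
    fix x assume x: "x \<in> {0..pi} - N"
    have dy: "(y has_vector_derivative deriv_pi y x) (at x within {0..pi})"
      using N(2) x by (simp add: deriv_pi_def vector_derivative_works)
    have dyi: "((\<lambda>x. y x $ i) has_vector_derivative deriv_pi y x $ i) (at x within {0..pi})" for i
      using bounded_linear.has_vector_derivative[OF bounded_linear_vec_nth dy] .
    have dC: "((\<lambda>x. of_real (C x) :: complex) has_vector_derivative of_real (- l * S x)) (at x within {0..pi})"
      unfolding C_def S_def by (auto intro!: derivative_eq_intros has_vector_derivative_of_real simp flip: has_real_derivative_iff_has_vector_derivative)
    have dS: "((\<lambda>x. of_real (S x) :: complex) has_vector_derivative of_real (l * C x)) (at x within {0..pi})"
      unfolding C_def S_def by (auto intro!: derivative_eq_intros has_vector_derivative_of_real simp flip: has_real_derivative_iff_has_vector_derivative)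
    have "(F has_vector_derivative (y x $ 2 * of_real (- l * S x) + deriv_pi y x $ 2 * of_real (C x)) -
        (y x $ 1 * of_real (l * C x) + deriv_pi y x $ 1 * of_real (S x))) (at x within {0..pi})"
      unfolding F_def[abs_def] by (intro has_vector_derivative_diff has_vector_derivative_mult dyi dC dS)
    also have "(y x $ 2 * of_real (- l * S x) + deriv_pi y x $ 2 * of_real (C x)) -
        (y x $ 1 * of_real (l * C x) + deriv_pi y x $ 1 * of_real (S x)) = h x"
      by (simp add: h_def cinner2_def u dirac0_eq algebra_simps)
    finally show "(F has_vector_derivative h x) (at x within {0..pi})" .
  qed
  moreover have "F 0 = 0"
  proof -
    have "cinner2 (y 0) (Phi \<alpha>) = 0" using y by (simp add: dirac_dom_def)
    then have "y 0 $ 1 * of_real (sin \<alpha>) + y 0 $ 2 * of_real (cos \<alpha>) = 0" by (simp add: cinner2_def Phi_def)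
    moreover have "F 0 = (y 0 $ 1 * of_real (sin \<alpha>) + y 0 $ 2 * of_real (cos \<alpha>)) / of_real (sqrt pi)"
      by (simp add: F_def C_def S_def add_divide_distrib)
    ultimately show ?thesis by simp
  qed
  moreover have "F pi = 0"
  proof -
    have "cinner2 (y pi) (Phi \<beta>) = 0" using y by (simp add: dirac_dom_def)
    then have "y pi $ 1 * of_real (sin \<beta>) + y pi $ 2 * of_real (cos \<beta>) = 0" by (simp add: cinner2_def Phi_def)
    moreover have "F pi = of_real (cos (of_int k * pi)) * (y pi $ 1 * of_real (sin \<beta>) + y pi $ 2 * of_real (cos \<beta>)) / of_real (sqrt pi)"
      unfolding F_def C_def S_def l_def cos_sin_pi_eig0
      by (simp add: add_divide_distrib distrib_left mult_ac)
    ultimately show ?thesis by simp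
  qed
  ultimately have "(h has_integral 0) {0..pi}" by simp
  have int: "integrable M_pi (\<lambda>x. cinner2 (dirac0 y x) (eigfun \<alpha> l x))" "integrable M_pi (\<lambda>x. cinner2 (y x) (eigfun \<alpha> l x))"
    by (intro integrable_cinner2 dirac0_L2[OF y] dirac_dom_L2[OF y] eigfun_in_L2_pi)+
  then have "integrable M_pi h"
    unfolding h_def[abs_def] by (intro Bochner_Integration.integrable_diff integrable_mult_right)
  then have "(LINT x|M_pi. h x) = integral {0..pi} h"
    by (rule lebesgue_integral_eq_integral) auto
  also have "\<dots> = 0" using \<open>(h has_integral 0) {0..pi}\<close> by (rule integral_unique)
  finally have "(LINT x|M_pi. h x) = 0" .
  moreover have "(LINT x|M_pi. h x) = (LINT x|M_pi. cinner2 (dirac0 y x) (eigfun \<alpha> l x)) -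
      of_real l * (LINT x|M_pi. cinner2 (y x) (eigfun \<alpha> l x))"
    unfolding h_def
    using Bochner_Integration.integral_diff[OF int(1) integrable_mult_right[OF int(2), of "of_real l"]]
    by (simp only: integral_mult_right_zero)
  ultimately have "L2_inner (dirac0 y) (eigfun \<alpha> l) - of_real l * L2_inner y (eigfun \<alpha> l) = 0"
    unfolding L2_inner_def by (simp only:)
  then show ?thesis unfolding fcoef_def l_def by (rule eq_iff_diff_eq_0[THEN iffD2])
qed

section \<open>Fourier series with summable coefficients\<close>

text \<open>Far out \<open>|pt c k|\<close> is at least half of \<open>|k|\<close>, which allows
  comparison with the inverse squares of the integers. A point equal to 0 contributes
  \<open>inverse 0 = 0\<close>.\<close>

lemma inverse_square_summable: "(\<lambda>k. inverse ((pt c k)\<^sup>2)) summable_on UNIV"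
proof -
  obtain n0 :: nat where n0: "2 * \<bar>c\<bar> + 1 \<le> real n0" using real_arch_simple by blast
  have nat: "(\<lambda>n::nat. 4 * inverse ((real n)\<^sup>2)) summable_on UNIV"
    by (intro summable_nonneg_imp_summable_on summable_mult inverse_power_summable) auto
  have bound: "inverse ((pt c k)\<^sup>2) \<le> 4 * inverse ((of_int k)\<^sup>2)" if k: "int n0 \<le> \<bar>k\<bar>" for k
  proof -
    have k': "real n0 \<le> \<bar>real_of_int k\<bar>" using k by linarith
    then have "\<bar>real_of_int k\<bar> / 2 \<le> \<bar>pt c k\<bar>" using n0 unfolding pt_def by linarith
    then have "(\<bar>real_of_int k\<bar> / 2)\<^sup>2 \<le> \<bar>pt c k\<bar>\<^sup>2" by (intro power_mono) auto
    moreover have "0 < (\<bar>real_of_int k\<bar> / 2)\<^sup>2" using k' n0 by simp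
    ultimately have "inverse (\<bar>pt c k\<bar>\<^sup>2) \<le> inverse ((\<bar>real_of_int k\<bar> / 2)\<^sup>2)" by (rule le_imp_inverse_le)
    moreover have "inverse ((\<bar>real_of_int k\<bar> / 2)\<^sup>2) = 4 * inverse ((of_int k)\<^sup>2)"
      by (simp add: power_divide inverse_eq_divide)
    ultimately show ?thesis by (simp only: power2_abs)
  qed
  \<comment> \<open>The sign \<open>sg\<close> selects one of the two tails, so that both are
    reindexed by natural numbers with one argument.\<close>
  have side: "(\<lambda>k. inverse ((pt c k)\<^sup>2)) summable_on {k. int n0 \<le> sg * k}" if sg: "sg = 1 \<or> sg = -1" for sg :: int
  proof -
    have "(\<lambda>n. inverse ((pt c (sg * int n))\<^sup>2)) summable_on {n. n0 \<le> n}"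
    proof (rule summable_on_comparison_test)
      show "(\<lambda>n::nat. 4 * inverse ((real n)\<^sup>2)) summable_on {n. n0 \<le> n}"
        by (rule summable_on_subset_banach[OF nat]) auto
      show "inverse ((pt c (sg * int n))\<^sup>2) \<le> 4 * inverse ((real n)\<^sup>2)" if "n \<in> {n. n0 \<le> n}" for n
        using bound[of "sg * int n"] sg that by auto
    qed auto
    moreover have "bij_betw (\<lambda>n. sg * int n) {n. n0 \<le> n} {k. int n0 \<le> sg * k}"
      using sg by (intro bij_betwI[where g = "\<lambda>k. nat (sg * k)"]) auto
    ultimately show ?thesis using summable_on_reindex_bij_betw by blast
  qed
  have "(\<lambda>k. inverse ((pt c k)\<^sup>2)) summable_on ({k. int n0 \<le> k} \<union> ({k. int n0 \<le> - k} - {k. int n0 \<le> k})) \<union> {- int n0<..<int n0}"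
  proof (rule summable_on_Un_disjoint[OF summable_on_Un_disjoint summable_on_finite])
    show "(\<lambda>k. inverse ((pt c k)\<^sup>2)) summable_on {k. int n0 \<le> k}"
      using side[of 1] by simp
    show "(\<lambda>k. inverse ((pt c k)\<^sup>2)) summable_on {k. int n0 \<le> - k} - {k. int n0 \<le> k}"
      by (rule summable_on_subset_banach[where A = "{k. int n0 \<le> - k}"]) (use side[of "-1"] in auto)
  qed auto
  moreover have "({k. int n0 \<le> k} \<union> ({k. int n0 \<le> - k} - {k. int n0 \<le> k})) \<union> {- int n0<..<int n0} = UNIV"
    by auto
  ultimately show ?thesis by simp
qed

text \<open>A product of two square summable sequences, by the inequality between arithmetic and
  geometric mean. Absolute summability is what makes the Fourier series below converge
  uniformly.\<close>

lemma abs_summable_div_pt: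
  fixes f :: "int \<Rightarrow> complex"
  assumes "(\<lambda>k. (cmod (f k))\<^sup>2) summable_on UNIV"
  shows "(\<lambda>k. cmod (f k / of_real (pt c k))) summable_on UNIV"
proof (rule Infinite_Sum.abs_summable_on_comparison_test')
  show "(\<lambda>k. (cmod (f k))\<^sup>2 + inverse ((pt c k)\<^sup>2)) summable_on UNIV"
    by (intro summable_on_add assms inverse_square_summable)
  fix k
  have "cmod (f k / of_real (pt c k)) = cmod (f k) * inverse \<bar>pt c k\<bar>"
    by (simp add: norm_mult norm_inverse divide_inverse)
  also have "\<dots> \<le> (cmod (f k))\<^sup>2 + (inverse \<bar>pt c k\<bar>)\<^sup>2"
  proof -
    have "0 \<le> cmod (f k) * inverse \<bar>pt c k\<bar>" by simp
    then show ?thesis using sum_squares_bound[of "cmod (f k)" "inverse \<bar>pt c k\<bar>"] by linarith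
  qed
  finally show "cmod (f k / of_real (pt c k)) \<le> (cmod (f k))\<^sup>2 + inverse ((pt c k)\<^sup>2)"
    by (simp add: power_inverse)
qed

text \<open>The uniform error is integrated against \<open>norm (h x)\<close>, which is integrable
  because it is dominated by \<open>1 + (norm (h x))^2\<close> on a bounded interval.\<close>

lemma L2_inner_uniform_limit:
  assumes lim: "uniform_limit {0..pi} f g \<F>" and f: "\<And>i. f i \<in> L2_pi" and g: "g \<in> L2_pi" and h: "h \<in> L2_pi"
  shows "((\<lambda>i. L2_inner (f i) h) \<longlongrightarrow> L2_inner g h) \<F>"
proof -
  have inth: "integrable M_pi (\<lambda>x. norm (h x))"
  proof (rule Bochner_Integration.integrable_bound)
    show "integrable M_pi (\<lambda>x. 1 + (norm (h x))\<^sup>2)"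
      using L2_pi_integrable[OF h] by (intro Bochner_Integration.integrable_add) (auto intro!: continuous_imp_integrable_real)
    show "(\<lambda>x. norm (h x)) \<in> borel_measurable M_pi"
      using L2_pi_measurable[OF h] by measurable
    have "norm (h x) \<le> 1 + (norm (h x))\<^sup>2" for x
    proof -
      have "2 * norm (h x) \<le> 1 + (norm (h x))\<^sup>2" using sum_squares_bound[of 1 "norm (h x)"] by simp
      then show ?thesis using norm_ge_zero[of "h x"] by linarith
    qed
    then show "AE x in M_pi. norm (norm (h x)) \<le> norm (1 + (norm (h x))\<^sup>2)"
      by (intro always_eventually allI) (simp add: order_trans)
  qed
  define H where "H = (LINT x|M_pi. norm (h x))"
  have "H \<ge> 0" by (simp add: H_def)
  show ?thesis
  proof (rule tendstoI)
    fix e :: real assume "e > 0"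
    define d where "d = e / (2 * H + 1)"
    have "d > 0" using \<open>e > 0\<close> \<open>H \<ge> 0\<close> by (simp add: d_def)
    have "2 * d * H < e"
    proof -
      have "2 * d * H < d * (2 * H + 1)" using \<open>d > 0\<close> by (simp add: algebra_simps)
      also have "\<dots> = e" using \<open>H \<ge> 0\<close> by (simp add: d_def)
      finally show ?thesis .
    qed
    from uniform_limitD[OF lim \<open>d > 0\<close>]
    show "\<forall>\<^sub>F i in \<F>. dist (L2_inner (f i) h) (L2_inner g h) < e"
    proof eventually_elim
      case (elim i)
      have fg: "(\<lambda>x. f i x - g x) \<in> L2_pi" by (intro L2_pi_diff f g)
      have "dist (L2_inner (f i) h) (L2_inner g h) = cmod (L2_inner (\<lambda>x. f i x - g x) h)"
        by (simp add: dist_norm L2_inner_diff_left f g h)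
      also have "\<dots> \<le> (LINT x|M_pi. cmod (cinner2 (f i x - g x) (h x)))"
        unfolding L2_inner_def by (rule integral_norm_bound)
      also have "\<dots> \<le> (LINT x|M_pi. (2 * d) * norm (h x))"
      proof (rule integral_mono)
        show "integrable M_pi (\<lambda>x. cmod (cinner2 (f i x - g x) (h x)))"
          by (intro integrable_norm integrable_cinner2 fg h)
        show "integrable M_pi (\<lambda>x. (2 * d) * norm (h x))" by (intro integrable_mult_right inth)
        fix x assume "x \<in> space M_pi"
        then have "norm (f i x - g x) \<le> d" using elim by (auto simp: dist_norm intro: less_imp_le)
        then have "2 * (norm (f i x - g x) * norm (h x)) \<le> 2 * (d * norm (h x))"
          by (intro mult_left_mono mult_right_mono) auto
        then show "cmod (cinner2 (f i x - g x) (h x)) \<le> (2 * d) * norm (h x)"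
          using norm_cinner2_le[of "f i x - g x" "h x"] by simp
      qed
      also have "\<dots> = 2 * d * H" by (simp add: H_def)
      finally show ?case using \<open>2 * d * H < e\<close> by linarith
    qed
  qed
qed

text \<open>Uniform convergence gives continuity and lets the inner product with \<open>g\<close> be
  taken term by term; pairing with the eigenfunctions yields the coefficients. Nothing is claimed
  about differentiability of \<open>Y\<close>.\<close>

lemma fourier_series:
  fixes s :: "int \<Rightarrow> complex"
  assumes "(\<lambda>k. cmod (s k)) summable_on UNIV"
  obtains Y where "continuous_on {0..pi} Y" "\<And>k. fcoef \<alpha> \<beta> Y k = s k"
    "\<And>g. g \<in> L2_pi \<Longrightarrow> ((\<lambda>k. s k * cnj (fcoef \<alpha> \<beta> g k)) has_sum L2_inner Y g) UNIV"
proof -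
  let ?u = "\<lambda>k. eigfun \<alpha> (eig0 \<alpha> \<beta> k)"
  define Y where "Y x = (\<Sum>\<^sub>\<infinity>k. s k *s ?u k x)" for x
  have lim: "uniform_limit {0..pi} (\<lambda>F x. \<Sum>k\<in>F. s k *s ?u k x) Y (finite_subsets_at_top UNIV)"
    unfolding Y_def
  proof (rule Weierstrass_m_test_general[OF _ assms])
    show "norm (s k *s ?u k x) \<le> cmod (s k)" for k x
      unfolding norm_scale_complex2 using mult_left_mono[OF norm_eigfun_le, of "cmod (s k)"] by simp
  qed
  have cont: "continuous_on {0..pi} Y"
    by (rule uniform_limit_theorem[OF _ lim])
       (auto intro!: always_eventually continuous_on_sum continuous_on_scale_complex2 continuous_on_eigfun)
  have inner: "((\<lambda>k. s k * cnj (fcoef \<alpha> \<beta> g k)) has_sum L2_inner Y g) UNIV" if g: "g \<in> L2_pi" for g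
  proof -
    have L2: "(\<lambda>x. \<Sum>k\<in>F. s k *s ?u k x) \<in> L2_pi" for F
      by (intro L2_pi_sum L2_pi_scale eigfun_in_L2_pi)
    have "L2_inner (\<lambda>x. \<Sum>k\<in>F. s k *s ?u k x) g = (\<Sum>k\<in>F. s k * cnj (fcoef \<alpha> \<beta> g k))" for F
      unfolding fcoef_def using g
      by (subst L2_inner_sum_left) (auto intro!: L2_pi_scale eigfun_in_L2_pi sum.cong simp: L2_inner_scale_left L2_inner_commute[of "?u _"])
    then show ?thesis
      using L2_inner_uniform_limit[OF lim L2 continuous_in_L2_pi[OF cont] g] by (simp add: has_sum_def)
  qed
  have coef: "fcoef \<alpha> \<beta> Y k = s k" for k
  proof -
    have "((\<lambda>j. s j * cnj (fcoef \<alpha> \<beta> (?u k) j)) has_sum fcoef \<alpha> \<beta> Y k) UNIV"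
      unfolding fcoef_def[of \<alpha> \<beta> Y] by (intro inner eigfun_in_L2_pi)
    moreover have "((\<lambda>j. s j * cnj (fcoef \<alpha> \<beta> (?u k) j)) has_sum s k) UNIV"
    proof (rule has_sum_cong_neutral[THEN iffD1])
      show "((\<lambda>j. s j) has_sum s k) {k}" by (rule has_sum_finiteI) auto
    qed (auto simp: fcoef_eigfun)
    ultimately show ?thesis by (rule has_sum_unique)
  qed
  show ?thesis by (rule that[OF cont coef inner])
qed

section \<open>Fourier expansion of functions in the domain\<close>

context
  fixes \<alpha> \<beta> :: real
  assumes eig0_nonzero: "\<And>k. eig0 \<alpha> \<beta> k \<noteq> 0"
begin

text \<open>The coefficients are those of \<open>dirac0 y\<close>, square summable by Bessel,
  divided by \<open>eig0\<close>.\<close>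

lemma dirac_dom_fcoef_summable:
  assumes y: "y \<in> dirac_dom \<alpha> \<beta>"
  shows "(\<lambda>k. cmod (fcoef \<alpha> \<beta> y k)) summable_on UNIV"
proof -
  have "(\<lambda>k. cmod (fcoef \<alpha> \<beta> (dirac0 y) k / of_real (eig0 \<alpha> \<beta> k))) summable_on UNIV"
    unfolding eig0_eq_pt by (intro abs_summable_div_pt fcoef_square_summable dirac0_L2[OF y])
  then show ?thesis using eig0_nonzero by (simp add: fcoef_dirac0[OF y])
qed

text \<open>By completeness \<open>y\<close> coincides on \<open>{0..pi}\<close> with the continuous
  sum of its Fourier series, for which the identity is available.\<close>

lemma dirac_dom_parseval:
  assumes y: "y \<in> dirac_dom \<alpha> \<beta>" and g: "g \<in> L2_pi"
  shows "((\<lambda>k. fcoef \<alpha> \<beta> y k * cnj (fcoef \<alpha> \<beta> g k)) has_sum L2_inner y g) UNIV"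
proof -
  obtain Y where Y: "continuous_on {0..pi} Y" "\<And>k. fcoef \<alpha> \<beta> Y k = fcoef \<alpha> \<beta> y k"
    "\<And>g. g \<in> L2_pi \<Longrightarrow> ((\<lambda>k. fcoef \<alpha> \<beta> y k * cnj (fcoef \<alpha> \<beta> g k)) has_sum L2_inner Y g) UNIV"
    using fourier_series[OF dirac_dom_fcoef_summable[OF y]] by metis
  have "y x - Y x = 0" if "x \<in> {0..pi}" for x
    using that by (intro fcoef_complete[of "\<lambda>x. y x - Y x" \<alpha> \<beta>])
      (auto intro!: continuous_intros dirac_dom_continuous[OF y] Y(1) simp: fcoef_diff dirac_dom_L2[OF y] continuous_in_L2_pi Y)
  then have "L2_inner y g = L2_inner Y g"
    unfolding L2_inner_def by (intro Bochner_Integration.integral_cong) auto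
  then show ?thesis using Y(3)[OF g] by simp
qed

end

section \<open>The eigenvalues as perturbed points\<close>

definition mass :: "real \<Rightarrow> real \<Rightarrow> real \<Rightarrow> (real \<Rightarrow> complex ^ 2) \<Rightarrow> int \<Rightarrow> real" where
  "mass \<alpha> \<beta> \<mu> v k = \<mu> * (cmod (fcoef \<alpha> \<beta> v k))\<^sup>2"

lemma mass_eq_0_iff: "mass \<alpha> \<beta> \<mu> v k = 0 \<longleftrightarrow> fcoef \<alpha> \<beta> v k = 0 \<or> \<mu> = 0"
  by (auto simp: mass_def)

lemma mass_summable: "v \<in> L2_pi \<Longrightarrow> mass \<alpha> \<beta> \<mu> v summable_on UNIV"
  unfolding mass_def[abs_def] by (intro summable_on_cmult_right fcoef_square_summable)

lemma Qfun_eq_pert: "Qfun \<alpha> \<beta> \<mu> v l = pert ((\<alpha> - \<beta>) / pi) (mass \<alpha> \<beta> \<mu> v) l"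
proof -
  have "\<mu> * (\<Sum>\<^sub>\<infinity>s\<in>{s. fcoef \<alpha> \<beta> v s \<noteq> 0}. (cmod (fcoef \<alpha> \<beta> v s))\<^sup>2 / (eig0 \<alpha> \<beta> s - l)) =
      (\<Sum>\<^sub>\<infinity>s\<in>{s. fcoef \<alpha> \<beta> v s \<noteq> 0}. \<mu> * ((cmod (fcoef \<alpha> \<beta> v s))\<^sup>2 / (eig0 \<alpha> \<beta> s - l)))"
    by (rule infsum_cmult_right'[symmetric])
  also have "\<dots> = (\<Sum>\<^sub>\<infinity>s. of_real (mass \<alpha> \<beta> \<mu> v s) / (of_real (pt ((\<alpha> - \<beta>) / pi) s) - l))"
    by (rule infsum_cong_neutral) (auto simp: mass_def eig0_eq_pt)
  finally show ?thesis by (simp add: Qfun_def pert_def)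
qed

text \<open>The definite descriptions in \<open>eig\<close> are matched with
  \<open>gap_root\<close>. For negative \<mu> the gap lies to the left of its point, so the
  reflected masses are used and the result is reflected back.\<close>

lemma eig_perturbed_points:
  assumes v: "v \<in> L2_pi"
  shows "perturbed_points ((\<alpha> - \<beta>) / pi) (mass \<alpha> \<beta> \<mu> v) (eig \<alpha> \<beta> \<mu> v)"
proof -
  define c where "c = (\<alpha> - \<beta>) / pi"
  define m where "m = mass \<alpha> \<beta> \<mu> v"
  have summ: "m summable_on UNIV" unfolding m_def by (rule mass_summable[OF v])
  have m0: "m k = 0 \<longleftrightarrow> fcoef \<alpha> \<beta> v k = 0 \<or> \<mu> = 0" for k by (simp add: m_def mass_eq_0_iff)
  have sigma1: "(\<forall>t\<in>sigma1 \<alpha> \<beta> v. P t) \<longleftrightarrow> (\<forall>j. m j \<noteq> 0 \<longrightarrow> P (pt c j))" if "\<mu> \<noteq> 0" for P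
    using that by (auto simp: sigma1_def m0 eig0_eq_pt c_def)
  have eig0: "eig \<alpha> \<beta> \<mu> v k = pt c k" if "m k = 0" for k
    using that by (simp add: eig_def m0 eig0_eq_pt c_def)
  have Q: "Qfun \<alpha> \<beta> \<mu> v l = pert c m l" for l
    by (simp add: Qfun_eq_pert c_def m_def)
  show ?thesis
  proof (cases "\<mu> \<ge> 0")
    case True
    interpret P: point_masses c m
      by unfold_locales (use True summ in \<open>auto simp: m_def mass_def\<close>)
    have "eig \<alpha> \<beta> \<mu> v k = gap_root c m k" if "m k \<noteq> 0" for k
    proof -
      have "\<mu> > 0" "fcoef \<alpha> \<beta> v k \<noteq> 0" using that True by (auto simp: m0)
      then show ?thesis
        unfolding eig_def gap_root_def in_gap_def by (simp add: sigma1 Q eig0_eq_pt conj_assoc flip: c_def)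
    qed
    then have "eig \<alpha> \<beta> \<mu> v = (\<lambda>k. if m k = 0 then pt c k else gap_root c m k)"
      using eig0 by auto
    then show ?thesis using P.perturbed_points_gap_root by (simp add: c_def m_def)
  next
    case False
    define w where "w k = - m (- k)" for k
    have w_fun: "w = (\<lambda>k. - m (- k))" by (simp add: w_def fun_eq_iff)
    interpret P: point_masses "- c" w
    proof
      show "0 \<le> w k" for k using False by (simp add: w_def m_def mass_def mult_nonpos_nonneg)
      show "w summable_on UNIV"
        unfolding w_def using summ summable_on_reindex_bij_betw[OF bij_uminus, of m]
        by (intro summable_on_uminus[THEN iffD2]) simp
    qed
    have w0: "w (- k) = 0 \<longleftrightarrow> m k = 0" for k by (simp add: w_def)
    have gap: "in_gap (- c) w (- k) (- l) \<longleftrightarrow> l < pt c k \<and> (\<forall>j. m j \<noteq> 0 \<longrightarrow> pt c j < pt c k \<longrightarrow> pt c j < l)" for k l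
    proof -
      have "(\<forall>j. w j \<noteq> 0 \<longrightarrow> pt (- c) (- k) < pt (- c) j \<longrightarrow> - l < pt (- c) j) \<longleftrightarrow>
          (\<forall>j. w (- j) \<noteq> 0 \<longrightarrow> pt (- c) (- k) < pt (- c) (- j) \<longrightarrow> - l < pt (- c) (- j))"
        by (metis minus_minus)
      then show ?thesis unfolding in_gap_def by (simp add: pt_uminus w0)
    qed
    have pert_w: "pert (- c) w (- l) = pert c m l" for l :: real
      using pert_reflect[of c m "- l"] by (simp add: w_fun)
    have "eig \<alpha> \<beta> \<mu> v k = - gap_root (- c) w (- k)" if "m k \<noteq> 0" for k
    proof -
      have "\<mu> < 0" "fcoef \<alpha> \<beta> v k \<noteq> 0" using that False by (auto simp: m0)
      then have "eig \<alpha> \<beta> \<mu> v k = (THE l. in_gap (- c) w (- k) (- l) \<and> pert (- c) w (- l) = 0)"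
        unfolding eig_def gap pert_w by (simp add: sigma1 Q eig0_eq_pt conj_assoc flip: c_def)
      also have "\<dots> = - gap_root (- c) w (- k)"
      proof (rule the_equality)
        show "in_gap (- c) w (- k) (- (- gap_root (- c) w (- k))) \<and> pert (- c) w (- (- gap_root (- c) w (- k))) = 0"
          using P.gap_root[of "- k"] that by (simp add: w0)
        show "l = - gap_root (- c) w (- k)" if "in_gap (- c) w (- k) (- l) \<and> pert (- c) w (- l) = 0" for l
          using P.gap_root_eqI[of "- k" "- l"] that \<open>m k \<noteq> 0\<close> by (simp add: w0)
      qed
      finally show ?thesis .
    qed
    then have "eig \<alpha> \<beta> \<mu> v = (\<lambda>k. - (if w (- k) = 0 then pt (- c) (- k) else gap_root (- c) w (- k)))"
      using eig0 by (auto simp: w0 pt_uminus)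
    moreover have "(\<lambda>k. - w (- k)) = m" by (simp add: w_def)
    ultimately show ?thesis
      using perturbed_points.reflected[OF P.perturbed_points_gap_root] by (simp add: c_def m_def)
  qed
qed

section \<open>Eigenfunctions and multiplicities\<close>

lemma has_sum_difference:
  fixes f g :: "'a \<Rightarrow> 'b::real_normed_field"
  assumes "(f has_sum a) A" "(g has_sum b) A"
  shows "((\<lambda>x. f x - g x) has_sum (a - b)) A"
  using has_sum_add[OF assms(1) has_sum_uminusI[OF assms(2)]] by simp

lemma has_sum_finite_sum:
  fixes f :: "'i \<Rightarrow> 'a \<Rightarrow> 'b::real_normed_vector"
  assumes "\<And>i. i \<in> K \<Longrightarrow> (f i has_sum s i) A"
  shows "((\<lambda>x. \<Sum>i\<in>K. f i x) has_sum (\<Sum>i\<in>K. s i)) A"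
  using assms by (induction K rule: infinite_finite_induct) (auto intro!: has_sum_add)

lemma dirac_L2:
  assumes "v \<in> L2_pi" "y \<in> dirac_dom \<alpha> \<beta>"
  shows "dirac \<mu> v y \<in> L2_pi"
  unfolding dirac_def[abs_def] using assms by (intro L2_pi_add L2_pi_scale dirac0_L2)

lemma fcoef_dirac:
  assumes "v \<in> L2_pi" "y \<in> dirac_dom \<alpha> \<beta>"
  shows "fcoef \<alpha> \<beta> (dirac \<mu> v y) k =
    of_real (eig0 \<alpha> \<beta> k) * fcoef \<alpha> \<beta> y k + of_real \<mu> * L2_inner y v * fcoef \<alpha> \<beta> v k"
proof -
  have "fcoef \<alpha> \<beta> (dirac \<mu> v y) k =
      fcoef \<alpha> \<beta> (dirac0 y) k + fcoef \<alpha> \<beta> (\<lambda>x. (of_real \<mu> * L2_inner y v) *s v x) k"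
    unfolding dirac_def[abs_def] by (rule fcoef_add[OF dirac0_L2[OF assms(2)] L2_pi_scale[OF assms(1)]])
  then show ?thesis by (simp add: fcoef_scale fcoef_dirac0[OF assms(2)])
qed

lemma continuous_eqI_fcoef:
  assumes "continuous_on {0..pi} f" "continuous_on {0..pi} g" "\<And>k. fcoef \<alpha> \<beta> f k = fcoef \<alpha> \<beta> g k" "x \<in> {0..pi}"
  shows "f x = g x"
  using fcoef_complete[of "\<lambda>x. f x - g x" \<alpha> \<beta> x] assms
  by (simp add: continuous_on_diff fcoef_diff continuous_in_L2_pi)

text \<open>The resolvent estimate annihilates the norm of an eigenfunction, Bessel its
  coefficients, completeness the function. As \<open>same_spectrum_with_mult\<close> compares
  multiplicities only on the spectrum, this supplies the remaining points.\<close>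

lemma dirac_mult_outside_spectrum:
  assumes "z \<notin> dirac_spectrum \<alpha> \<beta> \<mu> v"
  shows "dirac_mult \<alpha> \<beta> \<mu> v z = 0"
proof -
  interpret VS: vector_space fun_scale by (rule vector_space_fun_scale)
  obtain C where C: "\<And>y. y \<in> dirac_dom \<alpha> \<beta> \<Longrightarrow> L2_norm y \<le> C * L2_norm (\<lambda>x. dirac \<mu> v y x - z *s y x)"
    using assms by (auto simp: dirac_spectrum_def dirac_resolvent_set_def)
  have "y = 0" if y: "y \<in> dirac_eigenspace \<alpha> \<beta> \<mu> v z" for y
  proof
    fix x
    have dom: "y \<in> dirac_dom \<alpha> \<beta>" and ae: "AE x in M_pi. dirac \<mu> v y x = z *s y x"
      using y by (auto simp: dirac_eigenspace_def)
    have "(LINT x|M_pi. (norm (dirac \<mu> v y x - z *s y x))\<^sup>2) = 0"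
      by (rule integral_eq_zero_AE) (use ae in auto)
    then have "L2_norm y \<le> 0" using C[OF dom] by (simp add: L2_norm_def)
    then have norm_y: "(LINT x|M_pi. (norm (y x))\<^sup>2) \<le> 0" by (simp add: L2_norm_def)
    have "fcoef \<alpha> \<beta> y k = 0" for k
      using order_trans[OF bessel[OF dirac_dom_L2[OF dom], of "{k}" \<alpha> \<beta>] norm_y] by simp
    then have "y x = 0" if "x \<in> {0..pi}"
      using fcoef_complete[OF dirac_dom_continuous[OF dom], of \<alpha> \<beta>] that by simp
    moreover have "y x = 0" if "x \<notin> {0..pi}" using dom that by (auto simp: dirac_dom_def)
    ultimately show "y x = 0 x" by (cases "x \<in> {0..pi}") auto
  qed
  then have "dirac_eigenspace \<alpha> \<beta> \<mu> v z \<subseteq> {0}" by auto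
  then have "VS.span {} = VS.span (dirac_eigenspace \<alpha> \<beta> \<mu> v z)"
    by (metis VS.span_empty VS.span_mono VS.span_insert_0 subset_antisym VS.span_empty empty_subsetI)
  from VS.dim_eq_card[OF this VS.independent_empty] show ?thesis by (simp add: dirac_mult_def)
qed

locale dirac_zero_resolvent =
  fixes \<alpha> \<beta> \<mu> :: real and v :: "real \<Rightarrow> complex ^ 2"
  assumes v: "v \<in> L2_pi"
    and eig0_ne: "\<And>k. eig0 \<alpha> \<beta> k \<noteq> 0"
    and zero_resolvent: "0 \<notin> dirac_spectrum \<alpha> \<beta> \<mu> v"
begin

abbreviation "c \<equiv> (\<alpha> - \<beta>) / pi"
abbreviation "m \<equiv> mass \<alpha> \<beta> \<mu> v"
abbreviation "vk \<equiv> fcoef \<alpha> \<beta> v"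
abbreviation "ev \<equiv> eig \<alpha> \<beta> \<mu> v"

sublocale P: perturbed_points c m ev
  by (rule eig_perturbed_points[OF v])

lemma mass_complex: "of_real (m k) = of_real \<mu> * (vk k * cnj (vk k))"
  by (simp add: mass_def flip: complex_norm_square)

lemma pert_has_sum_complex:
  "((\<lambda>k. of_real \<mu> * (vk k * cnj (vk k)) / of_real (eig0 \<alpha> \<beta> k - z)) has_sum of_real (pert c m z - 1)) UNIV"
proof -
  have "((\<lambda>k. of_real (m k) / of_real (eig0 \<alpha> \<beta> k - z)) has_sum (of_real (pert c m z - 1) :: complex)) UNIV"
    using has_sum_of_real[OF pert_has_sum_real[OF P.m_summable, of c z], where 'a = complex] by (simp add: eig0_eq_pt)
  then show ?thesis unfolding mass_complex .
qed

lemma zero_solvable: "f \<in> L2_pi \<Longrightarrow> \<exists>y\<in>dirac_dom \<alpha> \<beta>. AE x in M_pi. dirac \<mu> v y x = f x"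
  using zero_resolvent by (auto simp: dirac_spectrum_def dirac_resolvent_set_def)

lemma zero_solution_fcoef:
  assumes "y \<in> dirac_dom \<alpha> \<beta>" "f \<in> L2_pi" "AE x in M_pi. dirac \<mu> v y x = f x"
  shows "of_real (eig0 \<alpha> \<beta> k) * fcoef \<alpha> \<beta> y k + of_real \<mu> * L2_inner y v * vk k = fcoef \<alpha> \<beta> f k"
  using trans[OF fcoef_dirac[OF v assms(1), symmetric] fcoef_cong_AE[OF assms(3) dirac_L2[OF v assms(1)] assms(2)]] .

text \<open>Solve \<open>D y = v\<close>: if the perturbation function vanished at 0, pairing \<open>y\<close> with \<open>v\<close> would
  give \<open>0 = 1\<close>.\<close>

lemma pert_0_nonzero: "pert c m (0::real) \<noteq> 0"
proof
  assume zero: "pert c m (0::real) = 0"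
  obtain y where y: "y \<in> dirac_dom \<alpha> \<beta>" "AE x in M_pi. dirac \<mu> v y x = v x"
    using zero_solvable[OF v] by blast
  define A where "A = of_real \<mu> * L2_inner y v"
  have coef: "of_real \<mu> * (fcoef \<alpha> \<beta> y k * cnj (vk k)) = (1 - A) * (of_real \<mu> * (vk k * cnj (vk k)) / of_real (eig0 \<alpha> \<beta> k - 0))" for k
  proof -
    have "of_real (eig0 \<alpha> \<beta> k) * fcoef \<alpha> \<beta> y k = (1 - A) * vk k"
      using zero_solution_fcoef[OF y(1) v y(2), of k] by (simp add: A_def algebra_simps eq_diff_eq)
    then have "fcoef \<alpha> \<beta> y k = (1 - A) * vk k / of_real (eig0 \<alpha> \<beta> k)"
      using eig0_ne[of k] by (metis nonzero_mult_div_cancel_left of_real_eq_0_iff)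
    then show ?thesis by simp
  qed
  have "((\<lambda>k. of_real \<mu> * (fcoef \<alpha> \<beta> y k * cnj (vk k))) has_sum A) UNIV"
    unfolding A_def by (intro has_sum_cmult_right dirac_dom_parseval eig0_ne y v)
  moreover have "((\<lambda>k. of_real \<mu> * (fcoef \<alpha> \<beta> y k * cnj (vk k))) has_sum ((1 - A) * of_real (pert c m 0 - 1))) UNIV"
    unfolding coef by (intro has_sum_cmult_right pert_has_sum_complex)
  \<comment> \<open>With \<open>pert c m 0 = 0\<close> this reads \<open>A = A - 1\<close>.\<close>
  ultimately have "A = (1 - A) * of_real (pert c m 0 - 1)" by (rule has_sum_unique)
  then show False using zero by simp
qed

lemma ev_nonzero: "ev k \<noteq> 0"
  using P.unperturbed[of k] P.root[of k] pert_0_nonzero eig0_ne[of k] by (metis eig0_eq_pt)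

text \<open>The series with the expected coefficients is not known to lie in the domain; solving
  \<open>D w = z Y\<close> in the domain and comparing coefficients shows that it does.\<close>

lemma ex_eigenfunction:
  fixes s :: "int \<Rightarrow> complex" and z :: real
  assumes summ: "(\<lambda>k. cmod (s k)) summable_on UNIV"
    and C: "((\<lambda>k. s k * cnj (vk k)) has_sum C) UNIV"
    and eq: "\<And>k. of_real (eig0 \<alpha> \<beta> k - z) * s k = - (of_real \<mu> * C * vk k)"
  shows "\<exists>w\<in>dirac_eigenspace \<alpha> \<beta> \<mu> v (of_real z). \<forall>k. fcoef \<alpha> \<beta> w k = s k"
proof -
  obtain Y where Y: "continuous_on {0..pi} Y" "\<And>k. fcoef \<alpha> \<beta> Y k = s k"
    "\<And>g. g \<in> L2_pi \<Longrightarrow> ((\<lambda>k. s k * cnj (fcoef \<alpha> \<beta> g k)) has_sum L2_inner Y g) UNIV"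
    using fourier_series[OF summ] by metis
  have zY: "(\<lambda>x. of_real z *s Y x) \<in> L2_pi"
    by (intro L2_pi_scale continuous_in_L2_pi Y(1))
  obtain w where w: "w \<in> dirac_dom \<alpha> \<beta>" "AE x in M_pi. dirac \<mu> v w x = of_real z *s Y x"
    using zero_solvable[OF zY] by blast
  \<comment> \<open>\<open>D\<close> measures how far the rank one terms of \<open>w\<close> and of
    the formal series differ; pairing with \<open>v\<close> yields
    \<open>D * pert c m 0 = 0\<close>.\<close>
  define D where "D = of_real \<mu> * (L2_inner w v - C)"
  have diff: "fcoef \<alpha> \<beta> w k - s k = - D * vk k / of_real (eig0 \<alpha> \<beta> k)" for k
  proof -
    have "of_real (eig0 \<alpha> \<beta> k) * fcoef \<alpha> \<beta> w k + of_real \<mu> * L2_inner w v * vk k = of_real z * s k"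
      using zero_solution_fcoef[OF w(1) zY w(2), of k] by (simp add: fcoef_scale Y(2))
    then have "of_real (eig0 \<alpha> \<beta> k) * (fcoef \<alpha> \<beta> w k - s k) = - D * vk k"
      using eq[of k] by (simp add: D_def algebra_simps)
    then show ?thesis using eig0_ne[of k] by (metis nonzero_mult_div_cancel_left of_real_eq_0_iff)
  qed
  have "((\<lambda>k. of_real \<mu> * (fcoef \<alpha> \<beta> w k * cnj (vk k) - s k * cnj (vk k))) has_sum D) UNIV"
    unfolding D_def by (intro has_sum_cmult_right has_sum_difference dirac_dom_parseval eig0_ne w v C)
  moreover have "of_real \<mu> * (fcoef \<alpha> \<beta> w k * cnj (vk k) - s k * cnj (vk k)) =
      - D * (of_real \<mu> * (vk k * cnj (vk k)) / of_real (eig0 \<alpha> \<beta> k - 0))" for k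
    unfolding left_diff_distrib[symmetric] diff by simp
  moreover have "((\<lambda>k. - D * (of_real \<mu> * (vk k * cnj (vk k)) / of_real (eig0 \<alpha> \<beta> k - 0))) has_sum (- D * of_real (pert c m 0 - 1))) UNIV"
    by (intro has_sum_cmult_right pert_has_sum_complex)
  ultimately have "D = - D * of_real (pert c m 0 - 1)" using has_sum_unique by fastforce
  then have "D * of_real (pert c m 0) = 0" by (simp add: algebra_simps)
  then have "D = 0" using pert_0_nonzero by simp
  then have coef: "fcoef \<alpha> \<beta> w k = s k" for k using diff[of k] by simp
  have "w x = Y x" if "x \<in> {0..pi}" for x
    by (rule continuous_eqI_fcoef[where \<alpha> = \<alpha> and \<beta> = \<beta>, OF dirac_dom_continuous[OF w(1)] Y(1) _ that]) (simp add: coef Y(2))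
  then have "AE x in M_pi. Y x = w x" by (intro AE_I2) simp
  with w(2) have "AE x in M_pi. dirac \<mu> v w x = of_real z *s w x" by eventually_elim simp
  then show ?thesis using w(1) coef by (auto simp: dirac_eigenspace_def)
qed

text \<open>For an unmoved index the eigenfunction is the free one. For a moved index it is the free
  resolvent applied to \<open>v\<close>, up to a factor; at \<open>z = ev k\<close> a denominator
  can vanish only where \<open>m j = 0\<close>, and there \<open>vk j = 0\<close>, so the quotient
  is 0.\<close>

definition eigencoef :: "real \<Rightarrow> int \<Rightarrow> int \<Rightarrow> complex" where
  "eigencoef z k j = (if m k = 0 then (if j = k then 1 else 0) else vk j / of_real (eig0 \<alpha> \<beta> j - z))"

lemma ex_eigenfunction_ev:
  "\<exists>w\<in>dirac_eigenspace \<alpha> \<beta> \<mu> v (of_real (ev k)). \<forall>j. fcoef \<alpha> \<beta> w j = eigencoef (ev k) k j"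
proof (cases "m k = 0")
  case True
  then have "ev k = eig0 \<alpha> \<beta> k" by (simp add: P.unperturbed eig0_eq_pt)
  have sum: "((\<lambda>j. (if j = k then 1 else 0) * f j) has_sum f k) UNIV" for f :: "int \<Rightarrow> 'b::real_normed_field"
  proof (rule has_sum_cong_neutral[THEN iffD1])
    show "(f has_sum f k) {k}" by (rule has_sum_finiteI) auto
  qed auto
  have "\<exists>w\<in>dirac_eigenspace \<alpha> \<beta> \<mu> v (of_real (ev k)). \<forall>j. fcoef \<alpha> \<beta> w j = (if j = k then 1 else 0)"
  proof (rule ex_eigenfunction)
    show "(\<lambda>j. cmod (if j = k then 1 else 0)) summable_on UNIV"
      using has_sum_imp_summable[OF sum[of "\<lambda>_. 1::real"]] by (simp add: if_distrib[of cmod] cong: if_cong)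
    show "((\<lambda>j. (if j = k then 1 else 0) * cnj (vk j)) has_sum cnj (vk k)) UNIV" by (rule sum)
    show "of_real (eig0 \<alpha> \<beta> j - ev k) * (if j = k then 1 else 0) = - (of_real \<mu> * cnj (vk k) * vk j)" for j
      using True \<open>ev k = eig0 \<alpha> \<beta> k\<close> by (auto simp: mass_eq_0_iff)
  qed
  with True show ?thesis by (simp add: eigencoef_def)
next
  case False
  then have "\<mu> \<noteq> 0" by (simp add: mass_eq_0_iff)
  have "\<exists>w\<in>dirac_eigenspace \<alpha> \<beta> \<mu> v (of_real (ev k)). \<forall>j. fcoef \<alpha> \<beta> w j = vk j / of_real (eig0 \<alpha> \<beta> j - ev k)"
  proof (rule ex_eigenfunction)
    have "eig0 \<alpha> \<beta> j - ev k = pt (c - ev k) j" for j by (simp add: eig0_eq_pt pt_def)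
    then show "(\<lambda>j. cmod (vk j / of_real (eig0 \<alpha> \<beta> j - ev k))) summable_on UNIV"
      using abs_summable_div_pt[OF fcoef_square_summable[OF v]] by simp
    have "((\<lambda>j. inverse (of_real \<mu>) * (of_real \<mu> * (vk j * cnj (vk j)) / of_real (eig0 \<alpha> \<beta> j - ev k)))
        has_sum (inverse (of_real \<mu>) * of_real (pert c m (ev k) - 1))) UNIV"
      by (intro has_sum_cmult_right pert_has_sum_complex)
    \<comment> \<open>The pairing with \<open>v\<close> is \<open>- inverse \<mu>\<close> because
      the perturbation function vanishes at \<open>ev k\<close>.\<close>
    then show "((\<lambda>j. vk j / of_real (eig0 \<alpha> \<beta> j - ev k) * cnj (vk j)) has_sum (- inverse (of_real \<mu>))) UNIV"
      using \<open>\<mu> \<noteq> 0\<close> P.root[OF False] by (simp add: field_simps)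
    show "of_real (eig0 \<alpha> \<beta> j - ev k) * (vk j / of_real (eig0 \<alpha> \<beta> j - ev k)) = - (of_real \<mu> * - inverse (of_real \<mu>) * vk j)" for j
    proof (cases "eig0 \<alpha> \<beta> j = ev k")
      case True
      then have "m j = 0" using P.not_pole[OF False, of j] by (auto simp: eig0_eq_pt)
      then show ?thesis using \<open>\<mu> \<noteq> 0\<close> by (simp add: mass_eq_0_iff)
    qed (use \<open>\<mu> \<noteq> 0\<close> in simp)
  qed
  with False show ?thesis by (simp add: eigencoef_def)
qed

lemma eigencoef_diagonal: "eigencoef (ev k) k k \<noteq> 0"
  using P.not_pole[of k k] by (auto simp: eigencoef_def mass_eq_0_iff eig0_eq_pt)

text \<open>At most one index of an eigenvalue carries mass, and next to it the massless ones have
  \<open>vk j = 0\<close>. So on the indices of one eigenvalue the coefficient matrix is diagonal,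
  which gives independence and lets coefficients be prescribed there.\<close>

lemma eigencoef_off_diagonal:
  assumes "ev j = ev k" "j \<noteq> k"
  shows "eigencoef (ev k) k j = 0"
proof (cases "m k = 0")
  case False
  then have "m j = 0" using P.root_inj[of j k] assms by auto
  with False show ?thesis by (auto simp: eigencoef_def mass_eq_0_iff)
qed (use assms in \<open>simp add: eigencoef_def\<close>)

text \<open>If \<open>\<mu> * C\<close> is not 0, pairing with \<open>v\<close> makes
  \<open>z\<close> a root of the perturbation function, hence a moved point \<open>ev k\<close>,
  whose coefficient would not be 0. If it is 0, \<open>t\<close> lives on the at most one index with
  \<open>eig0 = z\<close>; this index is unmoved or carries mass, and in the latter case
  \<open>C\<close> is a nonzero multiple of \<open>t k\<close>.\<close>

lemma eigenfunction_coef_unique: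
  fixes t :: "int \<Rightarrow> complex" and z :: real
  assumes C: "((\<lambda>k. t k * cnj (vk k)) has_sum C) UNIV"
    and eq: "\<And>k. of_real (eig0 \<alpha> \<beta> k - z) * t k = - (of_real \<mu> * C * vk k)"
    and zero: "\<And>k. ev k = z \<Longrightarrow> t k = 0"
  shows "t k = 0"
proof -
  have sol: "t k = - (of_real \<mu> * C * vk k) / of_real (eig0 \<alpha> \<beta> k - z)" if "eig0 \<alpha> \<beta> k \<noteq> z" for k
    using eq[of k] that by (metis nonzero_mult_div_cancel_left of_real_eq_0_iff right_minus_eq)
  have "of_real \<mu> * C = 0"
  proof (rule ccontr)
    assume ne: "of_real \<mu> * C \<noteq> 0"
    have vk0: "vk k = 0" if "eig0 \<alpha> \<beta> k = z" for k
      using eq[of k] that ne by simp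
    have "((\<lambda>k. of_real \<mu> * (t k * cnj (vk k))) has_sum (of_real \<mu> * C)) UNIV"
      by (intro has_sum_cmult_right C)
    moreover have "of_real \<mu> * (t k * cnj (vk k)) =
        - (of_real \<mu> * C) * (of_real \<mu> * (vk k * cnj (vk k)) / of_real (eig0 \<alpha> \<beta> k - z))" for k
      using sol[of k] vk0[of k] by (cases "eig0 \<alpha> \<beta> k = z") auto
    moreover have "((\<lambda>k. - (of_real \<mu> * C) * (of_real \<mu> * (vk k * cnj (vk k)) / of_real (eig0 \<alpha> \<beta> k - z)))
        has_sum (- (of_real \<mu> * C) * of_real (pert c m z - 1))) UNIV"
      by (intro has_sum_cmult_right pert_has_sum_complex)
    ultimately have "of_real \<mu> * C = - (of_real \<mu> * C) * of_real (pert c m z - 1)"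
      using has_sum_unique by fastforce
    then have "(of_real \<mu> * C) * of_real (pert c m z) = 0" by (simp add: algebra_simps)
    then have "pert c m z = 0" using ne by simp
    moreover have "z \<noteq> pt c j" if "m j \<noteq> 0" for j
      using vk0[of j] that by (auto simp: eig0_eq_pt mass_eq_0_iff)
    ultimately obtain k where k: "m k \<noteq> 0" "ev k = z" using P.ex_root by blast
    then have "eig0 \<alpha> \<beta> k \<noteq> z" using P.not_pole[of k k] by (auto simp: eig0_eq_pt)
    then show False using sol[of k] zero[OF k(2)] k(1) ne by (simp add: mass_eq_0_iff)
  qed
  then have off: "t k = 0" if "eig0 \<alpha> \<beta> k \<noteq> z" for k using sol[OF that] by simp
  show ?thesis
  proof (cases "eig0 \<alpha> \<beta> k = z \<and> m k \<noteq> 0")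
    case True
    have "((\<lambda>j. t j * cnj (vk j)) has_sum (t k * cnj (vk k))) UNIV"
    proof (rule has_sum_cong_neutral[THEN iffD1])
      show "((\<lambda>j. t j * cnj (vk j)) has_sum (t k * cnj (vk k))) {k}" by (rule has_sum_finiteI) auto
      show "t j * cnj (vk j) = 0" if "j \<in> UNIV - {k}" for j
        using off[of j] that True by (auto simp: eig0_eq_pt)
    qed auto
    then have "C = t k * cnj (vk k)" using has_sum_unique[OF C] by blast
    then show ?thesis using \<open>of_real \<mu> * C = 0\<close> True by (simp add: mass_eq_0_iff)
  next
    case False
    then show ?thesis using off[of k] zero[of k] P.unperturbed[of k] by (auto simp: eig0_eq_pt)
  qed
qed

lemma sum_fun_scale_apply: "(\<Sum>k\<in>K. fun_scale (r k) (e k)) = (\<lambda>x. \<Sum>k\<in>K. r k *s e k x)"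
  by (induction K rule: infinite_finite_induct) (auto simp: fun_scale_def fun_eq_iff)

text \<open>The eigenfunctions with coefficients \<open>eigencoef\<close> form a basis. For
  spanning, the combination with the same coefficients on \<open>K\<close> is subtracted and
  \<open>eigenfunction_coef_unique\<close> disposes of the rest.\<close>

theorem dirac_mult_eq_card: "dirac_mult \<alpha> \<beta> \<mu> v (of_real z) = card {k. ev k = z}"
proof -
  interpret VS: vector_space fun_scale by (rule vector_space_fun_scale)
  define K where "K = {k. ev k = z}"
  let ?E = "dirac_eigenspace \<alpha> \<beta> \<mu> v (of_real z)"
  have "finite K" unfolding K_def by (rule P.finite_fibre)
  have "\<forall>k. \<exists>w. k \<in> K \<longrightarrow> w \<in> ?E \<and> (\<forall>j. fcoef \<alpha> \<beta> w j = eigencoef z k j)"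
    using ex_eigenfunction_ev by (auto simp: K_def)
  then obtain e where "\<forall>k. k \<in> K \<longrightarrow> e k \<in> ?E \<and> (\<forall>j. fcoef \<alpha> \<beta> (e k) j = eigencoef z k j)"
    using choice[of "\<lambda>k w. k \<in> K \<longrightarrow> w \<in> ?E \<and> (\<forall>j. fcoef \<alpha> \<beta> w j = eigencoef z k j)"] by blast
  then have e: "e k \<in> ?E" "fcoef \<alpha> \<beta> (e k) j = eigencoef z k j" if "k \<in> K" for k j using that by auto
  have dom: "y \<in> dirac_dom \<alpha> \<beta>" if "y \<in> ?E" for y using that by (simp add: dirac_eigenspace_def)
  have diag: "eigencoef z k k \<noteq> 0" if "k \<in> K" for k using that eigencoef_diagonal by (auto simp: K_def)
  have off: "eigencoef z k j = 0" if "k \<in> K" "j \<in> K" "j \<noteq> k" for j k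
    using that eigencoef_off_diagonal[of j k] by (auto simp: K_def)
  have inj: "inj_on e K"
  proof (rule inj_onI)
    fix j k assume "j \<in> K" "k \<in> K" "e j = e k"
    then show "j = k" using e(2)[of j k] e(2)[of k k] diag[of k] off[of j k] by auto
  qed
  have e_L2: "e k \<in> L2_pi" if "k \<in> K" for k
    by (rule dirac_dom_L2[OF dom[OF e(1)[OF that]]])
  have comb_coef: "fcoef \<alpha> \<beta> (\<lambda>x. \<Sum>k\<in>K. r k *s e k x) j = (\<Sum>k\<in>K. r k * eigencoef z k j)" for r j
    by (subst fcoef_sum) (auto intro!: L2_pi_scale e_L2 sum.cong simp: fcoef_scale e(2))
  have comb_coef_K: "(\<Sum>k\<in>K. r k * eigencoef z k j) = r j * eigencoef z j j" if "j \<in> K" for r j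
    using \<open>finite K\<close> that by (subst sum.remove[of _ j]) (auto intro!: sum.neutral simp: off)
  have indep: "VS.independent (e ` K)"
    unfolding VS.dependent_finite[OF finite_imageI[OF \<open>finite K\<close>]]
  proof (clarsimp)
    fix u k assume k: "k \<in> K" "u (e k) \<noteq> 0" and sum: "(\<Sum>y\<in>e ` K. fun_scale (u y) y) = 0"
    have "(\<Sum>k\<in>K. fun_scale (u (e k)) (e k)) = 0"
      using sum by (simp add: sum.reindex[OF inj])
    then have "(\<lambda>x. \<Sum>k\<in>K. u (e k) *s e k x) = (\<lambda>x. 0)"
      by (simp only: sum_fun_scale_apply zero_fun_def)
    then have "(\<Sum>i\<in>K. u (e i) * eigencoef z i k) = fcoef \<alpha> \<beta> (\<lambda>x. 0) k"
      using comb_coef[of "\<lambda>k. u (e k)" k] by simp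
    also have "\<dots> = 0" by (simp add: fcoef_def L2_inner_def cinner2_def)
    finally show False using comb_coef_K[OF k(1), of "\<lambda>k. u (e k)"] diag[OF k(1)] k(2) by simp
  qed
  have "?E \<subseteq> VS.span (e ` K)"
  proof
    fix y assume y: "y \<in> ?E"
    define r where "r k = fcoef \<alpha> \<beta> y k / eigencoef z k k" for k
    define s where "s = (\<lambda>x. \<Sum>k\<in>K. r k *s e k x)"
    define t where "t k = fcoef \<alpha> \<beta> y k - fcoef \<alpha> \<beta> s k" for k
    have eqn: "of_real (eig0 \<alpha> \<beta> k - z) * fcoef \<alpha> \<beta> w k = - (of_real \<mu> * L2_inner w v * vk k)" if w: "w \<in> ?E" for w k
    proof -
      have "fcoef \<alpha> \<beta> (dirac \<mu> v w) k = fcoef \<alpha> \<beta> (\<lambda>x. of_real z *s w x) k"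
        using w by (intro fcoef_cong_AE dirac_L2[OF v dom] L2_pi_scale dirac_dom_L2[OF dom]) (auto simp: dirac_eigenspace_def)
      then show ?thesis by (simp add: fcoef_dirac[OF v dom[OF w]] fcoef_scale algebra_simps add_eq_0_iff)
    qed
    have ts: "t k = fcoef \<alpha> \<beta> y k - (\<Sum>i\<in>K. r i * fcoef \<alpha> \<beta> (e i) k)" for k
      by (simp add: t_def s_def comb_coef e(2))
    define C where "C = L2_inner y v - (\<Sum>i\<in>K. r i * L2_inner (e i) v)"
    have "t k = 0" for k
    proof (rule eigenfunction_coef_unique)
      have "((\<lambda>k. fcoef \<alpha> \<beta> y k * cnj (vk k) - (\<Sum>i\<in>K. r i * (fcoef \<alpha> \<beta> (e i) k * cnj (vk k)))) has_sum C) UNIV"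
        unfolding C_def
        by (intro has_sum_difference has_sum_finite_sum has_sum_cmult_right dirac_dom_parseval eig0_ne v dom e y)
      then show "((\<lambda>k. t k * cnj (vk k)) has_sum C) UNIV"
        by (simp add: ts left_diff_distrib sum_distrib_right mult.assoc)
      show "of_real (eig0 \<alpha> \<beta> k - z) * t k = - (of_real \<mu> * C * vk k)" for k
      proof -
        have "of_real (eig0 \<alpha> \<beta> k - z) * t k = of_real (eig0 \<alpha> \<beta> k - z) * fcoef \<alpha> \<beta> y k -
            (\<Sum>i\<in>K. r i * (of_real (eig0 \<alpha> \<beta> k - z) * fcoef \<alpha> \<beta> (e i) k))"
          by (simp only: ts right_diff_distrib sum_distrib_left mult.left_commute)
        also have "\<dots> = - (of_real \<mu> * L2_inner y v * vk k) - (\<Sum>i\<in>K. r i * - (of_real \<mu> * L2_inner (e i) v * vk k))"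
          using eqn[OF y] eqn[OF e(1)] by (intro arg_cong2[where f = "(-)"] sum.cong) auto
        also have "\<dots> = - (of_real \<mu> * C * vk k)"
          by (simp add: C_def sum_negf algebra_simps sum_distrib_left sum_distrib_right)
        finally show ?thesis .
      qed
      show "t k = 0" if "ev k = z" for k
      proof -
        have "k \<in> K" using that by (simp add: K_def)
        then show ?thesis
          unfolding t_def s_def comb_coef by (subst comb_coef_K) (use diag in \<open>simp_all add: r_def\<close>)
      qed
    qed
    then have coef: "fcoef \<alpha> \<beta> y k = fcoef \<alpha> \<beta> s k" for k by (simp add: t_def)
    have "y x = s x" for x
    proof (cases "x \<in> {0..pi}")
      case True
      have "continuous_on {0..pi} s"
        unfolding s_def
        by (intro continuous_on_sum continuous_on_scale_complex2 continuous_on_const dirac_dom_continuous[OF dom] e)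
      then show ?thesis by (rule continuous_eqI_fcoef[OF dirac_dom_continuous[OF dom[OF y]] _ coef True])
    next
      case False
      \<comment> \<open>The extension by 0 built into the domain turns equality on
        \<open>{0..pi}\<close> into equality of functions.\<close>
      have out: "w x = 0" if "w \<in> ?E" for w using dom[OF that] False by (simp add: dirac_dom_def)
      have "s x = 0" unfolding s_def by (intro sum.neutral) (simp add: out[OF e(1)])
      then show ?thesis by (simp add: out[OF y])
    qed
    then have "y = (\<Sum>k\<in>K. fun_scale (r k) (e k))"
      by (auto simp: sum_fun_scale_apply s_def)
    also have "\<dots> \<in> VS.span (e ` K)"
      by (intro VS.span_sum VS.span_scale VS.span_base) auto
    finally show "y \<in> VS.span (e ` K)" .
  qed
  moreover have "e ` K \<subseteq> VS.span ?E" using e(1) VS.span_base by blast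
  ultimately have "VS.span (e ` K) = VS.span ?E"
    unfolding VS.span_eq by blast
  then have "VS.dim ?E = card (e ` K)" using indep by (rule VS.dim_eq_card)
  then have "dirac_mult \<alpha> \<beta> \<mu> v (of_real z) = card K"
    by (simp only: dirac_mult_def card_image[OF inj])
  then show ?thesis by (simp only: K_def)
qed

end

theorem theorem3p2:
  fixes \<alpha> \<beta> \<mu> :: real and v :: "real \<Rightarrow> complex ^ 2"
  assumes "sin (\<beta> - \<alpha>) \<noteq> 0"
    and "v \<in> L2_pi"
    and "0 \<notin> dirac_spectrum \<alpha> \<beta> \<mu> v"
  shows "(\<forall>\<mu>' v'. v' \<in> L2_pi \<and> same_spectrum_with_mult \<alpha> \<beta> \<mu> v \<mu>' v' \<longrightarrow>
            (\<forall>k. \<mu> * (cmod (fcoef \<alpha> \<beta> v k))\<^sup>2 = \<mu>' * (cmod (fcoef \<alpha> \<beta> v' k))\<^sup>2)) \<and>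
         (\<exists>(G :: real \<Rightarrow> complex) L A.
            (\<forall>y>0. has_vp_prod
               (\<lambda>k. (1 - \<i> * of_real y / of_real (eig0 \<alpha> \<beta> k)) /
                    (1 - \<i> * of_real y / of_real (eig \<alpha> \<beta> \<mu> v k))) UNIV (G y)) \<and>
            (G \<longlongrightarrow> L) at_top \<and>
            A = of_real (sin (\<beta> - \<alpha>)) * L \<and>
            (\<forall>p. \<exists>P :: real.
               has_vp_prod
                 (\<lambda>k. eig0 \<alpha> \<beta> k / eig \<alpha> \<beta> \<mu> v k *
                      (1 + (eig \<alpha> \<beta> \<mu> v k - eig0 \<alpha> \<beta> k) / (eig0 \<alpha> \<beta> k - eig0 \<alpha> \<beta> p)))
                 (- {p}) P \<and>
               complex_of_real (\<mu> * (cmod (fcoef \<alpha> \<beta> v p))\<^sup>2) =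
                 A / of_real (sin (\<beta> - \<alpha>)) *
                 of_real (eig0 \<alpha> \<beta> p / eig \<alpha> \<beta> \<mu> v p * (eig \<alpha> \<beta> \<mu> v p - eig0 \<alpha> \<beta> p)) *
                 of_real P))"
proof -
  \<comment> \<open>The sine vanishes exactly when 0 is one of the free eigenvalues.\<close>
  have eig0_ne: "eig0 \<alpha> \<beta> k \<noteq> 0" for k
  proof
    assume "eig0 \<alpha> \<beta> k = 0"
    then have "\<beta> - \<alpha> = of_int k * pi" by (simp add: eig0_def field_simps)
    then have "sin (\<beta> - \<alpha>) = 0" unfolding sin_zero_iff_int2 by blast
    with assms(1) show False by simp
  qed
  interpret D: dirac_zero_resolvent \<alpha> \<beta> \<mu> v
    by unfold_locales (use assms eig0_ne in auto)
  have unique: "\<forall>\<mu>' v'. v' \<in> L2_pi \<and> same_spectrum_with_mult \<alpha> \<beta> \<mu> v \<mu>' v' \<longrightarrow>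
            (\<forall>k. \<mu> * (cmod (fcoef \<alpha> \<beta> v k))\<^sup>2 = \<mu>' * (cmod (fcoef \<alpha> \<beta> v' k))\<^sup>2)"
  proof (intro allI impI)
    fix \<mu>' v' k
    assume v': "v' \<in> L2_pi \<and> same_spectrum_with_mult \<alpha> \<beta> \<mu> v \<mu>' v'"
    then have spec: "dirac_spectrum \<alpha> \<beta> \<mu> v = dirac_spectrum \<alpha> \<beta> \<mu>' v'"
      and mult: "\<And>z. z \<in> dirac_spectrum \<alpha> \<beta> \<mu> v \<Longrightarrow> dirac_mult \<alpha> \<beta> \<mu> v z = dirac_mult \<alpha> \<beta> \<mu>' v' z"
      by (auto simp: same_spectrum_with_mult_def)
    \<comment> \<open>Equality of the spectra puts 0 into the resolvent set of the second operator
      as well.\<close>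
    interpret D': dirac_zero_resolvent \<alpha> \<beta> \<mu>' v'
      by unfold_locales (use assms eig0_ne v' spec in auto)
    have "card {k. eig \<alpha> \<beta> \<mu> v k = z} = card {k. eig \<alpha> \<beta> \<mu>' v' k = z}" for z
      unfolding D.dirac_mult_eq_card[symmetric] D'.dirac_mult_eq_card[symmetric]
      using mult dirac_mult_outside_spectrum spec by (cases "of_real z \<in> dirac_spectrum \<alpha> \<beta> \<mu> v") auto
    from perturbed_points_masses_unique[OF D.P.perturbed_points_axioms D'.P.perturbed_points_axioms this, of k]
    show "\<mu> * (cmod (fcoef \<alpha> \<beta> v k))\<^sup>2 = \<mu>' * (cmod (fcoef \<alpha> \<beta> v' k))\<^sup>2"
      by (simp add: mass_def)
  qed
  let ?c = "(\<alpha> - \<beta>) / pi" and ?m = "mass \<alpha> \<beta> \<mu> v"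
  have pt_ne: "pt ?c k \<noteq> 0" for k using eig0_ne[of k] by (simp add: eig0_eq_pt)
  \<comment> \<open>\<open>G y\<close> is the quotient of the values of the perturbation function at
    0 and at \<open>\<i> * y\<close>; its limit, and with it
    \<open>A / sin (\<beta> - \<alpha>)\<close>, is the value at 0.\<close>
  define L where "L = complex_of_real (pert ?c ?m 0)"
  define G where "G y = L / pert ?c ?m (\<i> * of_real y)" for y
  have formula: "\<exists>(G :: real \<Rightarrow> complex) L A.
            (\<forall>y>0. has_vp_prod
               (\<lambda>k. (1 - \<i> * of_real y / of_real (eig0 \<alpha> \<beta> k)) /
                    (1 - \<i> * of_real y / of_real (eig \<alpha> \<beta> \<mu> v k))) UNIV (G y)) \<and>
            (G \<longlongrightarrow> L) at_top \<and>
            A = of_real (sin (\<beta> - \<alpha>)) * L \<and>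
            (\<forall>p. \<exists>P :: real.
               has_vp_prod
                 (\<lambda>k. eig0 \<alpha> \<beta> k / eig \<alpha> \<beta> \<mu> v k *
                      (1 + (eig \<alpha> \<beta> \<mu> v k - eig0 \<alpha> \<beta> k) / (eig0 \<alpha> \<beta> k - eig0 \<alpha> \<beta> p)))
                 (- {p}) P \<and>
               complex_of_real (\<mu> * (cmod (fcoef \<alpha> \<beta> v p))\<^sup>2) =
                 A / of_real (sin (\<beta> - \<alpha>)) *
                 of_real (eig0 \<alpha> \<beta> p / eig \<alpha> \<beta> \<mu> v p * (eig \<alpha> \<beta> \<mu> v p - eig0 \<alpha> \<beta> p)) *
                 of_real P)"
  proof (rule exI[of _ G], rule exI[of _ L], rule exI[of _ "of_real (sin (\<beta> - \<alpha>)) * L"], intro conjI allI impI refl)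
    fix y :: real assume "y > 0"
    then have "\<i> * of_real y \<notin> \<real>" by (simp add: complex_is_Real_iff)
    from D.P.vp_prod_ratio[OF pt_ne D.ev_nonzero this]
    show "has_vp_prod (\<lambda>k. (1 - \<i> * of_real y / of_real (eig0 \<alpha> \<beta> k)) /
                    (1 - \<i> * of_real y / of_real (eig \<alpha> \<beta> \<mu> v k))) UNIV (G y)"
      by (simp add: has_vp_prod_def G_def L_def eig0_eq_pt)
  next
    have "(G \<longlongrightarrow> L / 1) at_top"
      unfolding G_def by (intro tendsto_divide tendsto_const D.P.pert_imaginary_tendsto) simp
    then show "(G \<longlongrightarrow> L) at_top" by simp
  next
    fix p
    obtain P where P: "(\<lambda>n::nat. \<Prod>k\<in>{- int n..int n} \<inter> - {p}. pt ?c k / eig \<alpha> \<beta> \<mu> v k *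
          (1 + (eig \<alpha> \<beta> \<mu> v k - pt ?c k) / (pt ?c k - pt ?c p))) \<longlonglongrightarrow> P"
      "?m p = pert ?c ?m 0 * (pt ?c p / eig \<alpha> \<beta> \<mu> v p * (eig \<alpha> \<beta> \<mu> v p - pt ?c p)) * P"
      using D.P.vp_prod_mass[OF pt_ne D.ev_nonzero D.pert_0_nonzero] by blast
    have "complex_of_real (?m p) = of_real (sin (\<beta> - \<alpha>)) * L / of_real (sin (\<beta> - \<alpha>)) *
        of_real (pt ?c p / eig \<alpha> \<beta> \<mu> v p * (eig \<alpha> \<beta> \<mu> v p - pt ?c p)) * of_real P"
      unfolding P(2) L_def using assms(1) by simp
    with P(1) show "\<exists>P :: real.
               has_vp_prod
                 (\<lambda>k. eig0 \<alpha> \<beta> k / eig \<alpha> \<beta> \<mu> v k *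
                      (1 + (eig \<alpha> \<beta> \<mu> v k - eig0 \<alpha> \<beta> k) / (eig0 \<alpha> \<beta> k - eig0 \<alpha> \<beta> p)))
                 (- {p}) P \<and>
               complex_of_real (\<mu> * (cmod (fcoef \<alpha> \<beta> v p))\<^sup>2) =
                 of_real (sin (\<beta> - \<alpha>)) * L / of_real (sin (\<beta> - \<alpha>)) *
                 of_real (eig0 \<alpha> \<beta> p / eig \<alpha> \<beta> \<mu> v p * (eig \<alpha> \<beta> \<mu> v p - eig0 \<alpha> \<beta> p)) *
                 of_real P"
      unfolding has_vp_prod_def eig0_eq_pt mass_def by blast
  qed
  from unique formula show ?thesis by (rule conjI)
qed

end
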